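(* Let $n\ge 1$ be an integer. Let $\mathcal{A}_n$ be the quantum cluster algebra over $\mathbb{Z}[q^{\pm1/2}]$ associated with the compatible pair $(\Lambda_n,\widetilde{B}_n)$, with initial extended quantum cluster $(Y_1,\dots,Y_{n+1})$ (frozen variable $Y_{n+1}$). For $0\le i\le n-1$ let $X_{2i}=\mu_{n-i}(Y_{n-i})$ be the quantum cluster variable which replaces $Y_{n-i}$ when the initial quantum seed is mutated in direction $n-i$, and let $X_{2n}=Y_1$. Let $Rep_{t,n}$ be the deformed Grothendieck ring of the category $\mathcal{C}_n$ of finite-dimensional representations of $U_q(\widehat{sl_2})$, with generators $[W_{1,0}],[W_{1,2}],\dots,[W_{1,2n}]$. Then the assignment $$X_{i}\mapsto [W_{1,i}]\qquad (i\in\{0,2,4,\dots,2n\})$$ extends to a ($\mathbb{Z}[q^{\pm1/2}]$-linear) ring isomorphism $\iota_n:\mathcal{A}_n\to Rep_{t,n}$.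
   Context: **Compatible pairs and their mutation.** Let $\widetilde{B}=(b_{ij})$ be an $m\times n$ integer matrix with rows labeled by $[1,m]=\{1,\dots,m\}$ and columns labeled by an $n$-element subset $\mathbf{ex}\subset[1,m]$, and let $\Lambda=(\lambda_{ij})$ be a skew-symmetric $m\times m$ integer matrix. The pair $(\Lambda,\widetilde{B})$ is compatible if for all $j\in\mathbf{ex}$, $i\in[1,m]$ one has $\sum_{k=1}^m b_{kj}\lambda_{ki}=\delta_{ij}d_j$ for some integers $d_j$. For $k\in\mathbf{ex}$ and a sign $\varepsilon\in\{\pm1\}$, the mutation of $(\Lambda,\widetilde{B})$ in direction $k$ is $(\Lambda',\widetilde{B}')=(E_\varepsilon^T\Lambda E_\varepsilon,\;E_\varepsilon\widetilde{B}F_\varepsilon)$ (it does not depend on $\varepsilon$), where $E_\varepsilon$ is the $m\times m$ matrix with $e_{ij}=\delta_{ij}$ if $j\ne k$, $e_{kk}=-1$, $e_{ik}=\max(0,-\varepsilon b_{ik})$ if $i\neq k$; and $F_\varepsilon$ is the matrix with rows and columns labeled by $\mathbf{ex}$ with $f_{ij}=\delta_{ij}$ if $i\neq k$, $f_{kk}=-1$, $f_{kj}=\max(0,\varepsilon b_{kj})$ if $j\ne k$. **Quantum seeds.** Here $q$ (in the coefficient ring $\mathbb{Z}[q^{\pm1/2}]$) is a formal variable. For a lattice $L$ of rank $m$ with a skew-symmetric bilinear form $\Lambda:L\times L\to\mathbb{Z}$, the based quantum torus $T(\Lambda)$ is the $\mathbb{Z}[q^{\pm1/2}]$-algebra with basis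 $\{X^e: e\in L\}$ and product $X^eX^f=q^{\Lambda(e,f)/2}X^{e+f}$. Let $F$ be its skew-field of fractions. A toric frame in $F$ is a map $M:\mathbb{Z}^m\to F\setminus\{0\}$, $M(c)=\varphi(X^{\eta(c)})$, with $\varphi$ an automorphism of $F$ and $\eta:\mathbb{Z}^m\to L$ a lattice isomorphism. Then $M(c)M(d)=q^{\Lambda_M(c,d)/2}M(c+d)$ for a skew-symmetric form $\Lambda_M$ on $\mathbb{Z}^m$, identified with its matrix $(\lambda_{ij})$ in the standard basis $e_1,\dots,e_m$; $M$ is determined by the elements $X_i=M(e_i)$ through $M(c)=q^{\frac12\sum_{l<k}c_kc_l\lambda_{kl}}X_1^{c_1}\cdots X_m^{c_m}$. A quantum seed is a pair $(M,\widetilde{B})$ with $M$ a toric frame and $(\Lambda_M,\widetilde{B})$ compatible. Its mutation in direction $k\in\mathbf{ex}$ is the quantum seed $(M',\widetilde{B}')$ where $(\Lambda_{M'},\widetilde{B}')$ is the mutation of $(\Lambda_M,\widetilde{B})$ in direction $k$, and $X_i'=M'(e_i)$ are given by $X_i'=X_i$ for $i\neq k$ and $$X_k'=M\Big(-e_k+\sum_{b_{ik}>0}b_{ik}e_i\Big)+M\Big(-e_k-\sum_{b_{ik}<0}b_{ik}e_i\Big).$$ The cluster of $(M,\widetilde{B})$ is $\{X_j: j\in\mathbf{ex}\}$; its elements are called quantum cluster variables. The elements $X_j$, $j\notin\mathbf{ex}$, are the frozen variables and are unchanged by mutation. The quantum cluster algebra associated with a mutation-equivalence class of quantum seeds is the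 $\mathbb{Z}[q^{\pm1/2}]$-subalgebra of $F$ generated by the union of the clusters of all seeds in the class together with the frozen variables (inverses of frozen variables are not adjoined). **The pair $(\Lambda_n,\widetilde{B}_n)$.** Here $m=n+1$, $\mathbf{ex}=[1,n]$, and the index $n+1$ is frozen. $\widetilde{B}_n$ is the $(n+1)\times n$ matrix of the quiver $n+1\to n\to\cdots\to 1$: $b_{i+1,i}=1$ for $1\le i\le n$, $b_{i,i+1}=-1$ for $1\le i\le n-1$, and all other entries are $0$. $\Lambda_n=(\lambda_{ij})$ is the skew-symmetric $(n+1)\times(n+1)$ matrix such that, for $j>i$, $\lambda_{ij}=-1$ if $i$ is odd and $j$ is even, and $\lambda_{ij}=0$ otherwise. The pair is compatible. The initial quantum seed is $(M,\widetilde{B}_n)$ with $M(e_i)=Y_i$ and $\Lambda_M=\Lambda_n$, so $Y_iY_j=q^{\lambda_{ij}}Y_jY_i$, in the skew-field $F$ of fractions of the quantum torus generated by $Y_1^{\pm1},\dots,Y_{n+1}^{\pm1}$. **The deformed Grothendieck ring.** Consider $U_q(\widehat{sl_2})$ (with parameter in $\mathbb{C}^*$, not a root of unity, here to be distinguished from the formal variable $q$ above) and its category $\mathcal{C}$ of finite-dimensional type 1 representations. $\mathcal{C}_n$ is the full subcategory of those $V$ such that the roots of the Drinfeld polynomials of every composition factor of $V$ belong to $\{q^{-2k}: 0\le k\le n\}$. $W_{1,2k}$ is the Kirillov–Reshetikhin module with highest $l$-weight $Y_{q^{2k}}$. The deformed Grothendieck ring $Rep_{t,n}$ of $\mathcal{C}_n$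 is (by a known theorem of Hernandez, taken here as its description) the associative unital $\mathbb{Z}[q^{\pm1/2}]$-algebra, with product $\ast$, presented by generators $[W_{1,0}],[W_{1,2}],\dots,[W_{1,2n}]$ and relations, for $l_1,l_2,l\in\{0,2,\dots,2n\}$, $$[W_{1,l_1}]\ast[W_{1,l_2}]=q^{r}\,[W_{1,l_2}]\ast[W_{1,l_1}],\quad r=(-1)^{(l_1-l_2)/2},\qquad\text{if } l_1>l_2 \text{ and } l_1\neq l_2+2,$$ $$[W_{1,l}]\ast[W_{1,l-2}]=q^{-1}[W_{1,l-2}]\ast[W_{1,l}]+(1-q^{-1})\qquad\text{for } l\ge 2.$$ *)

theory Defs
  imports "HOL-Algebra.Algebra" "HOL-Library.Poly_Mapping"
begin

section \<open>The coefficient ring and algebras spanned by a twisted monoid\<close>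

text \<open>
  Laurent polynomials over the integers in the square root of the formal variable \<open>q\<close>: the
  exponent \<open>a :: int\<close> stands for the power \<open>a/2\<close> of \<open>q\<close>.
\<close>

type_synonym laurent = "int \<Rightarrow>\<^sub>0 int"

definition q_half :: "int \<Rightarrow> laurent" where
  "q_half a = Poly_Mapping.single a 1"

definition q_pow :: "int \<Rightarrow> laurent" where
  "q_pow r = q_half (2 * r)"

text \<open>
  The free module over the coefficient ring with basis \<open>S\<close>, where basis elements multiply by
  \<open>X a * X b = c a b * X (opr a b)\<close> and \<open>X u\<close> is the unit.
\<close>

definition twisted_mult ::
  "('b \<Rightarrow> 'b \<Rightarrow> 'b) \<Rightarrow> ('b \<Rightarrow> 'b \<Rightarrow> laurent) \<Rightarrow>
   ('b \<Rightarrow>\<^sub>0 laurent) \<Rightarrow> ('b \<Rightarrow>\<^sub>0 laurent) \<Rightarrow> ('b \<Rightarrow>\<^sub>0 laurent)" where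
  "twisted_mult opr c f g =
     (\<Sum>a\<in>Poly_Mapping.keys f. \<Sum>b\<in>Poly_Mapping.keys g.
        Poly_Mapping.single (opr a b)
          (c a b * Poly_Mapping.lookup f a * Poly_Mapping.lookup g b))"

definition twisted_algebra ::
  "'b set \<Rightarrow> ('b \<Rightarrow> 'b \<Rightarrow> 'b) \<Rightarrow> 'b \<Rightarrow> ('b \<Rightarrow> 'b \<Rightarrow> laurent) \<Rightarrow> ('b \<Rightarrow>\<^sub>0 laurent) ring" where
  "twisted_algebra S opr u c =
     \<lparr>carrier = {f. Poly_Mapping.keys f \<subseteq> S},
      monoid.mult = twisted_mult opr c,
      monoid.one = Poly_Mapping.single u 1,
      ring.zero = 0,
      ring.add = (+)\<rparr>"

section \<open>Based quantum tori and their skew-fields of fractions\<close>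

text \<open>
  Vectors of rank \<open>m\<close> are finitely supported functions on \<open>nat\<close> with support in \<open>{1..m}\<close>;
  matrices are functions of two indices, of which only the entries in the stated range matter.
\<close>

type_synonym vec = "nat \<Rightarrow>\<^sub>0 int"
type_synonym matrix = "nat \<Rightarrow> nat \<Rightarrow> int"

definition lattice_of :: "nat \<Rightarrow> vec set" where
  "lattice_of m = {c. Poly_Mapping.keys c \<subseteq> {1..m}}"

definition unit_vec :: "nat \<Rightarrow> vec" where
  "unit_vec i = Poly_Mapping.single i 1"

definition bil_form :: "nat \<Rightarrow> matrix \<Rightarrow> vec \<Rightarrow> vec \<Rightarrow> int" where
  "bil_form m L e f =
     (\<Sum>i\<in>{1..m}. \<Sum>j\<in>{1..m}. Poly_Mapping.lookup e i * L i j * Poly_Mapping.lookup f j)"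

definition quantum_torus :: "nat \<Rightarrow> matrix \<Rightarrow> (vec \<Rightarrow>\<^sub>0 laurent) ring" where
  "quantum_torus m L =
     twisted_algebra (lattice_of m) (+) 0 (\<lambda>e f. q_half (bil_form m L e f))"

definition skew_field :: "'f ring \<Rightarrow> bool" where
  "skew_field F \<longleftrightarrow> Ring.ring F \<and> Units F = carrier F - {\<zero>\<^bsub>F\<^esub>}"

text \<open>The quantum torus is an Ore domain, so this determines \<open>(F, j)\<close> up to unique isomorphism.\<close>

definition skew_field_of_fractions :: "'t ring \<Rightarrow> 'f ring \<Rightarrow> ('t \<Rightarrow> 'f) \<Rightarrow> bool" where
  "skew_field_of_fractions T F j \<longleftrightarrow>
     skew_field F \<and> j \<in> ring_hom T F \<and> inj_on j (carrier T) \<and>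
     (\<forall>x\<in>carrier F. \<exists>a\<in>carrier T. \<exists>b\<in>carrier T - {\<zero>\<^bsub>T\<^esub>}. x = j a \<otimes>\<^bsub>F\<^esub> inv\<^bsub>F\<^esub> (j b))"

type_synonym 'f embedding = "(vec \<Rightarrow>\<^sub>0 laurent) \<Rightarrow> 'f"

definition torus_monom :: "'f embedding \<Rightarrow> vec \<Rightarrow> 'f" where
  "torus_monom j e = j (Poly_Mapping.single e 1)"

text \<open>The structure map of the coefficient ring into \<open>F\<close>.\<close>

definition coeff_in :: "'f embedding \<Rightarrow> laurent \<Rightarrow> 'f" where
  "coeff_in j c = j (Poly_Mapping.single 0 c)"

section \<open>Compatible pairs and matrix mutation\<close>

definition compatible_pair :: "nat \<Rightarrow> nat set \<Rightarrow> matrix \<Rightarrow> matrix \<Rightarrow> bool" where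
  "compatible_pair m ex L B \<longleftrightarrow>
     (\<forall>i\<in>{1..m}. \<forall>j\<in>{1..m}. L i j = - L j i) \<and>
     (\<exists>d :: nat \<Rightarrow> int. \<forall>j\<in>ex. \<forall>i\<in>{1..m}.
        (\<Sum>k\<in>{1..m}. B k j * L k i) = (if i = j then d j else 0))"

definition E_mat :: "int \<Rightarrow> nat \<Rightarrow> matrix \<Rightarrow> matrix" where
  "E_mat eps k B i j =
     (if j \<noteq> k then (if i = j then 1 else 0)
      else if i = k then - 1 else max 0 (- eps * B i k))"

definition F_mat :: "int \<Rightarrow> nat \<Rightarrow> matrix \<Rightarrow> matrix" where
  "F_mat eps k B i j =
     (if i \<noteq> k then (if i = j then 1 else 0)
      else if j = k then - 1 else max 0 (eps * B k j))"

definition mutate_form :: "nat \<Rightarrow> int \<Rightarrow> nat \<Rightarrow> matrix \<Rightarrow> matrix \<Rightarrow> matrix" where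
  "mutate_form m eps k B L i j =
     (\<Sum>a\<in>{1..m}. \<Sum>b\<in>{1..m}. E_mat eps k B a i * L a b * E_mat eps k B b j)"

definition mutate_exchange :: "nat \<Rightarrow> nat set \<Rightarrow> int \<Rightarrow> nat \<Rightarrow> matrix \<Rightarrow> matrix" where
  "mutate_exchange m ex eps k B i j =
     (\<Sum>a\<in>{1..m}. \<Sum>b\<in>ex. E_mat eps k B i a * B a b * F_mat eps k B b j)"

section \<open>Toric frames, quantum seeds and their mutation\<close>

type_synonym 'f frame = "vec \<Rightarrow> 'f"
type_synonym 'f seed = "'f frame \<times> matrix"

definition lattice_iso :: "nat \<Rightarrow> (vec \<Rightarrow> vec) \<Rightarrow> bool" where
  "lattice_iso m \<eta> \<longleftrightarrow> bij_betw \<eta> (lattice_of m) (lattice_of m) \<and>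
     (\<forall>c\<in>lattice_of m. \<forall>d\<in>lattice_of m. \<eta> (c + d) = \<eta> c + \<eta> d)"

definition skew_field_automorphism :: "'f ring \<Rightarrow> 'f embedding \<Rightarrow> ('f \<Rightarrow> 'f) \<Rightarrow> bool" where
  "skew_field_automorphism F j \<phi> \<longleftrightarrow>
     \<phi> \<in> ring_iso F F \<and> (\<forall>c. \<phi> (coeff_in j c) = coeff_in j c)"

definition toric_frame :: "nat \<Rightarrow> 'f ring \<Rightarrow> 'f embedding \<Rightarrow> 'f frame \<Rightarrow> bool" where
  "toric_frame m F j M \<longleftrightarrow>
     (\<exists>\<phi> \<eta>. skew_field_automorphism F j \<phi> \<and> lattice_iso m \<eta> \<and>
        (\<forall>c\<in>lattice_of m. M c = \<phi> (torus_monom j (\<eta> c))))"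

text \<open>For a toric frame the exponent \<open>a\<close> exists and is unique.\<close>

definition frame_form :: "'f ring \<Rightarrow> 'f embedding \<Rightarrow> 'f frame \<Rightarrow> vec \<Rightarrow> vec \<Rightarrow> int" where
  "frame_form F j M c d =
     (THE a. M c \<otimes>\<^bsub>F\<^esub> M d = coeff_in j (q_half a) \<otimes>\<^bsub>F\<^esub> M (c + d))"

definition frame_matrix :: "'f ring \<Rightarrow> 'f embedding \<Rightarrow> 'f frame \<Rightarrow> matrix" where
  "frame_matrix F j M i l = frame_form F j M (unit_vec i) (unit_vec l)"

definition quantum_seed :: "nat \<Rightarrow> nat set \<Rightarrow> 'f ring \<Rightarrow> 'f embedding \<Rightarrow> 'f seed \<Rightarrow> bool" where
  "quantum_seed m ex F j = (\<lambda>(M, B).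
     toric_frame m F j M \<and> compatible_pair m ex (frame_matrix F j M) B)"

definition mutated_variable :: "nat \<Rightarrow> 'f ring \<Rightarrow> nat \<Rightarrow> 'f seed \<Rightarrow> 'f" where
  "mutated_variable m F k = (\<lambda>(M, B).
     M (- unit_vec k + (\<Sum>i\<in>{i\<in>{1..m}. B i k > 0}. Poly_Mapping.single i (B i k)))
     \<oplus>\<^bsub>F\<^esub>
     M (- unit_vec k - (\<Sum>i\<in>{i\<in>{1..m}. B i k < 0}. Poly_Mapping.single i (B i k))))"

text \<open>
  The mutation of \<open>(M, B)\<close> in direction \<open>k\<close> is the quantum seed \<open>(M', B')\<close> with
  \<open>seed_mutation m ex F j k (M, B) (M', B')\<close>; it is determined up to the values of \<open>M'\<close>
  and \<open>B'\<close> outside their index ranges. The mutated pair does not depend on the sign \<open>eps\<close>.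
\<close>

definition seed_mutation ::
  "nat \<Rightarrow> nat set \<Rightarrow> 'f ring \<Rightarrow> 'f embedding \<Rightarrow> nat \<Rightarrow> 'f seed \<Rightarrow> 'f seed \<Rightarrow> bool" where
  "seed_mutation m ex F j k = (\<lambda>(M, B) (M', B').
     quantum_seed m ex F j (M', B') \<and>
     (\<exists>eps\<in>{1, - 1}.
        (\<forall>i\<in>{1..m}. \<forall>l\<in>{1..m}.
           frame_matrix F j M' i l = mutate_form m eps k B (frame_matrix F j M) i l) \<and>
        (\<forall>i\<in>{1..m}. \<forall>l\<in>ex. B' i l = mutate_exchange m ex eps k B i l)) \<and>
     (\<forall>i\<in>{1..m} - {k}. M' (unit_vec i) = M (unit_vec i)) \<and>
     M' (unit_vec k) = mutated_variable m F k (M, B))"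

definition mutation_class ::
  "nat \<Rightarrow> nat set \<Rightarrow> 'f ring \<Rightarrow> 'f embedding \<Rightarrow> 'f seed \<Rightarrow> 'f seed set" where
  "mutation_class m ex F j s =
     {s'. (\<lambda>t t'. \<exists>k\<in>ex. seed_mutation m ex F j k t t')\<^sup>*\<^sup>* s s'}"

section \<open>Quantum cluster algebras\<close>

definition seed_cluster :: "nat set \<Rightarrow> 'f seed \<Rightarrow> 'f set" where
  "seed_cluster ex = (\<lambda>(M, B). {M (unit_vec i) | i. i \<in> ex})"

definition frozen_variables :: "nat \<Rightarrow> nat set \<Rightarrow> 'f seed \<Rightarrow> 'f set" where
  "frozen_variables m ex = (\<lambda>(M, B). {M (unit_vec i) | i. i \<in> {1..m} - ex})"

definition quantum_cluster_algebra ::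
  "nat \<Rightarrow> nat set \<Rightarrow> 'f ring \<Rightarrow> 'f embedding \<Rightarrow> 'f seed \<Rightarrow> 'f ring" where
  "quantum_cluster_algebra m ex F j s =
     F\<lparr>carrier := generate_ring F
         (range (coeff_in j)
          \<union> (\<Union>t\<in>mutation_class m ex F j s. seed_cluster ex t)
          \<union> frozen_variables m ex s)\<rparr>"

section \<open>The pair for the linear quiver with one frozen vertex\<close>

definition B_lin :: "nat \<Rightarrow> matrix" where
  "B_lin n i j =
     (if j \<in> {1..n} \<and> i = j + 1 then 1
      else if i \<in> {1..<n} \<and> j = i + 1 then - 1
      else 0)"

definition Lambda_lin :: matrix where
  "Lambda_lin i j =
     (if i < j \<and> odd i \<and> even j then - 1
      else if j < i \<and> odd j \<and> even i then 1
      else 0)"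

definition initial_seed :: "nat \<Rightarrow> 'f embedding \<Rightarrow> 'f seed" where
  "initial_seed n j = (torus_monom j, B_lin n)"

definition Y_var :: "'f embedding \<Rightarrow> nat \<Rightarrow> 'f" where
  "Y_var j i = torus_monom j (unit_vec i)"

definition A_alg :: "nat \<Rightarrow> 'f ring \<Rightarrow> 'f embedding \<Rightarrow> 'f ring" where
  "A_alg n F j = quantum_cluster_algebra (n + 1) {1..n} F j (initial_seed n j)"

text \<open>\<open>X_var n F j i\<close> is the variable \<open>X\<close> with index \<open>2 * i\<close>, for \<open>0 \<le> i \<le> n\<close>.\<close>

definition X_var :: "nat \<Rightarrow> 'f ring \<Rightarrow> 'f embedding \<Rightarrow> nat \<Rightarrow> 'f" where
  "X_var n F j i =
     (if i < n then mutated_variable (n + 1) F (n - i) (initial_seed n j) else Y_var j 1)"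

section \<open>The deformed Grothendieck ring\<close>

text \<open>
  Words are lists of generator labels; the label \<open>l\<close> stands for the class of the
  Kirillov-Reshetikhin module \<open>W\<close> with indices \<open>(1, l)\<close>. The ring is given by
  Hernandez's presentation.
\<close>

definition free_algebra :: "nat set \<Rightarrow> (nat list \<Rightarrow>\<^sub>0 laurent) ring" where
  "free_algebra G = twisted_algebra (lists G) (@) [] (\<lambda>_ _. 1)"

definition KR_labels :: "nat \<Rightarrow> nat set" where
  "KR_labels n = {2 * k | k. k \<le> n}"

definition Rep_relations :: "nat \<Rightarrow> (nat list \<Rightarrow>\<^sub>0 laurent) set" where
  "Rep_relations n =
     {Poly_Mapping.single [l1, l2] 1
        - Poly_Mapping.single [l2, l1] (q_pow ((- 1) ^ ((l1 - l2) div 2))) | l1 l2.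
        l1 \<in> KR_labels n \<and> l2 \<in> KR_labels n \<and> l1 > l2 \<and> l1 \<noteq> l2 + 2}
     \<union>
     {Poly_Mapping.single [l, l - 2] 1
        - (Poly_Mapping.single [l - 2, l] (q_pow (- 1)) + Poly_Mapping.single [] (1 - q_pow (- 1))) | l.
        l \<in> KR_labels n \<and> l \<ge> 2}"

definition Rep_ideal :: "nat \<Rightarrow> (nat list \<Rightarrow>\<^sub>0 laurent) set" where
  "Rep_ideal n = Idl\<^bsub>free_algebra (KR_labels n)\<^esub> (Rep_relations n)"

definition Rep_ring :: "nat \<Rightarrow> (nat list \<Rightarrow>\<^sub>0 laurent) set ring" where
  "Rep_ring n = free_algebra (KR_labels n) Quot Rep_ideal n"

definition Rep_coeff :: "nat \<Rightarrow> laurent \<Rightarrow> (nat list \<Rightarrow>\<^sub>0 laurent) set" where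
  "Rep_coeff n c = Rep_ideal n +>\<^bsub>free_algebra (KR_labels n)\<^esub> Poly_Mapping.single [] c"

definition KR_class :: "nat \<Rightarrow> nat \<Rightarrow> (nat list \<Rightarrow>\<^sub>0 laurent) set" where
  "KR_class n l = Rep_ideal n +>\<^bsub>free_algebra (KR_labels n)\<^esub> Poly_Mapping.single [l] 1"

end

theory Submission
  imports Defs
begin

text \<open>
  Label the vertices of an (n+3)-gon by \<open>0, \<dots>, n + 2\<close>. Every chord \<open>(a, b)\<close> gets an element of
  the quantum torus, a sum of at most \<open>b - a\<close> monomials with coefficient 1, such that \<open>Y\<^sub>k\<close> is the
  chord \<open>(0, k + 1)\<close>, the frozen variable is the side \<open>(0, n + 2)\<close> and the other sides are 1. These
  elements quasi-commute when the chords do not cross and satisfy quantum Ptolemy relations when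
  they do. Hence every seed is a triangulation with labelled chords, its mutations are flips, and
  \<open>X\<^sub>2\<^sub>i\<close> is the short chord \<open>(n - i, n - i + 2)\<close>. The Ptolemy relations express every chord through
  the short ones, so these generate the cluster algebra, and they include Hernandez's relations as
  the cases of two short chords. That the short chords belong to the algebra needs the existence of
  the mutated seeds, that is, of an automorphism of \<open>F\<close>: conjugation by a quantum dilogarithm.
  Finally, the relations straighten every word to ordered words, and the leading
  exponents of the images of the ordered words in the torus are distinct, so there are no further
  relations.
\<close>

text \<open>A toric frame is injective, and this does much of the combinatorial work: no two labels
  carry the same chord, and no label carries a side that equals 1. So a mutated seed is only
  analysed, never constructed, when cluster variables are shown to be chords: whatever satisfies the
  mutation relation is a flip. Seeds are constructed only for the one-step mutations of the initial
  seed, since these, together with the first initial variable, supply all short chords. The obstacle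
  there is that \<open>F\<close> is an abstract skew-field of fractions, in which the infinite
  product of the quantum dilogarithm has no meaning. But conjugation involves only ratios of shifted
  copies of that product, so a two-sided sequence of units with prescribed ratios 1 + q^(i + 1/2)
  X^b takes its place, with b a column of the exchange matrix. Quasi-commutation and the Ptolemy
  relations both go through a symmetric product of two non-crossing chords, which differs from the
  ordinary product by a power of q^(1/2). All exponents depend only on parities of endpoints and on
  the order of two triangle indices, which makes the identities finite checks.\<close>

abbreviation "lkp \<equiv> Poly_Mapping.lookup"
abbreviation "kys \<equiv> Poly_Mapping.keys"
abbreviation "sgl \<equiv> Poly_Mapping.single"

section \<open>Twisted algebras\<close>

lemma poly_mapping_sum_singles:
  assumes "finite A" "kys f \<subseteq> A"
  shows "f = (\<Sum>a\<in>A. sgl a (lkp f a))"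
proof (rule poly_mapping_eqI)
  fix k
  have "lkp (\<Sum>a\<in>A. sgl a (lkp f a)) k = (\<Sum>a\<in>A. if a = k then lkp f a else 0)"
    by (simp add: lookup_sum lookup_single when_def)
  also have "\<dots> = lkp f k"
    using assms by (auto simp: in_keys_iff)
  finally show "lkp f k = lkp (\<Sum>a\<in>A. sgl a (lkp f a)) k" ..
qed

lemma keys_subset_induct [consumes 1, case_names zero single add]:
  fixes f :: "'a \<Rightarrow>\<^sub>0 'b :: comm_monoid_add"
  assumes "kys f \<subseteq> S"
    and zero: "P 0"
    and single: "\<And>a x. a \<in> S \<Longrightarrow> P (sgl a x)"
    and add: "\<And>f g. kys f \<subseteq> S \<Longrightarrow> kys g \<subseteq> S \<Longrightarrow> P f \<Longrightarrow> P g \<Longrightarrow> P (f + g)"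
  shows "P f"
proof -
  have "A \<subseteq> S \<Longrightarrow> kys (\<Sum>a\<in>A. sgl a (lkp f a)) \<subseteq> S \<and> P (\<Sum>a\<in>A. sgl a (lkp f a))"
    if "finite A" for A
    using that
  proof induction
    case empty
    then show ?case using zero by simp
  next
    case (insert a A)
    then show ?case
      using Poly_Mapping.keys_add[of "sgl a (lkp f a)" "\<Sum>a\<in>A. sgl a (lkp f a)"]
      by (auto intro!: add single split: if_splits)
  qed
  from this[of "kys f"] show ?thesis
    using assms(1) poly_mapping_sum_singles[of "kys f" f] by simp
qed

text \<open>The defining sum runs over the exact supports, which may shrink under addition; a fixed
  finite superset makes the product additive term by term.\<close>

lemma twisted_mult_superset:
  assumes "finite A" "finite B" "kys f \<subseteq> A" "kys g \<subseteq> B"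
  shows "twisted_mult opr c f g =
    (\<Sum>a\<in>A. \<Sum>b\<in>B. sgl (opr a b) (c a b * lkp f a * lkp g b))"
proof -
  have "twisted_mult opr c f g =
    (\<Sum>a\<in>kys f. \<Sum>b\<in>B. sgl (opr a b) (c a b * lkp f a * lkp g b))"
    unfolding twisted_mult_def using assms
    by (intro sum.cong[OF refl] sum.mono_neutral_left) (auto simp: in_keys_iff)
  also have "\<dots> = (\<Sum>a\<in>A. \<Sum>b\<in>B. sgl (opr a b) (c a b * lkp f a * lkp g b))"
    using assms by (intro sum.mono_neutral_left) (auto simp: in_keys_iff)
  finally show ?thesis .
qed

lemma twisted_mult_add_left:
  "twisted_mult opr c (f + f') g = twisted_mult opr c f g + twisted_mult opr c f' g"
  using Poly_Mapping.keys_add[of f f']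
  by (simp add: twisted_mult_superset[of "kys f \<union> kys f'" "kys g"] lookup_add
      distrib_left distrib_right single_add sum.distrib)

lemma twisted_mult_add_right:
  "twisted_mult opr c f (g + g') = twisted_mult opr c f g + twisted_mult opr c f g'"
  using Poly_Mapping.keys_add[of g g']
  by (simp add: twisted_mult_superset[of "kys f" "kys g \<union> kys g'"] lookup_add
      distrib_left distrib_right single_add sum.distrib)

lemma twisted_mult_zero [simp]:
  "twisted_mult opr c 0 g = 0" "twisted_mult opr c f 0 = 0"
  by (simp_all add: twisted_mult_def)

lemma twisted_mult_single:
  "twisted_mult opr c (sgl a x) (sgl b z) = sgl (opr a b) (c a b * x * z)"
  by (subst twisted_mult_superset[of "{a}" "{b}"]) auto

lemma twisted_mult_sum_left:
  "twisted_mult opr c (\<Sum>i\<in>I. f i) g = (\<Sum>i\<in>I. twisted_mult opr c (f i) g)"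
  by (induction I rule: infinite_finite_induct) (auto simp: twisted_mult_add_left)

lemma twisted_mult_sum_right:
  "twisted_mult opr c f (\<Sum>i\<in>I. g i) = (\<Sum>i\<in>I. twisted_mult opr c f (g i))"
  by (induction I rule: infinite_finite_induct) (auto simp: twisted_mult_add_right)

lemma twisted_mult_minus_left:
  "twisted_mult opr c (f - f') g = twisted_mult opr c f g - twisted_mult opr c f' g"
  using twisted_mult_add_left[of opr c "f - f'" f' g] by (simp add: algebra_simps)

lemma twisted_mult_minus_right:
  "twisted_mult opr c f (g - g') = twisted_mult opr c f g - twisted_mult opr c f g'"
  using twisted_mult_add_right[of opr c f "g - g'" g'] by (simp add: algebra_simps)

lemma cocycle_shuffle:
  fixes x :: "'a :: comm_monoid_mult"
  assumes "p * r = s * t" shows "r * (p * x * z) * w = t * x * (s * z * w)"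
proof -
  have "r * (p * x * z) * w = (p * r) * (x * z * w)" by (simp add: ac_simps)
  also have "\<dots> = t * x * (s * z * w)" unfolding assms by (simp add: ac_simps)
  finally show ?thesis .
qed

text \<open>The cocycle condition is associativity on basis elements. Two instances occur: the
  lattice, twisted by powers of q from a bilinear form, and the monoid of words with trivial twist,
  which gives the free algebra.\<close>

locale twisted_monoid =
  fixes S :: "'b set" and opr :: "'b \<Rightarrow> 'b \<Rightarrow> 'b" and u :: 'b and c :: "'b \<Rightarrow> 'b \<Rightarrow> laurent"
  assumes opr_closed: "\<lbrakk>a \<in> S; b \<in> S\<rbrakk> \<Longrightarrow> opr a b \<in> S"
    and unit_in: "u \<in> S"
    and opr_assoc: "\<lbrakk>a \<in> S; b \<in> S; d \<in> S\<rbrakk> \<Longrightarrow> opr (opr a b) d = opr a (opr b d)"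
    and opr_unit: "a \<in> S \<Longrightarrow> opr u a = a" "a \<in> S \<Longrightarrow> opr a u = a"
    and cocycle: "\<lbrakk>a \<in> S; b \<in> S; d \<in> S\<rbrakk> \<Longrightarrow> c a b * c (opr a b) d = c b d * c a (opr b d)"
    and cocycle_unit: "a \<in> S \<Longrightarrow> c u a = 1" "a \<in> S \<Longrightarrow> c a u = 1"
begin

abbreviation "A \<equiv> twisted_algebra S opr u c"

lemma carrier_eq: "carrier A = {f. kys f \<subseteq> S}"
  and mult_eq: "monoid.mult A = twisted_mult opr c"
  and one_eq: "\<one>\<^bsub>A\<^esub> = sgl u 1"
  and zero_eq: "\<zero>\<^bsub>A\<^esub> = 0"
  and add_eq: "ring.add A = (+)"
  by (simp_all add: twisted_algebra_def)

lemmas alg_simps = carrier_eq mult_eq one_eq zero_eq add_eq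

lemma twisted_mult_closed:
  assumes "kys f \<subseteq> S" "kys g \<subseteq> S"
  shows "kys (twisted_mult opr c f g) \<subseteq> S"
proof -
  have *: "kys (twisted_mult opr c (sgl a x) g) \<subseteq> S" if "a \<in> S" for a x
    using assms(2)
  proof (induction g rule: keys_subset_induct)
    case (single b z)
    then show ?case using that opr_closed by (auto simp: twisted_mult_single split: if_splits)
  next
    case (add f g)
    then show ?case
      by (auto simp: twisted_mult_add_right dest!: Poly_Mapping.keys_add[THEN subsetD])
  qed simp
  show ?thesis
    using assms(1)
  proof (induction f rule: keys_subset_induct)
    case (single b z)
    then show ?case using * by blast
  next
    case (add f g)
    then show ?case
      by (auto simp: twisted_mult_add_left dest!: Poly_Mapping.keys_add[THEN subsetD])
  qed simp
qed

lemma twisted_mult_assoc: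
  assumes "kys f \<subseteq> S" "kys g \<subseteq> S" "kys h \<subseteq> S"
  shows "twisted_mult opr c (twisted_mult opr c f g) h
       = twisted_mult opr c f (twisted_mult opr c g h)"
  using assms(1)
proof (induction f rule: keys_subset_induct)
  case (single a x)
  note a = this
  show ?case using assms(2)
  proof (induction g rule: keys_subset_induct)
    case (single b z)
    note b = this
    show ?case using assms(3)
    proof (induction h rule: keys_subset_induct)
      case (single d w)
      have "c (opr a b) d * (c a b * x * z) * w = c a (opr b d) * x * (c b d * z * w)"
        by (rule cocycle_shuffle[OF cocycle[OF a b single]])
      then show ?case
        using a b single by (simp only: twisted_mult_single opr_assoc)
    qed (simp_all add: twisted_mult_add_right)
  qed (simp_all add: twisted_mult_add_right twisted_mult_add_left)
qed (simp_all add: twisted_mult_add_left)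

lemma twisted_mult_unit:
  assumes "kys f \<subseteq> S"
  shows "twisted_mult opr c (sgl u 1) f = f" "twisted_mult opr c f (sgl u 1) = f"
  using assms
  by (induction f rule: keys_subset_induct)
    (auto simp: twisted_mult_single twisted_mult_add_left twisted_mult_add_right
      opr_unit cocycle_unit)

lemma is_ring: "Ring.ring A"
proof (rule ringI)
  show "abelian_group A"
  proof (rule abelian_groupI)
    fix f assume f: "f \<in> carrier A"
    show "\<exists>g\<in>carrier A. g \<oplus>\<^bsub>A\<^esub> f = \<zero>\<^bsub>A\<^esub>"
      using f by (intro bexI[of _ "- f"]) (auto simp: alg_simps in_keys_iff)
  next
    fix f g assume "f \<in> carrier A" "g \<in> carrier A"
    then show "f \<oplus>\<^bsub>A\<^esub> g \<in> carrier A"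
      using Poly_Mapping.keys_add[of f g] by (auto simp: alg_simps)
  qed (auto simp: alg_simps algebra_simps)
  show "monoid A"
    by (rule monoidI)
      (use unit_in twisted_mult_closed in
        \<open>auto simp: alg_simps twisted_mult_assoc twisted_mult_unit split: if_splits\<close>)
qed (auto simp: alg_simps twisted_mult_add_left twisted_mult_add_right)

end

subsection \<open>The universal property\<close>

text \<open>The data of a homomorphism out of a twisted algebra. It serves for the evaluation of
  words in \<open>F\<close> and for the map on the torus that becomes the dilogarithm
  automorphism.\<close>

locale twisted_hom = twisted_monoid S opr u c + R: Ring.ring R
  for S :: "'b set" and opr u c and R :: "'r ring" +
  fixes \<kappa> :: "laurent \<Rightarrow> 'r" and N :: "'b \<Rightarrow> 'r"
  assumes \<kappa>_closed [simp, intro]: "\<kappa> x \<in> carrier R"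
    and \<kappa>_add: "\<kappa> (x + z) = \<kappa> x \<oplus>\<^bsub>R\<^esub> \<kappa> z"
    and \<kappa>_mult: "\<kappa> (x * z) = \<kappa> x \<otimes>\<^bsub>R\<^esub> \<kappa> z"
    and \<kappa>_one: "\<kappa> 1 = \<one>\<^bsub>R\<^esub>"
    and \<kappa>_central: "r \<in> carrier R \<Longrightarrow> r \<otimes>\<^bsub>R\<^esub> \<kappa> x = \<kappa> x \<otimes>\<^bsub>R\<^esub> r"
    and N_closed [simp, intro]: "a \<in> S \<Longrightarrow> N a \<in> carrier R"
    and N_mult: "\<lbrakk>a \<in> S; b \<in> S\<rbrakk> \<Longrightarrow> N a \<otimes>\<^bsub>R\<^esub> N b = \<kappa> (c a b) \<otimes>\<^bsub>R\<^esub> N (opr a b)"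
    and N_unit: "N u = \<one>\<^bsub>R\<^esub>"
begin

definition ext :: "('b \<Rightarrow>\<^sub>0 laurent) \<Rightarrow> 'r" where
  "ext f = finsum R (\<lambda>a. \<kappa> (lkp f a) \<otimes>\<^bsub>R\<^esub> N a) (kys f)"

lemma \<kappa>_zero: "\<kappa> 0 = \<zero>\<^bsub>R\<^esub>"
  using \<kappa>_add[of 0 0] R.add.l_cancel_one[of "\<kappa> 0" "\<kappa> 0"] by simp

lemma ext_superset:
  assumes "finite B" "kys f \<subseteq> B" "B \<subseteq> S"
  shows "ext f = finsum R (\<lambda>a. \<kappa> (lkp f a) \<otimes>\<^bsub>R\<^esub> N a) B"
  unfolding ext_def
  by (rule R.add.finprod_mono_neutral_cong_left)
    (use assms in \<open>auto simp: in_keys_iff \<kappa>_zero\<close>)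

lemma ext_zero: "ext 0 = \<zero>\<^bsub>R\<^esub>"
  by (simp add: ext_def)

lemma ext_single: "a \<in> S \<Longrightarrow> ext (sgl a x) = \<kappa> x \<otimes>\<^bsub>R\<^esub> N a"
  by (subst ext_superset[of "{a}"]) auto

lemma ext_add:
  assumes "kys f \<subseteq> S" "kys g \<subseteq> S"
  shows "ext (f + g) = ext f \<oplus>\<^bsub>R\<^esub> ext g"
proof -
  let ?B = "kys f \<union> kys g"
  have "ext (f + g) = finsum R (\<lambda>a. \<kappa> (lkp f a) \<otimes>\<^bsub>R\<^esub> N a \<oplus>\<^bsub>R\<^esub> \<kappa> (lkp g a) \<otimes>\<^bsub>R\<^esub> N a) ?B"
    using assms Poly_Mapping.keys_add[of f g]
    by (subst ext_superset[of ?B]; (intro R.finsum_cong')?)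
      (auto simp: lookup_add \<kappa>_add R.l_distr subset_iff)
  also have "\<dots> = ext f \<oplus>\<^bsub>R\<^esub> ext g"
    using assms by (subst R.finsum_addf) (auto simp: ext_superset[of ?B] subset_iff)
  finally show ?thesis .
qed

lemma ext_closed:
  assumes "kys f \<subseteq> S" shows "ext f \<in> carrier R"
  unfolding ext_def using assms by (intro R.finsum_closed) auto

lemma ext_mult:
  assumes "kys f \<subseteq> S" "kys g \<subseteq> S"
  shows "ext (twisted_mult opr c f g) = ext f \<otimes>\<^bsub>R\<^esub> ext g"
  using assms(1)
proof (induction f rule: keys_subset_induct)
  case zero
  then show ?case using ext_closed[OF assms(2)] by (simp add: ext_zero)
next
  case (single a x)
  note a = this
  show ?case using assms(2)
  proof (induction g rule: keys_subset_induct)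
    case zero
    then show ?case using ext_closed[of "sgl a x"] a by (simp add: ext_zero)
  next
    case (single b z)
    have "\<kappa> x \<otimes>\<^bsub>R\<^esub> N a \<otimes>\<^bsub>R\<^esub> (\<kappa> z \<otimes>\<^bsub>R\<^esub> N b) = \<kappa> x \<otimes>\<^bsub>R\<^esub> ((N a \<otimes>\<^bsub>R\<^esub> \<kappa> z) \<otimes>\<^bsub>R\<^esub> N b)"
      using a single by (simp add: R.m_assoc)
    also have "\<dots> = \<kappa> x \<otimes>\<^bsub>R\<^esub> \<kappa> z \<otimes>\<^bsub>R\<^esub> (N a \<otimes>\<^bsub>R\<^esub> N b)"
      unfolding \<kappa>_central[OF N_closed[OF a]] using a single by (simp add: R.m_assoc)
    also have "\<dots> = \<kappa> (x * z * c a b) \<otimes>\<^bsub>R\<^esub> N (opr a b)"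
      using a single opr_closed[OF a single] by (simp add: R.m_assoc N_mult \<kappa>_mult)
    finally show ?case
      using a single opr_closed[OF a single]
      by (simp add: twisted_mult_single ext_single mult_ac)
  next
    case (add g h)
    then show ?case
      using a by (simp add: twisted_mult_add_right ext_add twisted_mult_closed ext_closed R.r_distr)
  qed
next
  case (add f h)
  then show ?case
    using assms by (simp add: twisted_mult_add_left ext_add twisted_mult_closed ext_closed R.l_distr)
qed

lemma ext_hom: "ext \<in> ring_hom A R"
  by (rule ring_hom_memI)
    (auto simp: alg_simps ext_closed ext_mult ext_add ext_single unit_in \<kappa>_one N_unit)

end

section \<open>The based quantum torus\<close>

lemma q_half_add: "q_half (a + b) = q_half a * q_half b"
  by (simp add: q_half_def mult_single)

lemma q_half_0 [simp]: "q_half 0 = 1"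
  by (simp add: q_half_def)

lemma q_half_cancel [simp]: "q_half a * q_half (- a) = 1" "q_half (- a) * q_half a = 1"
  by (simp_all flip: q_half_add)

lemma q_half_neq_0 [simp]: "q_half a \<noteq> 0"
  using q_half_cancel(1)[of a] by (metis mult_zero_left zero_neq_one)

lemma q_half_inject [simp]: "q_half a = q_half b \<longleftrightarrow> a = b"
proof
  assume "q_half a = q_half b"
  then have "lkp (q_half a) a = lkp (q_half b) a" by simp
  then show "a = b" by (auto simp: q_half_def lookup_single when_def split: if_splits)
qed simp

lemma bil_form_add_left: "bil_form m L (e + e') f = bil_form m L e f + bil_form m L e' f"
  and bil_form_add_right: "bil_form m L f (e + e') = bil_form m L f e + bil_form m L f e'"
  by (simp_all add: bil_form_def lookup_add algebra_simps sum.distrib)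

lemma bil_form_diff_left: "bil_form m L (e - e') f = bil_form m L e f - bil_form m L e' f"
  and bil_form_diff_right: "bil_form m L f (e - e') = bil_form m L f e - bil_form m L f e'"
  by (simp_all add: bil_form_def lookup_minus algebra_simps sum_subtractf)

lemma bil_form_uminus_left: "bil_form m L (- e) f = - bil_form m L e f"
  and bil_form_uminus_right: "bil_form m L f (- e) = - bil_form m L f e"
  by (simp_all add: bil_form_def sum_negf)

lemma bil_form_zero [simp]: "bil_form m L 0 f = 0" "bil_form m L f 0 = 0"
  by (simp_all add: bil_form_def)

lemmas bil_form_linear = bil_form_add_left bil_form_add_right bil_form_diff_left
  bil_form_diff_right bil_form_uminus_left bil_form_uminus_right

lemma lookup_unit_vec: "lkp (unit_vec i) k = (if i = k then 1 else 0)"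
  by (simp add: unit_vec_def lookup_single when_def)

lemma bil_form_unit_left:
  assumes "i \<in> {1..m}"
  shows "bil_form m L (unit_vec i) f = (\<Sum>l\<in>{1..m}. L i l * lkp f l)"
proof -
  have "bil_form m L (unit_vec i) f
      = (\<Sum>k\<in>{1..m}. if i = k then (\<Sum>l\<in>{1..m}. L i l * lkp f l) else 0)"
    unfolding bil_form_def by (intro sum.cong) (auto simp: lookup_unit_vec)
  then show ?thesis using assms by simp
qed

lemma bil_form_unit:
  assumes "i \<in> {1..m}" "l \<in> {1..m}"
  shows "bil_form m L (unit_vec i) (unit_vec l) = L i l"
proof -
  have "(\<Sum>k\<in>{1..m}. L i k * lkp (unit_vec l) k) = (\<Sum>k\<in>{1..m}. if l = k then L i l else 0)"
    by (intro sum.cong) (auto simp: lookup_unit_vec)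
  then show ?thesis using assms by (simp add: bil_form_unit_left)
qed

lemma bil_form_skew:
  assumes "\<And>i l. i \<in> {1..m} \<Longrightarrow> l \<in> {1..m} \<Longrightarrow> L i l = - L l i"
  shows "bil_form m L f e = - bil_form m L e f"
  unfolding bil_form_def sum_negf[symmetric]
  by (subst sum.swap, intro sum.cong refl) (subst assms, auto)

lemma zero_in_lattice [simp, intro]: "0 \<in> lattice_of m"
  and unit_vec_in_lattice [simp, intro]: "i \<in> {1..m} \<Longrightarrow> unit_vec i \<in> lattice_of m"
  by (auto simp: lattice_of_def unit_vec_def)

lemma add_in_lattice [intro]: "e \<in> lattice_of m \<Longrightarrow> f \<in> lattice_of m \<Longrightarrow> e + f \<in> lattice_of m"
  using Poly_Mapping.keys_add[of e f] by (auto simp: lattice_of_def)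

lemma uminus_in_lattice [intro]: "e \<in> lattice_of m \<Longrightarrow> - e \<in> lattice_of m"
  by (simp add: lattice_of_def)

lemma diff_in_lattice [intro]: "e \<in> lattice_of m \<Longrightarrow> f \<in> lattice_of m \<Longrightarrow> e - f \<in> lattice_of m"
  using add_in_lattice[OF _ uminus_in_lattice, of e m f] by simp

lemma sum_in_lattice [intro]: "(\<And>i. i \<in> I \<Longrightarrow> e i \<in> lattice_of m) \<Longrightarrow> sum e I \<in> lattice_of m"
  by (induction I rule: infinite_finite_induct) auto

abbreviation torus_mult :: "nat \<Rightarrow> matrix \<Rightarrow> (vec \<Rightarrow>\<^sub>0 laurent) \<Rightarrow> (vec \<Rightarrow>\<^sub>0 laurent) \<Rightarrow> (vec \<Rightarrow>\<^sub>0 laurent)"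
  where "torus_mult m L \<equiv> twisted_mult (+) (\<lambda>e f. q_half (bil_form m L e f))"

lemma torus_mult_single:
  "torus_mult m L (sgl e x) (sgl f z) = sgl (e + f) (q_half (bil_form m L e f) * x * z)"
  by (rule twisted_mult_single)

interpretation torus: twisted_monoid "lattice_of m" "(+)" 0 "\<lambda>e f. q_half (bil_form m L e f)"
  for m L
  by unfold_locales
    (auto simp: add.assoc bil_form_linear simp flip: q_half_add intro: arg_cong[where f = q_half])

lemma quantum_torus_simps:
  "carrier (quantum_torus m L) = {f. kys f \<subseteq> lattice_of m}"
  "monoid.mult (quantum_torus m L) = torus_mult m L"
  "\<one>\<^bsub>quantum_torus m L\<^esub> = sgl 0 1"
  "\<zero>\<^bsub>quantum_torus m L\<^esub> = 0"
  "ring.add (quantum_torus m L) = (+)"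
  by (simp_all add: quantum_torus_def torus.alg_simps)

lemma torus_scale:
  "torus_mult m L (sgl 0 x) (sgl e z) = sgl e (x * z)"
  "torus_mult m L (sgl e z) (sgl 0 x) = sgl e (x * z)"
  by (simp_all add: torus_mult_single mult.commute)

section \<open>Chords of a polygon as elements of the torus\<close>

text \<open>
  \<open>vtx v\<close> is the exponent of the chord \<open>(0, v)\<close>. For \<open>a > 0\<close>, \<open>chord a b\<close> is the Laurent expansion
  with respect to the fan of all chords at \<open>0\<close>, with one summand for each triangle \<open>(0, i, i + 1)\<close>
  that the chord crosses.
\<close>

definition vtx :: "nat \<Rightarrow> vec" where
  "vtx v = (if v \<ge> 2 then unit_vec (v - 1) else 0)"

definition side_vec :: "nat \<Rightarrow> vec" where
  "side_vec i = vtx i + vtx (Suc i)"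

text \<open>For a = 0 the index 0 stands in for the triangles: \<open>side_vec 0\<close> is 0, so
  the single summand is \<open>vtx b\<close>. Chords of the fan thus obey the same formula as all
  others.\<close>

definition chord_idx :: "nat \<Rightarrow> nat \<Rightarrow> nat set" where
  "chord_idx a b = (if a = 0 then {0} else {a..<b})"

definition chord :: "nat \<Rightarrow> nat \<Rightarrow> vec \<Rightarrow>\<^sub>0 laurent" where
  "chord a b = (\<Sum>i\<in>chord_idx a b. sgl (vtx a + vtx b - side_vec i) 1)"

abbreviation "short k \<equiv> chord k (Suc (Suc k))"

text \<open>
  The form on the vectors \<open>vtx\<close> and \<open>side_vec\<close> with positive indices. As \<open>vtx 0 = 0\<close>, it is not the
  form when an index of \<open>om\<close> or \<open>tau\<close> is \<open>0\<close>, but in \<open>expo\<close> these terms cancel against each other.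
\<close>

definition om :: "nat \<Rightarrow> nat \<Rightarrow> int" where
  "om v w = (if v < w \<and> even v \<and> odd w then -1 else if w < v \<and> even w \<and> odd v then 1 else 0)"

definition tau :: "nat \<Rightarrow> nat \<Rightarrow> int" where
  "tau v i = (if v \<le> i then (if even v then -1 else 0) else (if odd v then 1 else 0))"

definition cmp :: "nat \<Rightarrow> nat \<Rightarrow> int" where
  "cmp i l = (if i < l then -1 else if l < i then 1 else 0)"

abbreviation "lin_mult n \<equiv> torus_mult (Suc n) Lambda_lin"

definition expo :: "nat \<Rightarrow> nat \<Rightarrow> nat \<Rightarrow> nat \<Rightarrow> nat \<Rightarrow> nat \<Rightarrow> int" where
  "expo a b c d i l = om a c + om a d + om b c + om b d
     - tau a l - tau b l + tau c i + tau d i + cmp i l"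

lemma om_tau: "om v i + om v (Suc i) = tau v i"
  by (cases "v = Suc i") (auto simp: om_def tau_def)

lemma om_skew: "om v w = - om w v"
  by (auto simp: om_def)

lemma tau_cmp: "tau i l + tau (Suc i) l = cmp i l"
  by (auto simp: tau_def cmp_def)

lemma om_1 [simp]: "w \<ge> 1 \<Longrightarrow> om (Suc 0) w = 0"
  by (auto simp: om_def)

lemma bil_vtx:
  assumes "v \<in> {1..Suc (Suc n)}" "w \<in> {1..Suc (Suc n)}"
  shows "bil_form (Suc n) Lambda_lin (vtx v) (vtx w) = om v w"
proof (cases "v = 1 \<or> w = 1")
  case True
  then show ?thesis using assms om_skew[of v w] by (auto simp: vtx_def)
next
  case False
  with assms obtain v' w' where "v = Suc v'" "w = Suc w'" "v' \<in> {1..Suc n}" "w' \<in> {1..Suc n}"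
    by (cases v; cases w) auto
  then show ?thesis
    using bil_form_unit[of v' "Suc n" w' Lambda_lin] by (auto simp: vtx_def Lambda_lin_def om_def)
qed

lemma vtx_in_lattice [intro]: "v \<le> Suc (Suc n) \<Longrightarrow> vtx v \<in> lattice_of (Suc n)"
  by (auto simp: vtx_def intro!: unit_vec_in_lattice)

lemma bil_chord:
  assumes "a < b" "b \<le> Suc (Suc n)" "i \<in> chord_idx a b" "c < d" "d \<le> Suc (Suc n)" "l \<in> chord_idx c d"
  shows "bil_form (Suc n) Lambda_lin (vtx a + vtx b - side_vec i) (vtx c + vtx d - side_vec l)
       = expo a b c d i l"
proof -
  have v0: "vtx 0 = 0" "vtx (Suc 0) = 0" by (simp_all add: vtx_def)
  note t = om_tau[of a l, symmetric] om_tau[of b l, symmetric] om_tau[of c i, symmetric]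
    om_tau[of d i, symmetric] tau_cmp[of i l, symmetric] om_tau[of i l, symmetric]
    om_tau[of "Suc i" l, symmetric]
  note s = om_skew[of i c] om_skew[of i d] om_skew[of "Suc i" c] om_skew[of "Suc i" d]
  \<comment> \<open>If a = 0 < c, then i = 0, and \<open>tau c 0\<close> and \<open>tau d 0\<close>
    cancel \<open>om 0 c\<close> and \<open>om 0 d\<close>, while \<open>cmp 0 l\<close> cancels
    \<open>tau 0 l\<close>; the rest is the form of \<open>vtx b\<close> with the second exponent.
    The case c = 0 < a is the mirror image.\<close>
  consider "a = 0" "c = 0" | "a = 0" "c > 0" | "a > 0" "c = 0" | "a > 0" "c > 0" by auto
  then show ?thesis
  proof cases
    case 1
    then show ?thesis using assms
      by (auto simp: chord_idx_def side_vec_def v0 bil_vtx expo_def om_def tau_def cmp_def)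
  next
    case 2
    then have "i = 0" "l \<in> {c..<d}" using assms by (auto simp: chord_idx_def)
    then show ?thesis
      using 2 assms om_1[of c] om_1[of d] om_1[of l] om_1[of "Suc l"]
      unfolding expo_def t side_vec_def using s
      by (simp add: v0 bil_form_linear bil_vtx)
  next
    case 3
    then have "l = 0" "i \<in> {a..<b}" using assms by (auto simp: chord_idx_def)
    then show ?thesis
      using 3 assms om_1[of a] om_1[of b] om_1[of i] om_1[of "Suc i"]
        om_skew[of a 1] om_skew[of b 1] om_skew[of i 1] om_skew[of "Suc i" 1]
      unfolding expo_def t side_vec_def using s
      by (simp add: v0 bil_form_linear bil_vtx)
  next
    case 4
    then have "l \<in> {c..<d}" "i \<in> {a..<b}" using assms by (auto simp: chord_idx_def)
    then show ?thesis
      using 4 assms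
      unfolding expo_def t side_vec_def using s
      by (simp add: bil_form_linear bil_vtx)
  qed
qed

text \<open>The monomials depend symmetrically on the two triangle indices; only the power of q is
  left to \<open>e\<close>. Transposing the index sets is therefore free, and identities of products
  reduce to identities between functions of two indices.\<close>

definition dsum :: "(nat \<Rightarrow> nat \<Rightarrow> int) \<Rightarrow> nat set \<Rightarrow> nat set \<Rightarrow> vec \<Rightarrow> (vec \<Rightarrow>\<^sub>0 laurent)" where
  "dsum e U V w = (\<Sum>i\<in>U. \<Sum>l\<in>V. sgl (w - side_vec i - side_vec l) (q_half (e i l)))"

lemma dsum_swap: "dsum e U V w = dsum (\<lambda>i l. e l i) V U w"
  unfolding dsum_def by (subst sum.swap) (simp add: algebra_simps)

lemma dsum_cong:
  assumes "\<And>i l. i \<in> U \<Longrightarrow> l \<in> V \<Longrightarrow> e i l = e' i l"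
  shows "dsum e U V w = dsum e' U V w"
  unfolding dsum_def using assms by (auto intro!: sum.cong)

lemma dsum_Un_left:
  "\<lbrakk>finite U; finite U'; U \<inter> U' = {}\<rbrakk> \<Longrightarrow> dsum e (U \<union> U') V w = dsum e U V w + dsum e U' V w"
  by (simp add: dsum_def sum.union_disjoint)

lemma dsum_Un_right:
  "\<lbrakk>finite V; finite V'; V \<inter> V' = {}\<rbrakk> \<Longrightarrow> dsum e U (V \<union> V') w = dsum e U V w + dsum e U V' w"
  by (simp add: dsum_def sum.union_disjoint sum.distrib)

lemma dsum_scale:
  "torus_mult m L (sgl 0 (q_half k)) (dsum e U V w) = dsum (\<lambda>i l. k + e i l) U V w"
  by (simp add: dsum_def twisted_mult_sum_right torus_scale q_half_add)

lemma finite_chord_idx [simp]: "finite (chord_idx a b)"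
  by (simp add: chord_idx_def)

lemma chord_mult:
  assumes "a < b" "b \<le> Suc (Suc n)" "c < d" "d \<le> Suc (Suc n)"
  shows "lin_mult n (chord a b) (chord c d)
    = dsum (expo a b c d) (chord_idx a b) (chord_idx c d) (vtx a + vtx b + (vtx c + vtx d))"
  unfolding chord_def twisted_mult_sum_left twisted_mult_sum_right dsum_def
  by (subst sum.swap, intro sum.cong refl)
    (simp add: torus_mult_single bil_chord assms algebra_simps)

lemma chord_keys: "a < b \<Longrightarrow> b \<le> Suc (Suc n) \<Longrightarrow> kys (chord a b) \<subseteq> lattice_of (Suc n)"
  unfolding chord_def side_vec_def chord_idx_def
  by (rule order_trans[OF keys_sum])
    (auto simp: split: if_splits intro!: add_in_lattice diff_in_lattice vtx_in_lattice)

lemma chord_side [simp]: "a < b \<Longrightarrow> b = Suc a \<Longrightarrow> chord a b = sgl 0 1"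
  by (cases "a = 0") (auto simp: chord_def chord_idx_def side_vec_def)

lemma chord_fan: "chord 0 (Suc k) = sgl (if k = 0 then 0 else unit_vec k) 1"
  by (auto simp: chord_def chord_idx_def side_vec_def vtx_def)

lemma expo_skew: "expo a b c d i l = - expo c d a b l i"
  using om_skew[of a c] om_skew[of a d] om_skew[of b c] om_skew[of b d]
  by (auto simp: expo_def cmp_def)

subsection \<open>Quasi-commutation of non-crossing chords\<close>

text \<open>In terms of signs, \<open>hsum a b\<close> is -((-1)^a + (-1)^b)/2, and
  \<open>hdiff a b\<close> below is ((-1)^b - (-1)^a)/2. So \<open>hsum\<close> vanishes unless the
  parities agree, and \<open>hdiff\<close> unless they differ.\<close>

definition hsum :: "nat \<Rightarrow> nat \<Rightarrow> int" where
  "hsum a b = 1 - of_bool (even a) - of_bool (even b)"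

definition hdiff :: "nat \<Rightarrow> nat \<Rightarrow> int" where
  "hdiff a b = 1 - of_bool (even a) - of_bool (odd b)"

text \<open>The power of q by which two non-crossing chords quasi-commute. The branches are the
  positions of (a, b) relative to (c, d): left, right, around, inside.\<close>

definition lam :: "nat \<Rightarrow> nat \<Rightarrow> nat \<Rightarrow> nat \<Rightarrow> int" where
  "lam a b c d =
     (if b \<le> c then hsum a b * hsum c d
      else if d \<le> a then - (hsum a b * hsum c d)
      else if a \<le> c \<and> d \<le> b then hdiff a b * hsum c d
      else - (hdiff c d * hsum a b))"

definition noncrossing :: "nat \<Rightarrow> nat \<Rightarrow> nat \<Rightarrow> nat \<Rightarrow> bool" where
  "noncrossing a b c d \<longleftrightarrow> b \<le> c \<or> d \<le> a \<or> (a \<le> c \<and> d \<le> b) \<or> (c \<le> a \<and> b \<le> d)"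

text \<open>Exchanging the chords exchanges the branches in pairs. The two nested branches overlap
  only for equal chords, where \<open>hdiff\<close> or \<open>hsum\<close> is 0 by parity.\<close>

lemma lam_skew:
  assumes "a < b" "c < d" "noncrossing a b c d"
  shows "lam c d a b = - lam a b c d"
  using assms unfolding noncrossing_def
  by (elim disjE) (auto simp: lam_def hdiff_def hsum_def)

lemmas expo_simps = expo_def om_def tau_def cmp_def lam_def hsum_def hdiff_def

lemma expo_disjoint:
  assumes "a < b" "b \<le> c" "c < d" "i \<in> chord_idx a b" "l \<in> chord_idx c d"
  shows "expo a b c d i l = lam a b c d"
proof -
  have "i < b" "c \<le> l" "a \<le> i" "l < d" using assms by (auto simp: chord_idx_def split: if_splits)
  then show ?thesis using assms(1-3)
    by (cases "even a"; cases "even b"; cases "even c"; cases "even d") (auto simp: expo_simps)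
qed

lemma expo_nested:
  assumes "a \<le> c" "c < d" "d \<le> b" "i \<in> chord_idx a b" "l \<in> chord_idx c d"
  shows "expo a b c d i l = lam a b c d + (if i \<in> {c..<d} then cmp i l else 0)"
proof -
  have "i < b" "c \<le> l" "a \<le> i" "l < d" using assms by (auto simp: chord_idx_def split: if_splits)
  then show ?thesis using assms(1-3)
    by (cases "even a"; cases "even b"; cases "even c"; cases "even d") (auto simp: expo_simps)
qed

text \<open>The product of two chords divided by q^(lam/2). For non-crossing chords it does not
  depend on their order, and in a seed it is the value of the frame at the sum of the two
  exponents.\<close>

definition nprod :: "nat \<Rightarrow> nat \<Rightarrow> nat \<Rightarrow> nat \<Rightarrow> (vec \<Rightarrow>\<^sub>0 laurent)" where
  "nprod a b c d = dsum (\<lambda>i l. expo a b c d i l - lam a b c d) (chord_idx a b) (chord_idx c d)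
     (vtx a + vtx b + (vtx c + vtx d))"

lemma chord_mult_nprod:
  assumes "a < b" "b \<le> Suc (Suc n)" "c < d" "d \<le> Suc (Suc n)"
  shows "lin_mult n (chord a b) (chord c d)
    = lin_mult n (sgl 0 (q_half (lam a b c d))) (nprod a b c d)"
  using assms by (simp add: chord_mult nprod_def dsum_scale)

text \<open>Exchanging the chords negates the normalised exponent, as \<open>expo\<close> and
  \<open>lam\<close> are both skew. That exponent is 0 off the square of common indices; on the
  square it is the antisymmetric \<open>cmp\<close>, and the negation is undone by transposing,
  since the monomials are symmetric.\<close>

lemma nprod_sym_aux:
  assumes "a < b" "c < d" "b \<le> c \<or> (a \<le> c \<and> d \<le> b)"
  shows "nprod a b c d = nprod c d a b"
proof -
  have nc: "noncrossing a b c d" using assms(3) by (auto simp: noncrossing_def)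
  let ?w = "vtx a + vtx b + (vtx c + vtx d)"
  let ?e = "\<lambda>i l. expo a b c d i l - lam a b c d"
  have "nprod c d a b = dsum (\<lambda>i l. expo c d a b i l - lam c d a b) (chord_idx c d) (chord_idx a b) ?w"
    by (simp add: nprod_def add_ac)
  also have "\<dots> = dsum (\<lambda>i l. expo c d a b l i - lam c d a b) (chord_idx a b) (chord_idx c d) ?w"
    by (rule dsum_swap)
  also have "\<dots> = dsum (\<lambda>i l. - ?e i l) (chord_idx a b) (chord_idx c d) ?w"
    by (rule dsum_cong) (simp add: expo_skew[of c d a b] lam_skew[OF assms(1,2) nc])
  also have "\<dots> = dsum ?e (chord_idx a b) (chord_idx c d) ?w"
  proof (cases "b \<le> c \<or> a = 0")
    case True
    have "?e i l = 0" if "i \<in> chord_idx a b" "l \<in> chord_idx c d" for i l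
    proof (cases "b \<le> c")
      case True
      then show ?thesis using expo_disjoint[OF assms(1) _ assms(2) that] by simp
    next
      case False
      then have "a = 0" "a \<le> c" "d \<le> b" using assms True by auto
      then show ?thesis using expo_nested[OF _ assms(2) _ that] that
        by (auto simp: chord_idx_def cmp_def split: if_splits)
    qed
    then show ?thesis by (intro dsum_cong) simp
  next
    case False
    then have nest: "a \<le> c" "d \<le> b" "a > 0" "c > 0" using assms by auto
    have e: "?e i l = (if i \<in> {c..<d} then cmp i l else 0)"
      if "i \<in> chord_idx a b" "l \<in> {c..<d}" for i l
      using expo_nested[OF nest(1) assms(2) nest(2) that(1)] that nest by (auto simp: chord_idx_def)
    have idx: "chord_idx a b = ({a..<c} \<union> {d..<b}) \<union> {c..<d}" "chord_idx c d = {c..<d}"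
      using nest assms by (auto simp: chord_idx_def)
    have sub: "{a..<c} \<union> {d..<b} \<subseteq> chord_idx a b" "{c..<d} \<subseteq> chord_idx a b"
      unfolding idx by auto
    have 1: "dsum (\<lambda>i l. - ?e i l) ({a..<c} \<union> {d..<b}) {c..<d} ?w
        = dsum ?e ({a..<c} \<union> {d..<b}) {c..<d} ?w"
    proof (rule dsum_cong)
      fix i l assume i: "i \<in> {a..<c} \<union> {d..<b}" and l: "l \<in> {c..<d}"
      have "?e i l = 0" using e[OF subsetD[OF sub(1) i] l] i assms(2) by auto
      then show "- ?e i l = ?e i l" by simp
    qed
    have 2: "dsum (\<lambda>i l. - ?e i l) {c..<d} {c..<d} ?w = dsum ?e {c..<d} {c..<d} ?w"
    proof (subst dsum_swap, rule dsum_cong)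
      fix i l assume i: "i \<in> {c..<d}" and l: "l \<in> {c..<d}"
      show "- ?e l i = ?e i l"
        using e[OF subsetD[OF sub(2) i] l] e[OF subsetD[OF sub(2) l] i] i l by (auto simp: cmp_def)
    qed
    have u: "dsum f (chord_idx a b) (chord_idx c d) ?w
        = dsum f ({a..<c} \<union> {d..<b}) {c..<d} ?w + dsum f {c..<d} {c..<d} ?w" for f
      unfolding idx by (rule dsum_Un_left) auto
    show ?thesis
      unfolding u 1 2 ..
  qed
  finally show ?thesis by (simp add: nprod_def)
qed

lemma nprod_sym:
  assumes "a < b" "c < d" "noncrossing a b c d"
  shows "nprod a b c d = nprod c d a b"
  using assms nprod_sym_aux[of a b c d] nprod_sym_aux[of c d a b]
  by (auto simp: noncrossing_def)

subsection \<open>The quantum Ptolemy relations\<close>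

text \<open>Sorts the terms of a product of the crossing chords (a, c) and (b, d). A pair with i
  below b and l from c on belongs to the sides (a, b), (c, d), every other pair to (b, c), (a, d).
  Items 1, 3, 6 treat one order of the crossing chords and 2, 4, 5, 7 the other. With both indices
  between b and c, the first order matches directly, the second after transposition.\<close>

lemma expo_ptolemy:
  assumes "a < b" "b < c" "c < d"
  shows "\<lbrakk>a \<le> i; i < b; b \<le> l; l < c\<rbrakk> \<Longrightarrow>
      expo a c b d i l = lam a c b c + lam a c a d + (expo b c a d l i - lam b c a d)"
    and "\<lbrakk>a \<le> i; i < b; b \<le> l; l < c\<rbrakk> \<Longrightarrow>
      - expo a c b d i l = lam b d b c + lam b d a d + (expo b c a d l i - lam b c a d)"
    and "\<lbrakk>b \<le> i; i < c; b \<le> l; l < d\<rbrakk> \<Longrightarrow>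
      expo a c b d i l = lam a c b c + lam a c a d + (expo b c a d i l - lam b c a d)"
    and "\<lbrakk>b \<le> i; i < c; c \<le> l; l < d\<rbrakk> \<Longrightarrow>
      - expo a c b d i l = lam b d b c + lam b d a d + (expo b c a d i l - lam b c a d)"
    and "\<lbrakk>b \<le> i; i < c; b \<le> l; l < c\<rbrakk> \<Longrightarrow>
      - expo a c b d i l = lam b d b c + lam b d a d + (expo b c a d l i - lam b c a d)"
    and "\<lbrakk>a \<le> i; i < b; c \<le> l; l < d\<rbrakk> \<Longrightarrow>
      expo a c b d i l = lam a c a b + lam a c c d + (expo a b c d i l - lam a b c d)"
    and "\<lbrakk>a \<le> i; i < b; c \<le> l; l < d\<rbrakk> \<Longrightarrow>
      - expo a c b d i l = lam b d a b + lam b d c d + (expo a b c d i l - lam a b c d)"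
  using assms
  by (cases "even a"; cases "even b"; cases "even c"; cases "even d"; simp add: expo_simps)+

text \<open>Terms are matched block by block, with \<open>f\<close> for the crossing chords and
  \<open>g\<close>, \<open>h\<close> for the two pairs of opposite sides. The two alternatives in
  \<open>mid\<close> are the two orders of the crossing chords.\<close>

lemma ptolemy_dsum:
  fixes a b c d :: nat and f g h :: "nat \<Rightarrow> nat \<Rightarrow> int"
  assumes ord: "a < b" "b < c" "c < d"
    and low: "\<And>i l. \<lbrakk>a \<le> i; i < b; b \<le> l; l < c\<rbrakk> \<Longrightarrow> f i l = g l i"
    and mid: "(\<forall>i l. b \<le> i \<and> i < c \<and> b \<le> l \<and> l < c \<longrightarrow> f i l = g i l) \<or>
      (\<forall>i l. b \<le> i \<and> i < c \<and> b \<le> l \<and> l < c \<longrightarrow> f i l = g l i)"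
    and high: "\<And>i l. \<lbrakk>b \<le> i; i < c; c \<le> l; l < d\<rbrakk> \<Longrightarrow> f i l = g i l"
    and out: "\<And>i l. \<lbrakk>a \<le> i; i < b; c \<le> l; l < d\<rbrakk> \<Longrightarrow> f i l = h i l"
  shows "dsum f (chord_idx a c) (chord_idx b d) w
    = dsum g (chord_idx b c) (chord_idx a d) w + dsum h (chord_idx a b) (chord_idx c d) w"
proof -
  have bd: "chord_idx b d = {b..<c} \<union> {c..<d}" "chord_idx b c = {b..<c}" "chord_idx c d = {c..<d}"
    using ord by (auto simp: chord_idx_def)
  let ?ab = "chord_idx a b"
  have ab: "i \<in> ?ab \<Longrightarrow> a \<le> i \<and> i < b" for i using ord by (auto simp: chord_idx_def split: if_splits)
  have 1: "dsum f ?ab {b..<c} w = dsum g {b..<c} ?ab w"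
    by (subst dsum_swap, rule dsum_cong) (use ab low in auto)
  have 2: "dsum f ?ab {c..<d} w = dsum h ?ab {c..<d} w"
    by (rule dsum_cong) (use ab out in auto)
  show ?thesis
  proof (cases "a = 0")
    \<comment> \<open>The chords from a = 0 have the single index 0, so only the blocks with first
      index below b occur.\<close>
    case True
    then have "chord_idx a c = ?ab" "chord_idx a d = ?ab" by (simp_all add: chord_idx_def)
    then show ?thesis unfolding bd using 1 2 by (simp add: dsum_Un_right)
  next
    case False
    then have ac: "chord_idx a c = ?ab \<union> {b..<c}" "chord_idx a d = ?ab \<union> ({b..<c} \<union> {c..<d})"
      and dis: "?ab \<inter> {b..<c} = {}" "?ab \<inter> {c..<d} = {}" "{b..<c} \<inter> {c..<d} = {}"
      using ord by (auto simp: chord_idx_def)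
    have 3: "dsum f {b..<c} {b..<c} w = dsum g {b..<c} {b..<c} w"
      using mid
    proof
      assume *: "\<forall>i l. b \<le> i \<and> i < c \<and> b \<le> l \<and> l < c \<longrightarrow> f i l = g i l"
      show ?thesis by (rule dsum_cong) (use * in auto)
    next
      assume *: "\<forall>i l. b \<le> i \<and> i < c \<and> b \<le> l \<and> l < c \<longrightarrow> f i l = g l i"
      show ?thesis by (subst dsum_swap, rule dsum_cong) (use * in auto)
    qed
    have 4: "dsum f {b..<c} {c..<d} w = dsum g {b..<c} {c..<d} w"
      by (rule dsum_cong) (use high in auto)
    show ?thesis
      unfolding ac bd using dis
      by (simp add: dsum_Un_right dsum_Un_left 1 2 3 4 Int_Un_distrib)
  qed
qed

lemma ptolemy_ordered:
  assumes "a < b" "b < c" "c < d" "d \<le> Suc (Suc n)"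
  shows "lin_mult n (chord a c) (chord b d)
      = lin_mult n (sgl 0 (q_half (lam a c b c + lam a c a d))) (nprod b c a d)
      + lin_mult n (sgl 0 (q_half (lam a c a b + lam a c c d))) (nprod a b c d)"
    and "lin_mult n (chord b d) (chord a c)
      = lin_mult n (sgl 0 (q_half (lam b d b c + lam b d a d))) (nprod b c a d)
      + lin_mult n (sgl 0 (q_half (lam b d a b + lam b d c d))) (nprod a b c d)"
proof -
  let ?w = "vtx a + vtx c + (vtx b + vtx d)"
  let ?g = "expo b c a d" and ?h = "expo a b c d"
  have w: "vtx b + vtx c + (vtx a + vtx d) = ?w" "vtx a + vtx b + (vtx c + vtx d) = ?w"
    "vtx b + vtx d + (vtx a + vtx c) = ?w"
    by (simp_all add: algebra_simps)
  note e = expo_ptolemy[OF assms(1-3)]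
  show "lin_mult n (chord a c) (chord b d)
      = lin_mult n (sgl 0 (q_half (lam a c b c + lam a c a d))) (nprod b c a d)
      + lin_mult n (sgl 0 (q_half (lam a c a b + lam a c c d))) (nprod a b c d)"
    using assms unfolding nprod_def dsum_scale w
    by (subst chord_mult) (auto intro!: ptolemy_dsum simp: e(1,3,6))
  have "lin_mult n (chord b d) (chord a c)
      = dsum (\<lambda>i l. - expo a c b d i l) (chord_idx a c) (chord_idx b d) ?w"
    using assms by (subst chord_mult; simp add: w)
      (subst dsum_swap, rule dsum_cong, simp add: expo_skew[of b d a c])
  also have "\<dots> = lin_mult n (sgl 0 (q_half (lam b d b c + lam b d a d))) (nprod b c a d)
      + lin_mult n (sgl 0 (q_half (lam b d a b + lam b d c d))) (nprod a b c d)"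
    using assms unfolding nprod_def dsum_scale w
    by (intro ptolemy_dsum) (auto simp: e(2,4,5,7))
  finally show "lin_mult n (chord b d) (chord a c)
      = lin_mult n (sgl 0 (q_half (lam b d b c + lam b d a d))) (nprod b c a d)
      + lin_mult n (sgl 0 (q_half (lam b d a b + lam b d c d))) (nprod a b c d)" .
qed

section \<open>Chords with unordered endpoints and quadrilaterals in cyclic order\<close>

definition uchord :: "nat \<Rightarrow> nat \<Rightarrow> (vec \<Rightarrow>\<^sub>0 laurent)" where
  "uchord p q = chord (min p q) (max p q)"

definition ulam :: "nat \<Rightarrow> nat \<Rightarrow> nat \<Rightarrow> nat \<Rightarrow> int" where
  "ulam p q r s = lam (min p q) (max p q) (min r s) (max r s)"

definition unprod :: "nat \<Rightarrow> nat \<Rightarrow> nat \<Rightarrow> nat \<Rightarrow> (vec \<Rightarrow>\<^sub>0 laurent)" where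
  "unprod p q r s = nprod (min p q) (max p q) (min r s) (max r s)"

definition unoncrossing :: "nat \<Rightarrow> nat \<Rightarrow> nat \<Rightarrow> nat \<Rightarrow> bool" where
  "unoncrossing p q r s = noncrossing (min p q) (max p q) (min r s) (max r s)"

definition cyc4 :: "nat \<Rightarrow> nat \<Rightarrow> nat \<Rightarrow> nat \<Rightarrow> bool" where
  "cyc4 p q r s \<longleftrightarrow> (p < q \<and> q < r \<and> r < s) \<or> (q < r \<and> r < s \<and> s < p)
     \<or> (r < s \<and> s < p \<and> p < q) \<or> (s < p \<and> p < q \<and> q < r)"

lemma uchord_mult_unprod:
  assumes "p \<noteq> q" "r \<noteq> s" "p \<le> Suc (Suc n)" "q \<le> Suc (Suc n)" "r \<le> Suc (Suc n)" "s \<le> Suc (Suc n)"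
  shows "lin_mult n (uchord p q) (uchord r s)
    = lin_mult n (sgl 0 (q_half (ulam p q r s))) (unprod p q r s)"
  unfolding uchord_def ulam_def unprod_def using assms by (intro chord_mult_nprod) auto

lemma unprod_sym:
  assumes "p \<noteq> q" "r \<noteq> s" "unoncrossing p q r s"
  shows "unprod p q r s = unprod r s p q"
  using assms unfolding unprod_def unoncrossing_def by (intro nprod_sym) auto

lemma ulam_skew:
  "\<lbrakk>p \<noteq> q; r \<noteq> s; unoncrossing p q r s\<rbrakk> \<Longrightarrow> ulam r s p q = - ulam p q r s"
  unfolding ulam_def unoncrossing_def by (rule lam_skew) auto

text \<open>Turning the quadrilateral by one vertex exchanges its diagonals. The four positions of
  the smallest vertex therefore reduce alternately to the two orders in
  \<open>ptolemy_ordered\<close>, and the symmetry of \<open>nprod\<close> rearranges the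
  sides.\<close>

theorem ptolemy:
  assumes "cyc4 p q r s" "p \<le> Suc (Suc n)" "q \<le> Suc (Suc n)" "r \<le> Suc (Suc n)" "s \<le> Suc (Suc n)"
  shows "lin_mult n (uchord p r) (uchord q s)
      = lin_mult n (sgl 0 (q_half (ulam p r q r + ulam p r s p))) (unprod q r s p)
      + lin_mult n (sgl 0 (q_half (ulam p r p q + ulam p r r s))) (unprod p q r s)"
proof -
  have sym: "nprod b c a d = nprod a d b c" "nprod a b c d = nprod c d a b"
    if "a < b" "b < c" "c < d" for a b c d
    using that by (auto intro!: nprod_sym simp: noncrossing_def)
  consider "p < q" "q < r" "r < s" | "q < r" "r < s" "s < p" | "r < s" "s < p" "p < q"
    | "s < p" "p < q" "q < r"
    using assms(1) by (auto simp: cyc4_def)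
  then show ?thesis
  proof cases
    case 1
    then show ?thesis
      using ptolemy_ordered(1)[of p q r s n] assms
      by (simp add: uchord_def ulam_def unprod_def min_absorb1 min_absorb2 max_absorb1 max_absorb2)
  next
    case 2
    then show ?thesis
      using ptolemy_ordered(2)[of q r s p n] assms sym[of q r s p]
      by (simp add: uchord_def ulam_def unprod_def min_absorb1 min_absorb2 max_absorb1 max_absorb2 add.commute)
  next
    case 3
    then show ?thesis
      using ptolemy_ordered(1)[of r s p q n] assms sym[of r s p q]
      by (simp add: uchord_def ulam_def unprod_def min_absorb1 min_absorb2 max_absorb1 max_absorb2 add.commute)
  next
    case 4
    then show ?thesis
      using ptolemy_ordered(2)[of s p q r n] assms sym[of s p q r]
      by (simp add: uchord_def ulam_def unprod_def min_absorb1 min_absorb2 max_absorb1 max_absorb2 add.commute)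
  qed
qed

section \<open>Skew-fields of fractions and toric frames\<close>

declare single_one [simp del]

lemma single_inject [simp]: "sgl e a = sgl e b \<longleftrightarrow> a = b"
  and single_eq_0_iff [simp]: "sgl e a = 0 \<longleftrightarrow> a = 0"
  by (metis lookup_single_eq) (metis lookup_single_eq lookup_zero single_zero)

locale torus_fractions =
  fixes m :: nat and L :: matrix and F :: "'f ring" (structure) and j :: "'f embedding"
  assumes L_skew: "\<And>i l. i \<in> {1..m} \<Longrightarrow> l \<in> {1..m} \<Longrightarrow> L i l = - L l i"
    and fractions: "skew_field_of_fractions (quantum_torus m L) F j"
begin

sublocale Ring.ring F
  using fractions by (simp add: skew_field_of_fractions_def skew_field_def)

abbreviation "\<kappa> \<equiv> coeff_in j"
abbreviation "tmon \<equiv> torus_monom j"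
abbreviation "lat \<equiv> lattice_of m"
abbreviation "bil \<equiv> bil_form m L"
abbreviation "tmul \<equiv> torus_mult m L"

lemma Units_iff: "x \<in> Units F \<longleftrightarrow> x \<in> carrier F \<and> x \<noteq> \<zero>"
  using fractions by (auto simp: skew_field_of_fractions_def skew_field_def)

lemma j_hom: "j \<in> ring_hom (quantum_torus m L) F"
  using fractions by (simp add: skew_field_of_fractions_def)

lemma j_closed [intro]: "kys f \<subseteq> lat \<Longrightarrow> j f \<in> carrier F"
  and j_mult: "\<lbrakk>kys f \<subseteq> lat; kys g \<subseteq> lat\<rbrakk> \<Longrightarrow> j (tmul f g) = j f \<otimes> j g"
  and j_add: "\<lbrakk>kys f \<subseteq> lat; kys g \<subseteq> lat\<rbrakk> \<Longrightarrow> j (f + g) = j f \<oplus> j g"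
  and j_one [simp]: "j (sgl 0 1) = \<one>"
  using ring_hom_memE[OF j_hom] by (auto simp: quantum_torus_simps)

lemma j_inject: "\<lbrakk>kys f \<subseteq> lat; kys g \<subseteq> lat\<rbrakk> \<Longrightarrow> j f = j g \<longleftrightarrow> f = g"
  using fractions by (auto simp: skew_field_of_fractions_def quantum_torus_simps inj_on_def)

lemma j_zero [simp]: "j 0 = \<zero>"
  using j_add[of 0 0] add.l_cancel_one[of "j 0" "j 0"] j_closed[of 0] by simp

lemma j_eq_zero_iff: "kys f \<subseteq> lat \<Longrightarrow> j f = \<zero> \<longleftrightarrow> f = 0"
  using j_inject[of f 0] by simp

lemma fraction:
  assumes "x \<in> carrier F"
  obtains f g where "kys f \<subseteq> lat" "kys g \<subseteq> lat" "g \<noteq> 0" "x = j f \<otimes> inv (j g)"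
proof -
  obtain f g where "f \<in> carrier (quantum_torus m L)"
    "g \<in> carrier (quantum_torus m L) - {\<zero>\<^bsub>quantum_torus m L\<^esub>}" "x = j f \<otimes> inv (j g)"
    using assms fractions unfolding skew_field_of_fractions_def by blast
  then show thesis using that[of f g] by (simp add: quantum_torus_simps)
qed

lemma keys_coeff [simp]: "kys (sgl 0 c) \<subseteq> lat"
  by (auto simp: lattice_of_def)

lemma keys_monom: "e \<in> lat \<Longrightarrow> kys (sgl e c) \<subseteq> lat"
  by auto

lemma \<kappa>_closed [simp, intro]: "\<kappa> c \<in> carrier F"
  unfolding coeff_in_def by (rule j_closed) simp

lemma \<kappa>_mult: "\<kappa> (a * b) = \<kappa> a \<otimes> \<kappa> b"
  unfolding coeff_in_def by (subst j_mult[symmetric]) (simp_all add: torus_mult_single)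

lemma \<kappa>_add: "\<kappa> (a + b) = \<kappa> a \<oplus> \<kappa> b"
  unfolding coeff_in_def by (subst j_add[symmetric]) (simp_all add: single_add)

lemma \<kappa>_one [simp]: "\<kappa> 1 = \<one>"
  by (simp add: coeff_in_def)

lemma \<kappa>_inject: "\<kappa> a = \<kappa> b \<longleftrightarrow> a = b"
  by (simp add: coeff_in_def j_inject)

lemma j_scale: "kys f \<subseteq> lat \<Longrightarrow> j (tmul (sgl 0 c) f) = \<kappa> c \<otimes> j f"
  by (simp add: j_mult coeff_in_def)

lemma coeff_commute: "kys f \<subseteq> lat \<Longrightarrow> tmul f (sgl 0 c) = tmul (sgl 0 c) f"
  by (induction f rule: keys_subset_induct)
    (auto simp: torus_mult_single twisted_mult_add_left twisted_mult_add_right mult.commute)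

lemma tmul_closed: "\<lbrakk>kys f \<subseteq> lat; kys g \<subseteq> lat\<rbrakk> \<Longrightarrow> kys (tmul f g) \<subseteq> lat"
  by (rule torus.twisted_mult_closed)

lemma Units_commute_inv:
  assumes "u \<in> Units F" "x \<in> carrier F" "u \<otimes> x = x \<otimes> u"
  shows "inv u \<otimes> x = x \<otimes> inv u"
proof -
  have u: "u \<in> carrier F" using assms(1) by (rule Units_closed)
  have "inv u \<otimes> x = inv u \<otimes> (x \<otimes> u) \<otimes> inv u"
    using assms(1,2) u by (simp add: m_assoc)
  also have "\<dots> = inv u \<otimes> (u \<otimes> x) \<otimes> inv u"
    using assms(3) by simp
  also have "\<dots> = x \<otimes> inv u"
    using assms(1,2) u by (simp add: m_assoc[symmetric])
  finally show ?thesis .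
qed

lemma \<kappa>_central:
  assumes "x \<in> carrier F" shows "x \<otimes> \<kappa> c = \<kappa> c \<otimes> x"
proof -
  obtain f g where fg: "kys f \<subseteq> lat" "kys g \<subseteq> lat" "g \<noteq> 0" "x = j f \<otimes> inv (j g)"
    using assms by (rule fraction)
  have *: "j h \<otimes> \<kappa> c = \<kappa> c \<otimes> j h" if "kys h \<subseteq> lat" for h
    using that by (simp add: coeff_in_def coeff_commute flip: j_mult)
  have u: "j g \<in> Units F" using fg by (auto simp: Units_iff j_eq_zero_iff)
  have "x \<otimes> \<kappa> c = j f \<otimes> (inv (j g) \<otimes> \<kappa> c)"
    using fg u by (simp add: m_assoc j_closed)
  also have "\<dots> = j f \<otimes> (\<kappa> c \<otimes> inv (j g))"
    using Units_commute_inv[OF u _ *] fg by simp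
  also have "\<dots> = \<kappa> c \<otimes> x"
    using *[OF fg(1)] fg u by (simp add: m_assoc[symmetric] j_closed)
  finally show ?thesis .
qed

lemma integral:
  assumes "x \<otimes> y = \<zero>" "x \<in> carrier F" "y \<in> carrier F"
  shows "x = \<zero> \<or> y = \<zero>"
proof (rule disjCI)
  assume "y \<noteq> \<zero>"
  then have y: "y \<in> Units F" using assms by (simp add: Units_iff)
  have "x = x \<otimes> (y \<otimes> inv y)" using y assms by simp
  also have "\<dots> = (x \<otimes> y) \<otimes> inv y" using m_assoc[of x y "inv y"] y assms(2,3) by simp
  also have "\<dots> = \<zero>" using assms y by simp
  finally show "x = \<zero>" .
qed

lemma mult_cancel_left:
  "\<lbrakk>a \<in> carrier F; a \<noteq> \<zero>; x \<in> carrier F; y \<in> carrier F; a \<otimes> x = a \<otimes> y\<rbrakk> \<Longrightarrow> x = y"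
  using Units_l_cancel[of a x y] by (simp add: Units_iff)

lemma mult_cancel_right:
  assumes "a \<in> carrier F" "a \<noteq> \<zero>" "x \<in> carrier F" "y \<in> carrier F" "x \<otimes> a = y \<otimes> a"
  shows "x = y"
proof -
  have a: "a \<in> Units F" using assms by (simp add: Units_iff)
  have "x \<otimes> a \<otimes> inv a = y \<otimes> a \<otimes> inv a" using assms(5) by simp
  then show ?thesis using a assms(1,3,4) by (simp add: m_assoc)
qed

lemma \<kappa>_q_half_cancel:
  assumes "\<kappa> (q_half a) \<otimes> x = \<kappa> (q_half b) \<otimes> x" "x \<in> carrier F" "x \<noteq> \<zero>"
  shows "a = b"
  using mult_cancel_right[OF assms(2,3) _ _ assms(1)] by (simp add: \<kappa>_inject)

lemma tmon_closed [intro]: "e \<in> lat \<Longrightarrow> tmon e \<in> carrier F"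
  by (auto simp: torus_monom_def)

lemma tmon_mult:
  "\<lbrakk>e \<in> lat; f \<in> lat\<rbrakk> \<Longrightarrow> tmon e \<otimes> tmon f = \<kappa> (q_half (bil e f)) \<otimes> tmon (e + f)"
  by (simp add: torus_monom_def coeff_in_def add_in_lattice keys_monom torus_mult_single
      flip: j_mult)

lemma tmon_zero [simp]: "tmon 0 = \<one>"
  by (simp add: torus_monom_def)

lemma j_monom: "e \<in> lat \<Longrightarrow> j (sgl e c) = \<kappa> c \<otimes> tmon e"
  unfolding torus_monom_def by (subst j_scale[symmetric]) (auto simp: torus_scale)

lemma tmon_neq_zero: "e \<in> lat \<Longrightarrow> tmon e \<noteq> \<zero>"
  by (simp add: torus_monom_def j_eq_zero_iff keys_monom)

lemma bil_skew: "bil f e = - bil e f"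
  by (rule bil_form_skew[OF L_skew])

lemma toric_frame_tmon: "toric_frame m F j tmon"
proof -
  have "skew_field_automorphism F j id"
    by (auto simp: skew_field_automorphism_def ring_iso_def ring_hom_def)
  moreover have "lattice_iso m id" by (simp add: lattice_iso_def)
  ultimately show ?thesis unfolding toric_frame_def by (metis id_apply)
qed

text \<open>The automorphism fixes the coefficients, so the relations of the torus monomials pass to
  the frame, with the form pulled back along \<eta>. All lattice vectors are covered, because
  mutation evaluates the frame at sums.\<close>

lemma toric_frameE:
  assumes "toric_frame m F j M"
  obtains \<Lambda> :: "vec \<Rightarrow> vec \<Rightarrow> int" where
    "\<And>c d. \<lbrakk>c \<in> lat; d \<in> lat\<rbrakk> \<Longrightarrow> M c \<otimes> M d = \<kappa> (q_half (\<Lambda> c d)) \<otimes> M (c + d)"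
    "\<And>c d e. \<lbrakk>c \<in> lat; d \<in> lat; e \<in> lat\<rbrakk> \<Longrightarrow> \<Lambda> (c + d) e = \<Lambda> c e + \<Lambda> d e"
    "\<And>c d e. \<lbrakk>c \<in> lat; d \<in> lat; e \<in> lat\<rbrakk> \<Longrightarrow> \<Lambda> e (c + d) = \<Lambda> e c + \<Lambda> e d"
    "\<And>c d. \<Lambda> d c = - \<Lambda> c d"
    "\<And>c. c \<in> lat \<Longrightarrow> M c \<in> carrier F" "\<And>c. c \<in> lat \<Longrightarrow> M c \<noteq> \<zero>"
    "M 0 = \<one>" "inj_on M lat"
proof -
  obtain \<phi> \<eta> where \<phi>: "skew_field_automorphism F j \<phi>" and \<eta>: "lattice_iso m \<eta>"
    and M: "\<And>c. c \<in> lat \<Longrightarrow> M c = \<phi> (tmon (\<eta> c))"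
    using assms by (auto simp: toric_frame_def)
  have \<phi>_hom: "\<phi> \<in> ring_hom F F" and \<phi>_inj: "inj_on \<phi> (carrier F)"
    and \<phi>_coeff: "\<And>c. \<phi> (\<kappa> c) = \<kappa> c"
    using \<phi> by (auto simp: skew_field_automorphism_def ring_iso_def bij_betw_def)
  note \<phi>_simps = ring_hom_memE[OF \<phi>_hom]
  have \<phi>0: "\<phi> \<zero> = \<zero>" using \<phi>_coeff[of 0] by (simp add: coeff_in_def)
  have \<eta>_in: "\<eta> c \<in> lat" if "c \<in> lat" for c
    using that \<eta> by (auto simp: lattice_iso_def bij_betw_def)
  have \<eta>_add: "\<eta> (c + d) = \<eta> c + \<eta> d" if "c \<in> lat" "d \<in> lat" for c d
    using that \<eta> by (auto simp: lattice_iso_def)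
  have \<eta>0: "\<eta> 0 = 0" using \<eta>_add[of 0 0] by simp
  define \<Lambda> where "\<Lambda> = (\<lambda>c d. bil (\<eta> c) (\<eta> d))"
  show thesis
  proof (rule that[of \<Lambda>])
    fix c d assume cd: "c \<in> lat" "d \<in> lat"
    then have "M c \<otimes> M d = \<phi> (tmon (\<eta> c) \<otimes> tmon (\<eta> d))"
      by (simp add: M \<phi>_simps(2) \<eta>_in tmon_closed)
    also have "\<dots> = \<phi> (\<kappa> (q_half (\<Lambda> c d))) \<otimes> \<phi> (tmon (\<eta> (c + d)))"
      using cd by (simp add: \<eta>_in tmon_mult \<eta>_add \<Lambda>_def \<phi>_simps(2) tmon_closed add_in_lattice)
    finally show "M c \<otimes> M d = \<kappa> (q_half (\<Lambda> c d)) \<otimes> M (c + d)"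
      using cd by (simp add: M \<phi>_coeff add_in_lattice)
  next
    fix c assume c: "c \<in> lat"
    show "M c \<noteq> \<zero>"
      using tmon_neq_zero[OF \<eta>_in[OF c]] inj_onD[OF \<phi>_inj, of "tmon (\<eta> c)" \<zero>] \<eta>_in[OF c] c
      by (auto simp: M \<phi>0)
  next
    show "inj_on M lat"
    proof (rule inj_onI)
      fix c d assume cd: "c \<in> lat" "d \<in> lat" "M c = M d"
      then have "tmon (\<eta> c) = tmon (\<eta> d)"
        using inj_onD[OF \<phi>_inj] \<eta>_in by (auto simp: M)
      then have "\<eta> c = \<eta> d"
        using cd \<eta>_in by (simp add: torus_monom_def j_inject keys_monom)
           (metis keys_single singleton_iff zero_neq_one)
      then show "c = d"
        using \<eta> cd by (auto simp: lattice_iso_def bij_betw_def inj_on_def)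
    qed
  qed (use \<phi>_simps in \<open>auto simp: M \<eta>_in \<eta>_add \<eta>0 \<Lambda>_def bil_form_linear tmon_closed
        intro: bil_skew\<close>)
qed

end

section \<open>Labelled triangulations\<close>

definition edge :: "nat \<Rightarrow> nat \<Rightarrow> nat \<times> nat" where
  "edge p q = (min p q, max p q)"

lemma edge_eq_iff: "edge p q = edge r s \<longleftrightarrow> (p = r \<and> q = s) \<or> (p = s \<and> q = r)"
  by (auto simp: edge_def min_def max_def split: if_splits)

lemma edge_commute: "edge p q = edge q p"
  by (simp add: edge_eq_iff)

definition outer_sides :: "nat \<Rightarrow> (nat \<times> nat) set" where
  "outer_sides n = {(x, Suc x) | x. x \<le> Suc n}"

definition edges :: "nat \<Rightarrow> (nat \<Rightarrow> nat \<times> nat) \<Rightarrow> (nat \<times> nat) set" where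
  "edges n d = d ` {1..Suc n} \<union> outer_sides n"

definition quad :: "nat \<Rightarrow> (nat \<Rightarrow> nat \<times> nat) \<Rightarrow> matrix \<Rightarrow> nat \<Rightarrow> nat \<Rightarrow> nat \<Rightarrow> nat \<Rightarrow> nat \<Rightarrow> bool" where
  "quad n d B k p q r s \<longleftrightarrow> cyc4 p q r s \<and> {p, q, r, s} \<subseteq> {..Suc (Suc n)} \<and> d k = edge p r \<and>
     {edge p q, edge q r, edge r s, edge s p} \<subseteq> edges n d \<and>
     (\<forall>i\<in>{1..Suc n}. B i k = of_bool (d i = edge q r \<or> d i = edge s p)
        - of_bool (d i = edge p q \<or> d i = edge r s))"

text \<open>
  The label \<open>i\<close> sits on the chord \<open>d i\<close>. In a triangulation each chord \<open>d k\<close> that is not a side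
  is a diagonal of a quadrilateral, whose sides are read off from the column \<open>k\<close> of \<open>B\<close>.
\<close>

definition labelled :: "nat \<Rightarrow> (nat \<Rightarrow> nat \<times> nat) \<Rightarrow> matrix \<Rightarrow> bool" where
  "labelled n d B \<longleftrightarrow>
     (\<forall>k\<in>{1..n}. \<exists>p q r s. quad n d B k p q r s) \<and>
     (\<forall>i\<in>{1..n}. \<forall>k\<in>{1..n}. B i k = - B k i) \<and>
     (\<forall>i\<in>{1..Suc n}. \<exists>a b. d i = (a, b) \<and> a < b \<and> b \<le> Suc (Suc n))"

lemma cyc4_distinct: "cyc4 p q r s \<Longrightarrow> distinct [p, q, r, s]"
  by (auto simp: cyc4_def)

lemma cyc4_rot: "cyc4 p q r s \<Longrightarrow> cyc4 q r s p"
  by (auto simp: cyc4_def)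

lemma quad_rot2: "quad n d B k p q r s \<Longrightarrow> quad n d B k r s p q"
  unfolding quad_def
  by (auto simp: cyc4_def edge_commute disj_commute)

lemma quad_diag_entry:
  assumes "quad n d B k p q r s" "i \<in> {1..Suc n}"
  shows "B i k = of_bool (d i = edge q r \<or> d i = edge s p)
        - of_bool (d i = edge p q \<or> d i = edge r s)"
  using assms by (auto simp: quad_def)

lemma quad_entry_disj:
  assumes "quad n d B k p q r s" "i \<in> {1..Suc n}"
  shows "B i k = 0 \<longleftrightarrow> d i \<notin> {edge p q, edge q r, edge r s, edge s p}"
    and "B i k = 1 \<longleftrightarrow> d i \<in> {edge q r, edge s p}"
    and "B i k = -1 \<longleftrightarrow> d i \<in> {edge p q, edge r s}"
proof -
  have "distinct [p, q, r, s]" using assms(1) by (auto simp: quad_def dest: cyc4_distinct)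
  then have "\<not> ((d i = edge q r \<or> d i = edge s p) \<and> (d i = edge p q \<or> d i = edge r s))"
    by (auto simp: edge_eq_iff)
  then show "B i k = 0 \<longleftrightarrow> d i \<notin> {edge p q, edge q r, edge r s, edge s p}"
    and "B i k = 1 \<longleftrightarrow> d i \<in> {edge q r, edge s p}"
    and "B i k = -1 \<longleftrightarrow> d i \<in> {edge p q, edge r s}"
    unfolding quad_diag_entry[OF assms] by (auto simp: of_bool_def)
qed

text \<open>Both signs in the definition of the matrix mutation give this matrix.\<close>

definition mutB :: "nat \<Rightarrow> matrix \<Rightarrow> matrix" where
  "mutB k B i l = (if i = k \<or> l = k then - B i l
     else B i l + (if B k l > 0 then B k l * max 0 (B i k) else B k l * max 0 (- B i k)))"

text \<open>The conditions \<open>inj'\<close> and \<open>not_outer\<close> do not come from the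
  combinatorics: they are consequences of the injectivity of the frame of the mutated seed.\<close>

locale flip =
  fixes n :: nat and d :: "nat \<Rightarrow> nat \<times> nat" and B :: matrix and k p q r s :: nat
  assumes lab: "labelled n d B" and k: "k \<in> {1..n}" and qk: "quad n d B k p q r s"
    and inj: "inj_on d {1..Suc n}"
    and inj': "inj_on (d(k := edge q s)) {1..Suc n}"
    and not_outer: "edge q s \<notin> outer_sides n"
begin

abbreviation "d' \<equiv> d(k := edge q s)"

lemma cyc: "cyc4 p q r s" and dk: "d k = edge p r"
  and dist: "p \<noteq> q" "p \<noteq> r" "p \<noteq> s" "q \<noteq> r" "q \<noteq> s" "r \<noteq> s"
  and bound: "p \<le> Suc (Suc n)" "q \<le> Suc (Suc n)" "r \<le> Suc (Suc n)" "s \<le> Suc (Suc n)"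
  and sides: "edge p q \<in> edges n d" "edge q r \<in> edges n d" "edge r s \<in> edges n d"
    "edge s p \<in> edges n d"
  using qk cyc4_distinct[of p q r s] by (auto simp: quad_def)

lemma edges_flip: "D \<in> edges n d \<Longrightarrow> D \<noteq> edge p r \<Longrightarrow> D \<in> edges n d'"
  using dk by (auto simp: edges_def image_iff)

lemma new_edge: "edge q s \<in> edges n d'"
  using k by (auto simp: edges_def image_iff)

lemma new_not_old:
  assumes "D \<in> edges n d" "D \<noteq> edge p r" shows "edge q s \<noteq> D"
proof
  assume D: "edge q s = D"
  then obtain i where i: "i \<in> {1..Suc n}" "d i = D"
    using assms not_outer by (auto simp: edges_def)
  then have "i \<noteq> k" using assms dk by auto
  then have "d' i = d' k" using i(2) D by simp
  then show False using inj_onD[OF inj' _ i(1), of k] k \<open>i \<noteq> k\<close> by simp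
qed

lemma other_label:
  assumes "i \<in> {1..Suc n}" "i \<noteq> k"
  shows "d i \<noteq> edge p r" "d i \<noteq> edge q s" "d' i = d i"
proof -
  have k': "k \<in> {1..Suc n}" using k by simp
  show "d' i = d i" using assms by simp
  show "d i \<noteq> edge p r"
    using inj_onD[OF inj _ assms(1) k'] assms(2) dk by metis
  show "d i \<noteq> edge q s"
    using inj_onD[OF inj' _ assms(1) k'] assms(2) by (metis fun_upd_apply)
qed

text \<open>The new diagonal joins q and s, so the quadrilateral is read from q on; this shift by
  one vertex reverses all signs, as mutation does in column \<open>k\<close>.\<close>

lemma quad_flipped: "quad n d' (mutB k B) k q r s p"
proof -
  have "mutB k B i k = of_bool (d' i = edge r s \<or> d' i = edge p q)
      - of_bool (d' i = edge q r \<or> d' i = edge s p)" if i: "i \<in> {1..Suc n}" for i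
  proof (cases "i = k")
    case True
    have "B k k = 0"
      using quad_diag_entry[OF qk, of k] k dk dist by (simp add: edge_eq_iff)
    then show ?thesis using True dist by (simp add: mutB_def edge_eq_iff)
  next
    case False
    then show ?thesis using quad_diag_entry[OF qk i] by (auto simp: mutB_def)
  qed
  moreover have "{edge q r, edge r s, edge s p, edge p q} \<subseteq> edges n d'"
    using sides edges_flip dist by (auto simp: edge_eq_iff)
  ultimately show ?thesis
    using cyc4_rot[OF cyc] bound by (simp add: quad_def)
qed

lemma skew_flipped:
  assumes "i \<in> {1..n}" "l \<in> {1..n}"
  shows "mutB k B i l = - mutB k B l i"
proof -
  have sk: "B l i = - B i l" "B k i = - B i k" "B k l = - B l k"
    using lab assms k unfolding labelled_def by blast+
  show ?thesis
  proof (cases "i = k \<or> l = k")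
    case True
    then have "mutB k B i l = - B i l" "mutB k B l i = - B l i" by (auto simp: mutB_def)
    then show ?thesis using sk(1) by simp
  next
    case False
    consider "B i k = 0" | "B i k = 1" | "B i k = -1"
      using quad_diag_entry[OF qk, of i] assms by (auto simp: of_bool_def split: if_splits)
    moreover consider "B l k = 0" | "B l k = 1" | "B l k = -1"
      using quad_diag_entry[OF qk, of l] assms by (auto simp: of_bool_def split: if_splits)
    ultimately show ?thesis
      using False unfolding mutB_def sk by fastforce
  qed
qed

text \<open>If \<open>B k l\<close> is nonzero, the chord of \<open>k\<close> is a side of the
  quadrilateral of \<open>l\<close>, and by skew symmetry also conversely: the two quadrilaterals
  share a triangle that has both chords as sides. The flip replaces it by another triangle on the
  chord of \<open>l\<close>, which moves one vertex of that quadrilateral; the sign of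
  \<open>B k l\<close> decides which.\<close>

lemma quad_other:
  assumes l: "l \<in> {1..n}" "l \<noteq> k"
  shows "\<exists>p q r s. quad n d' (mutB k B) l p q r s"
proof -
  obtain a b c e where ql: "quad n d B l a b c e"
    using lab l unfolding labelled_def by blast
  have kl: "k \<in> {1..Suc n}" "l \<in> {1..Suc n}" using k l by auto
  have Blk: "B l k = - B k l" using lab l k unfolding labelled_def by blast
  have l': "d l \<noteq> edge p r" "d l \<noteq> edge q s" "d' l = d l" using other_label[OF kl(2) l(2)] by auto
  consider (zero) "B k l = 0" | (pos) "B k l = 1" | (neg) "B k l = -1"
    using quad_diag_entry[OF ql kl(1)] by (auto simp: of_bool_def split: if_splits)
  then show ?thesis
  proof cases
    case zero
    then have nk: "edge p r \<notin> {edge a b, edge b c, edge c e, edge e a}"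
      using quad_entry_disj(1)[OF ql kl(1)] dk by simp
    have sd: "{edge a b, edge b c, edge c e, edge e a} \<subseteq> edges n d" using ql by (auto simp: quad_def)
    have new: "edge q s \<notin> {edge a b, edge b c, edge c e, edge e a}"
    proof
      assume *: "edge q s \<in> {edge a b, edge b c, edge c e, edge e a}"
      then have "edge q s \<noteq> edge p r" using nk by metis
      then show False using new_not_old[OF subsetD[OF sd *]] by simp
    qed
    have "mutB k B i l = of_bool (d' i = edge b c \<or> d' i = edge e a)
        - of_bool (d' i = edge a b \<or> d' i = edge c e)" if i: "i \<in> {1..Suc n}" for i
    proof (cases "i = k")
      case True
      then show ?thesis using zero new by (simp add: mutB_def)
    next
      case False
      then show ?thesis using zero l quad_diag_entry[OF ql i] by (simp add: mutB_def)
    qed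
    moreover have "{edge a b, edge b c, edge c e, edge e a} \<subseteq> edges n d'"
    proof
      fix D assume *: "D \<in> {edge a b, edge b c, edge c e, edge e a}"
      then have "D \<noteq> edge p r" using nk by metis
      then show "D \<in> edges n d'" by (rule edges_flip[OF subsetD[OF sd *]])
    qed
    ultimately have "quad n d' (mutB k B) l a b c e"
      using ql l by (simp add: quad_def)
    then show ?thesis by blast
  next
    case pos
    text \<open>The two quadrilaterals share the triangle \<open>P R S\<close>; after the flip it becomes \<open>Q R S\<close>.\<close>
    have "d k \<in> {edge b c, edge e a}" using quad_entry_disj(2)[OF ql kl(1)] pos by simp
    \<comment> \<open>Half turns keep the diagonals of both quadrilaterals, so the vertices can be
      named such that the chord of \<open>k\<close> runs from b' = P to c' = R.\<close>
    then obtain a' b' c' e' where ql': "quad n d B l a' b' c' e'" "d k = edge b' c'"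
      using ql quad_rot2[OF ql] by auto
    have "(b' = p \<and> c' = r) \<or> (b' = r \<and> c' = p)" using ql'(2) dk by (auto simp: edge_eq_iff)
    then obtain P Q R S where QK: "quad n d B k P Q R S" "b' = P" "c' = R"
      and PQ: "edge Q S = edge q s" "edge P R = edge p r"
      using qk quad_rot2[OF qk] by (auto simp: edge_commute)
    interpret Q: flip n d B k P Q R S
      using lab k QK inj inj' not_outer PQ by unfold_locales auto
    have "d l = edge a' R" using ql' QK by (auto simp: quad_def)
    \<comment> \<open>The sign of \<open>B l k\<close> leaves two sides of the quadrilateral of
      \<open>k\<close>, of which only R S ends in R.\<close>
    moreover have "d l \<in> {edge P Q, edge R S}"
      using quad_entry_disj(3)[OF QK(1) kl(2)] Blk pos by simp
    moreover have "a' \<noteq> P" using ql'(1) QK(2) by (auto simp: quad_def dest: cyc4_distinct)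
    ultimately have a': "a' = S" using Q.dist by (auto simp: edge_eq_iff)
    define T where "T = e'"
    have ql'': "quad n d B l S P R T" using ql' QK a' by (simp add: T_def)
    then have cT: "cyc4 S P R T" by (simp add: quad_def)
    \<comment> \<open>T lies on the arc from R to S and Q on the arc from P to R, so they
      differ.\<close>
    then have dT: "T \<noteq> P" "T \<noteq> R" "T \<noteq> S" "T \<noteq> Q" and cT': "cyc4 S Q R T"
      using Q.cyc by (auto simp: cyc4_def)
    have "mutB k B i l = of_bool (d' i = edge Q R \<or> d' i = edge T S)
        - of_bool (d' i = edge S Q \<or> d' i = edge R T)" if i: "i \<in> {1..Suc n}" for i
    proof (cases "i = k")
      case True
      then show ?thesis using pos PQ(1) Q.dist dT by (simp add: mutB_def edge_eq_iff flip: PQ(1))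
    next
      case False
      note o = Q.other_label[OF i False]
      have "mutB k B i l = B i l + max 0 (B i k)" using False l pos by (simp add: mutB_def)
      also have "\<dots> = of_bool (d i = edge Q R \<or> d i = edge T S)
          - of_bool (d i = edge S Q \<or> d i = edge R T)"
        unfolding quad_diag_entry[OF ql'' i] quad_diag_entry[OF QK(1) i]
        using o Q.dist dT
        by (cases "d i = edge Q R"; cases "d i = edge S P"; cases "d i = edge P Q";
            cases "d i = edge R S") (auto simp: edge_eq_iff)
      finally show ?thesis using False by simp
    qed
    moreover have "{edge S Q, edge Q R, edge R T, edge T S} \<subseteq> edges n d'"
    proof -
      have ef: "D \<in> edges n d \<Longrightarrow> D \<noteq> edge P R \<Longrightarrow> D \<in> edges n d'" for D
        using Q.edges_flip[of D] PQ(1) by simp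
      have "edge R T \<in> edges n d" "edge T S \<in> edges n d" using ql'' by (simp_all add: quad_def)
      moreover have "edge R T \<noteq> edge P R" "edge T S \<noteq> edge P R" "edge Q R \<noteq> edge P R"
        using Q.dist dT by (simp_all add: edge_eq_iff)
      ultimately have "edge R T \<in> edges n d'" "edge T S \<in> edges n d'" "edge Q R \<in> edges n d'"
        using ef Q.sides(2) by blast+
      then show ?thesis using Q.new_edge PQ(1) edge_commute[of S Q] by simp
    qed
    ultimately have "quad n d' (mutB k B) l S Q R T"
      using ql'' l Q.bound cT' by (simp add: quad_def)
    then show ?thesis by blast
  next
    case neg
    \<comment> \<open>Mirror image of the positive case: the shared triangle is again P R S, but the
      chord of \<open>l\<close> is now P S, and the triangle becomes P Q S.\<close>
    have "d k \<in> {edge a b, edge c e}" using quad_entry_disj(3)[OF ql kl(1)] neg by simp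
    then obtain a' b' c' e' where ql': "quad n d B l a' b' c' e'" "d k = edge a' b'"
      using ql quad_rot2[OF ql] by auto
    have "(a' = p \<and> b' = r) \<or> (a' = r \<and> b' = p)" using ql'(2) dk by (auto simp: edge_eq_iff)
    then obtain P Q R S where QK: "quad n d B k P Q R S" "a' = P" "b' = R"
      and PQ: "edge Q S = edge q s" "edge P R = edge p r"
      using qk quad_rot2[OF qk] by (auto simp: edge_commute)
    interpret Q: flip n d B k P Q R S
      using lab k QK inj inj' not_outer PQ by unfold_locales auto
    have "d l = edge P c'" using ql' QK by (auto simp: quad_def)
    moreover have "d l \<in> {edge Q R, edge S P}"
      using quad_entry_disj(2)[OF QK(1) kl(2)] Blk neg by simp
    moreover have "c' \<noteq> R" using ql'(1) QK(3) by (auto simp: quad_def dest: cyc4_distinct)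
    ultimately have c': "c' = S" using Q.dist by (auto simp: edge_eq_iff)
    define T where "T = e'"
    have ql'': "quad n d B l P R S T" using ql' QK c' by (simp add: T_def)
    then have cT: "cyc4 P R S T" by (simp add: quad_def)
    then have dT: "T \<noteq> P" "T \<noteq> R" "T \<noteq> S" "T \<noteq> Q" and cT': "cyc4 P Q S T"
      using Q.cyc by (auto simp: cyc4_def)
    have "mutB k B i l = of_bool (d' i = edge Q S \<or> d' i = edge T P)
        - of_bool (d' i = edge P Q \<or> d' i = edge S T)" if i: "i \<in> {1..Suc n}" for i
    proof (cases "i = k")
      case True
      then show ?thesis using neg PQ(1) Q.dist dT by (simp add: mutB_def edge_eq_iff flip: PQ(1))
    next
      case False
      note o = Q.other_label[OF i False]
      have "mutB k B i l = B i l - max 0 (- B i k)" using False l neg by (simp add: mutB_def)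
      also have "\<dots> = of_bool (d i = edge Q S \<or> d i = edge T P)
          - of_bool (d i = edge P Q \<or> d i = edge S T)"
        unfolding quad_diag_entry[OF ql'' i] quad_diag_entry[OF QK(1) i]
        using o Q.dist dT
        by (cases "d i = edge Q R"; cases "d i = edge S P"; cases "d i = edge P Q";
            cases "d i = edge R S") (auto simp: edge_eq_iff)
      finally show ?thesis using False by simp
    qed
    moreover have "{edge P Q, edge Q S, edge S T, edge T P} \<subseteq> edges n d'"
    proof -
      have ef: "D \<in> edges n d \<Longrightarrow> D \<noteq> edge P R \<Longrightarrow> D \<in> edges n d'" for D
        using Q.edges_flip[of D] PQ(1) by simp
      have "edge S T \<in> edges n d" "edge T P \<in> edges n d" using ql'' by (simp_all add: quad_def)
      moreover have "edge S T \<noteq> edge P R" "edge T P \<noteq> edge P R" "edge P Q \<noteq> edge P R"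
        using Q.dist dT by (simp_all add: edge_eq_iff)
      ultimately have "edge S T \<in> edges n d'" "edge T P \<in> edges n d'" "edge P Q \<in> edges n d'"
        using ef Q.sides(1) by blast+
      then show ?thesis using Q.new_edge PQ(1) by simp
    qed
    ultimately have "quad n d' (mutB k B) l P Q S T"
      using ql'' l Q.bound cT' by (simp add: quad_def)
    then show ?thesis by blast
  qed
qed

lemma labelled_flipped: "labelled n d' (mutB k B)"
  unfolding labelled_def
proof (intro conjI ballI)
  fix l assume "l \<in> {1..n}"
  then show "\<exists>p q r s. quad n d' (mutB k B) l p q r s"
    using quad_flipped quad_other by (cases "l = k") blast+
next
  fix i assume "i \<in> {1..Suc n}"
  then show "\<exists>a b. d' i = (a, b) \<and> a < b \<and> b \<le> Suc (Suc n)"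
    using lab bound dist by (auto simp: labelled_def edge_def)
qed (rule skew_flipped)

end

lemma labelled_cong:
  assumes "labelled n d B" "\<And>i l. \<lbrakk>i \<in> {1..Suc n}; l \<in> {1..n}\<rbrakk> \<Longrightarrow> B' i l = B i l"
  shows "labelled n d B'"
proof -
  have "quad n d B' l p q r s = quad n d B l p q r s" if "l \<in> {1..n}" for l p q r s
    using assms(2) that by (auto simp: quad_def)
  moreover have "B' i l = - B' l i" if "i \<in> {1..n}" "l \<in> {1..n}" for i l
  proof -
    have "B i l = - B l i" using assms(1) that unfolding labelled_def by blast
    moreover have "B' i l = B i l" "B' l i = B l i" using that by (auto intro: assms(2))
    ultimately show ?thesis by metis
  qed
  ultimately show ?thesis using assms(1) unfolding labelled_def by blast
qed

text \<open>\<open>E_mat\<close> and \<open>F_mat\<close> differ from the identity only in column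
  \<open>k\<close> and in row \<open>k\<close>, so each sum keeps at most two terms;
  \<open>B k k = 0\<close> removes the cross term.\<close>

lemma mutate_exchange_eq:
  assumes ex: "finite ex" "ex \<subseteq> {1..m}" and k: "k \<in> ex" and i: "i \<in> {1..m}" and l: "l \<in> ex"
    and B: "B k k = 0"
  shows "mutate_exchange m ex eps k B i l =
    (if i = k \<or> l = k then - B i l
     else B i l + max 0 (- eps * B i k) * B k l + B i k * max 0 (eps * B k l))"
proof -
  have k': "k \<in> {1..m}" using ex k by auto
  define G where "G b = (if i = k then - B k b else B i b + E_mat eps k B i k * B k b)" for b
  have E: "(\<Sum>a\<in>{1..m}. E_mat eps k B i a * B a b) = G b" for b
  proof -
    have "(\<Sum>a\<in>{1..m}. E_mat eps k B i a * B a b)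
        = E_mat eps k B i k * B k b + (\<Sum>a\<in>{1..m} - {k}. E_mat eps k B i a * B a b)"
      using k' by (simp add: sum.remove)
    also have "(\<Sum>a\<in>{1..m} - {k}. E_mat eps k B i a * B a b)
        = (\<Sum>a\<in>{1..m} - {k}. if i = a then B i b else 0)"
      by (intro sum.cong) (auto simp: E_mat_def)
    finally show ?thesis using i by (auto simp: G_def E_mat_def)
  qed
  have "mutate_exchange m ex eps k B i l = (\<Sum>b\<in>ex. \<Sum>a\<in>{1..m}. E_mat eps k B i a * B a b * F_mat eps k B b l)"
    unfolding mutate_exchange_def by (rule sum.swap)
  also have "\<dots> = (\<Sum>b\<in>ex. G b * F_mat eps k B b l)"
    by (simp only: E flip: sum_distrib_right)
  also have "\<dots> = G k * F_mat eps k B k l + (\<Sum>b\<in>ex - {k}. G b * F_mat eps k B b l)"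
    using ex k by (simp add: sum.remove)
  also have "(\<Sum>b\<in>ex - {k}. G b * F_mat eps k B b l) = (\<Sum>b\<in>ex - {k}. if b = l then G l else 0)"
    by (intro sum.cong) (auto simp: F_mat_def)
  finally show ?thesis
    using ex l B by (auto simp: G_def F_mat_def E_mat_def algebra_simps)
qed

section \<open>Seeds of the linear quiver are labelled triangulations\<close>

definition chord_of :: "nat \<times> nat \<Rightarrow> (vec \<Rightarrow>\<^sub>0 laurent)" where
  "chord_of D = chord (fst D) (snd D)"

lemma chord_of_edge: "chord_of (edge p q) = uchord p q"
  by (simp add: chord_of_def edge_def uchord_def)

lemma uchord_keys:
  "\<lbrakk>p \<noteq> q; p \<le> Suc (Suc n); q \<le> Suc (Suc n)\<rbrakk> \<Longrightarrow> kys (uchord p q) \<subseteq> lattice_of (Suc n)"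
  unfolding uchord_def by (intro chord_keys) auto

lemma dsum_keys:
  assumes "w \<in> lattice_of m" "\<And>i. i \<in> U \<union> V \<Longrightarrow> side_vec i \<in> lattice_of m"
  shows "kys (dsum e U V w) \<subseteq> lattice_of m"
  unfolding dsum_def using assms
  by (intro order_trans[OF keys_sum] UN_least) (auto intro!: diff_in_lattice split: if_splits)

lemma nprod_keys:
  assumes "a < b" "b \<le> Suc (Suc n)" "c < d" "d \<le> Suc (Suc n)"
  shows "kys (nprod a b c d) \<subseteq> lattice_of (Suc n)"
  unfolding nprod_def using assms
  by (intro dsum_keys)
    (auto simp: side_vec_def chord_idx_def split: if_splits intro!: add_in_lattice vtx_in_lattice)

lemma unprod_keys:
  assumes "p \<noteq> q" "r \<noteq> s" "{p, q, r, s} \<subseteq> {..Suc (Suc n)}"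
  shows "kys (unprod p q r s) \<subseteq> lattice_of (Suc n)"
  unfolding unprod_def using assms by (intro nprod_keys) auto

lemma cyc4_noncrossing:
  assumes "cyc4 p q r s"
  shows "unoncrossing p r q r" "unoncrossing p r s p" "unoncrossing p r p q"
    "unoncrossing p r r s" "unoncrossing q r s p" "unoncrossing p q r s"
  using assms unfolding cyc4_def unoncrossing_def noncrossing_def
  by (auto simp: min_def max_def)

lemma chord_outer: "(a, b) \<in> outer_sides n \<Longrightarrow> chord a b = sgl 0 1"
  by (auto simp: outer_sides_def)

lemma unit_vec_neq_0 [simp]: "unit_vec i \<noteq> 0"
  by (simp add: unit_vec_def)

lemma unit_vec_inject [simp]: "unit_vec i = unit_vec l \<longleftrightarrow> i = l"
  by (metis lookup_unit_vec zero_neq_one)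

lemma quad_entry_sign:
  assumes "quad n d B k p q r s" "i \<in> {1..Suc n}"
  shows "0 < B i k \<longleftrightarrow> d i = edge q r \<or> d i = edge s p"
    and "B i k < 0 \<longleftrightarrow> d i = edge p q \<or> d i = edge r s"
proof -
  have "B i k \<in> {-1, 0, 1}"
    using quad_diag_entry[OF assms] by (simp add: of_bool_def)
  then have "0 < B i k \<longleftrightarrow> B i k = 1" "B i k < 0 \<longleftrightarrow> B i k = -1" by auto
  then show "0 < B i k \<longleftrightarrow> d i = edge q r \<or> d i = edge s p"
    "B i k < 0 \<longleftrightarrow> d i = edge p q \<or> d i = edge r s"
    using quad_entry_disj(2,3)[OF assms] by simp_all
qed

section \<open>Mutation acts on labelled seeds as a flip\<close>

locale linear_torus =
  fixes n :: nat and F :: "'f ring" (structure) and j :: "'f embedding"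
  assumes n_pos: "n \<ge> 1"
    and fractions_lin: "skew_field_of_fractions (quantum_torus (Suc n) Lambda_lin) F j"
begin

sublocale torus_fractions "Suc n" Lambda_lin F j
  by unfold_locales (auto simp: Lambda_lin_def fractions_lin)

text \<open>Only the values at basis vectors are recorded: the values of the form that a mutation
  uses are then forced by the quasi-commutation of the chords.\<close>

definition seed_labelling :: "'f frame \<Rightarrow> (nat \<Rightarrow> nat \<times> nat) \<Rightarrow> bool" where
  "seed_labelling M d \<longleftrightarrow> toric_frame (Suc n) F j M \<and>
     (\<forall>i\<in>{1..Suc n}. M (unit_vec i) = j (chord_of (d i)))"

text \<open>The outer sides equal 1, which is the value of the frame at 0; injectivity of the frame
  excludes them just as it excludes repeated chords.\<close>

lemma seed_labelling_inj:
  assumes "seed_labelling M d"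
  shows "inj_on d {1..Suc n}" "i \<in> {1..Suc n} \<Longrightarrow> d i \<notin> outer_sides n"
proof -
  obtain \<Lambda> where one: "M 0 = \<one>" and inj: "inj_on M lat"
    using assms by (auto simp: seed_labelling_def elim: toric_frameE)
  show "inj_on d {1..Suc n}"
  proof (rule inj_onI)
    fix i l assume il: "i \<in> {1..Suc n}" "l \<in> {1..Suc n}" "d i = d l"
    then have "M (unit_vec i) = M (unit_vec l)" using assms by (simp add: seed_labelling_def)
    from inj_onD[OF inj this] il show "i = l" by simp
  qed
  show "d i \<notin> outer_sides n" if i: "i \<in> {1..Suc n}"
  proof
    assume "d i \<in> outer_sides n"
    then have "chord_of (d i) = sgl 0 1" by (cases "d i") (simp add: chord_of_def chord_outer)
    then have "M (unit_vec i) = M 0" using assms i one by (simp add: seed_labelling_def)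
    from inj_onD[OF inj this] i show False by simp
  qed
qed

text \<open>Multiplying the exchange formula by the old variable turns its summands into the two
  terms of the Ptolemy relation; then the old variable is cancelled in the skew-field.\<close>

lemma mutated_variable_eq:
  assumes sl: "seed_labelling M d" and k: "k \<in> {1..n}" and qk: "quad n d B k p q r s"
  shows "mutated_variable (Suc n) F k (M, B) = j (uchord q s)"
proof -
  obtain \<Lambda> :: "vec \<Rightarrow> vec \<Rightarrow> int" where
    M_mult: "\<And>c d. \<lbrakk>c \<in> lat; d \<in> lat\<rbrakk> \<Longrightarrow> M c \<otimes> M d = \<kappa> (q_half (\<Lambda> c d)) \<otimes> M (c + d)"
    and "\<And>c d e. \<lbrakk>c \<in> lat; d \<in> lat; e \<in> lat\<rbrakk> \<Longrightarrow> \<Lambda> (c + d) e = \<Lambda> c e + \<Lambda> d e"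
    and \<Lambda>_add: "\<And>c d e. \<lbrakk>c \<in> lat; d \<in> lat; e \<in> lat\<rbrakk> \<Longrightarrow> \<Lambda> e (c + d) = \<Lambda> e c + \<Lambda> e d"
    and \<Lambda>_skew: "\<And>c d. \<Lambda> d c = - \<Lambda> c d"
    and M_closed: "\<And>c. c \<in> lat \<Longrightarrow> M c \<in> carrier F"
    and M_nz: "\<And>c. c \<in> lat \<Longrightarrow> M c \<noteq> \<zero>" and M_0: "M 0 = \<one>" and "inj_on M lat"
  proof -
    show thesis
      using sl[unfolded seed_labelling_def, THEN conjunct1]
    proof (rule toric_frameE, goal_cases)
      case (1 \<Lambda>)
      show thesis by (rule that[of \<Lambda>]) (fact 1)+
    qed
  qed
  note inj = seed_labelling_inj[OF sl]
  have cyc: "cyc4 p q r s" and dk: "d k = edge p r"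
    and bound: "p \<le> Suc (Suc n)" "q \<le> Suc (Suc n)" "r \<le> Suc (Suc n)" "s \<le> Suc (Suc n)"
    and sides: "edge p q \<in> edges n d" "edge q r \<in> edges n d" "edge r s \<in> edges n d"
      "edge s p \<in> edges n d"
    using qk by (auto simp: quad_def)
  have dist: "p \<noteq> q" "p \<noteq> r" "p \<noteq> s" "q \<noteq> r" "q \<noteq> s" "r \<noteq> s"
    using cyc4_distinct[OF cyc] by auto
  \<comment> \<open>The exponent of an edge: a basis vector for a labelled chord, 0 for an outer
    side. Sides equal to 1 then need no separate treatment.\<close>
  define ev where "ev D = (\<Sum>i\<in>{i\<in>{1..Suc n}. d i = D}. unit_vec i)" for D
  have ev_lat: "ev D \<in> lat" for D
    unfolding ev_def by (rule sum_in_lattice) auto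
  have ev_label: "ev (d i) = unit_vec i" if "i \<in> {1..Suc n}" for i
  proof -
    have "{i'\<in>{1..Suc n}. d i' = d i} = {i}" using that inj_onD[OF inj(1)] by blast
    then show ?thesis by (simp only: ev_def) simp
  qed
  have M_ev: "M (ev D) = j (chord_of D)" if "D \<in> edges n d" for D
    using that unfolding edges_def
  proof
    assume "D \<in> d ` {1..Suc n}"
    then obtain i where i: "i \<in> {1..Suc n}" "D = d i" by blast
    then show ?thesis using sl by (simp add: ev_label seed_labelling_def del: atLeastAtMost_iff)
  next
    assume D: "D \<in> outer_sides n"
    then have "{i'\<in>{1..Suc n}. d i' = D} = {}" using inj(2) by blast
    then have "ev D = 0" by (simp only: ev_def) simp
    moreover have "chord_of D = sgl 0 1" using D by (cases D) (simp add: chord_of_def chord_outer)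
    ultimately show ?thesis by (simp add: M_0)
  qed
  \<comment> \<open>Both orders of the product of frame elements are compared with both orders of
    the product of chords. One order alone would fix the frame value only up to a power of q
    involving the unknown form.\<close>
  have pair: "\<Lambda> (ev (edge a b)) (ev (edge c e)) = ulam a b c e \<and>
      M (ev (edge a b) + ev (edge c e)) = j (unprod a b c e)"
    if "edge a b \<in> edges n d" "edge c e \<in> edges n d" "a \<noteq> b" "c \<noteq> e"
      "{a, b, c, e} \<subseteq> {..Suc (Suc n)}" "unoncrossing a b c e" for a b c e
  proof -
    define u where "u = ev (edge a b)"
    define v where "v = ev (edge c e)"
    have uv: "u \<in> lat" "v \<in> lat" "u + v \<in> lat" by (auto simp: u_def v_def ev_lat)
    have bd: "a \<le> Suc (Suc n)" "b \<le> Suc (Suc n)" "c \<le> Suc (Suc n)" "e \<le> Suc (Suc n)"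
      using that(5) by auto
    have M_u: "M u = j (uchord a b)" and M_v: "M v = j (uchord c e)"
      using that(1,2) by (simp_all add: u_def v_def M_ev chord_of_edge)
    note keys = uchord_keys[OF that(3) bd(1,2)] uchord_keys[OF that(4) bd(3,4)]
      unprod_keys[OF that(3,4,5)]
    let ?N = "j (unprod a b c e)" and ?lam = "ulam a b c e"
    have N: "?N \<in> carrier F" using keys(3) by (rule j_closed)
    have 1: "\<kappa> (q_half (\<Lambda> u v)) \<otimes> M (u + v) = \<kappa> (q_half ?lam) \<otimes> ?N"
    proof -
      have "\<kappa> (q_half (\<Lambda> u v)) \<otimes> M (u + v) = j (tmul (uchord a b) (uchord c e))"
        using uv keys by (simp add: M_u M_v j_mult flip: M_mult)
      also have "\<dots> = \<kappa> (q_half ?lam) \<otimes> ?N"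
        using that bd keys by (simp add: uchord_mult_unprod j_scale)
      finally show ?thesis .
    qed
    have 2: "\<kappa> (q_half (- \<Lambda> u v)) \<otimes> M (u + v) = \<kappa> (q_half (- ?lam)) \<otimes> ?N"
    proof -
      have "\<kappa> (q_half (- \<Lambda> u v)) \<otimes> M (u + v) = M v \<otimes> M u"
        using uv M_mult[of v u] \<Lambda>_skew[of u v] by (simp add: add.commute)
      also have "\<dots> = j (tmul (uchord c e) (uchord a b))"
        using keys by (simp add: M_u M_v j_mult)
      also have "\<dots> = \<kappa> (q_half (- ?lam)) \<otimes> ?N"
        using that bd keys unprod_sym[OF that(3,4,6)] ulam_skew[OF that(3,4,6)]
        by (simp add: uchord_mult_unprod j_scale)
      finally show ?thesis .
    qed
    have shift: "?N = \<kappa> (q_half (y - x)) \<otimes> M (u + v)"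
      if "\<kappa> (q_half y) \<otimes> M (u + v) = \<kappa> (q_half x) \<otimes> ?N" for x y
    proof -
      have "?N = \<kappa> (q_half (- x)) \<otimes> (\<kappa> (q_half x) \<otimes> ?N)"
        using N by (simp add: m_assoc[symmetric] flip: \<kappa>_mult)
      also have "\<dots> = \<kappa> (q_half (- x)) \<otimes> (\<kappa> (q_half y) \<otimes> M (u + v))"
        using that by simp
      also have "\<dots> = \<kappa> (q_half (y - x)) \<otimes> M (u + v)"
        using uv M_closed by (simp add: m_assoc[symmetric] flip: \<kappa>_mult q_half_add)
      finally show ?thesis .
    qed
    \<comment> \<open>The two orders express one element as powers of q^(1/2) with opposite
      exponents times the same frame value, so that exponent is 0.\<close>
    have "\<Lambda> u v - ?lam = - \<Lambda> u v - - ?lam"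
      using shift[OF 1] shift[OF 2] uv M_closed M_nz
      by (intro \<kappa>_q_half_cancel[of _ "M (u + v)"]) simp_all
    then have lam: "\<Lambda> u v = ?lam" by simp
    moreover have "M (u + v) = ?N" using shift[OF 1] lam uv M_closed by simp
    ultimately show ?thesis by (simp add: u_def v_def)
  qed
  let ?e = "unit_vec k"
  have k': "k \<in> {1..Suc n}" using k by simp
  have e: "?e \<in> lat" "?e = ev (edge p r)" using ev_label[OF k'] dk k by auto
  have pr: "edge p r \<in> edges n d" unfolding edges_def using imageI[OF k', of d] dk by simp
  have M_e: "M ?e = j (uchord p r)" using M_ev[OF pr] by (simp add: e(2) chord_of_edge)
  have \<Lambda>_0: "\<Lambda> ?e 0 = 0" using \<Lambda>_add[of 0 0 ?e] e by simp
  have \<Lambda>_e: "\<Lambda> ?e ?e = 0" using \<Lambda>_skew[of ?e ?e] by simp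
  have \<Lambda>_ne: "\<Lambda> ?e (- ?e) = 0"
    using \<Lambda>_add[of ?e "- ?e" ?e] e \<Lambda>_0 \<Lambda>_e uminus_in_lattice by simp
  have summand: "- ?e + (ev (edge a b) + ev (edge c f)) \<in> lat \<and>
      M ?e \<otimes> M (- ?e + (ev (edge a b) + ev (edge c f)))
      = \<kappa> (q_half (ulam p r a b + ulam p r c f)) \<otimes> j (unprod a b c f)"
    if "edge a b \<in> edges n d" "edge c f \<in> edges n d" "a \<noteq> b" "c \<noteq> f"
      "{a, b, c, f} \<subseteq> {..Suc (Suc n)}" "unoncrossing a b c f" "unoncrossing p r a b"
      "unoncrossing p r c f" for a b c f
  proof -
    let ?w = "ev (edge a b) + ev (edge c f)"
    have w: "?w \<in> lat" "- ?e + ?w \<in> lat"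
      by (intro add_in_lattice uminus_in_lattice ev_lat e(1))+
    have "M ?e \<otimes> M (- ?e + ?w) = \<kappa> (q_half (\<Lambda> ?e (- ?e + ?w))) \<otimes> M ?w"
      using w e by (simp add: M_mult)
    also have "\<Lambda> ?e (- ?e + ?w) = \<Lambda> ?e (ev (edge a b)) + \<Lambda> ?e (ev (edge c f))"
      unfolding \<Lambda>_add[OF uminus_in_lattice[OF e(1)] w(1) e(1)] \<Lambda>_add[OF ev_lat ev_lat e(1)] \<Lambda>_ne
      by simp
    also have "\<dots> = ulam p r a b + ulam p r c f"
      using pair[OF pr that(1)] pair[OF pr that(2)] that bound dist by (simp add: e(2))
    finally show ?thesis using pair[OF that(1-6)] w by simp
  qed
  have pos: "B i k = 1"
    if "i \<in> {1..Suc n}" "d i = edge q r \<or> d i = edge s p" for i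
    using quad_entry_disj(2)[OF qk that(1)] that(2) by simp
  have plus: "(\<Sum>i\<in>{i\<in>{1..Suc n}. B i k > 0}. sgl i (B i k)) = ev (edge q r) + ev (edge s p)"
  proof -
    have "{i\<in>{1..Suc n}. B i k > 0} = {i\<in>{1..Suc n}. d i = edge q r} \<union> {i\<in>{1..Suc n}. d i = edge s p}"
      using quad_entry_sign(1)[OF qk] by auto
    moreover have "{i\<in>{1..Suc n}. d i = edge q r} \<inter> {i\<in>{1..Suc n}. d i = edge s p} = {}"
      using dist by (auto simp: edge_eq_iff)
    ultimately have "(\<Sum>i\<in>{i\<in>{1..Suc n}. B i k > 0}. sgl i (B i k))
        = (\<Sum>i\<in>{i\<in>{1..Suc n}. d i = edge q r}. sgl i (B i k))
        + (\<Sum>i\<in>{i\<in>{1..Suc n}. d i = edge s p}. sgl i (B i k))"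
      by (simp only:) (rule sum.union_disjoint, auto)
    also have "(\<Sum>i\<in>{i\<in>{1..Suc n}. d i = edge q r}. sgl i (B i k)) = ev (edge q r)"
      unfolding ev_def unit_vec_def by (intro sum.cong) (auto simp: pos)
    also have "(\<Sum>i\<in>{i\<in>{1..Suc n}. d i = edge s p}. sgl i (B i k)) = ev (edge s p)"
      unfolding ev_def unit_vec_def by (intro sum.cong) (auto simp: pos)
    finally show ?thesis .
  qed
  have neg: "B i k = -1"
    if "i \<in> {1..Suc n}" "d i = edge p q \<or> d i = edge r s" for i
    using quad_entry_disj(3)[OF qk that(1)] that(2) by simp
  have minus: "(\<Sum>i\<in>{i\<in>{1..Suc n}. B i k < 0}. sgl i (B i k)) = - (ev (edge p q) + ev (edge r s))"
  proof -
    have "{i\<in>{1..Suc n}. B i k < 0} = {i\<in>{1..Suc n}. d i = edge p q} \<union> {i\<in>{1..Suc n}. d i = edge r s}"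
      using quad_entry_sign(2)[OF qk] by auto
    moreover have "{i\<in>{1..Suc n}. d i = edge p q} \<inter> {i\<in>{1..Suc n}. d i = edge r s} = {}"
      using dist by (auto simp: edge_eq_iff)
    ultimately have "(\<Sum>i\<in>{i\<in>{1..Suc n}. B i k < 0}. sgl i (B i k))
        = (\<Sum>i\<in>{i\<in>{1..Suc n}. d i = edge p q}. sgl i (B i k))
        + (\<Sum>i\<in>{i\<in>{1..Suc n}. d i = edge r s}. sgl i (B i k))"
      by (simp only:) (rule sum.union_disjoint, auto)
    also have "(\<Sum>i\<in>{i\<in>{1..Suc n}. d i = edge p q}. sgl i (B i k)) = - ev (edge p q)"
      unfolding ev_def unit_vec_def sum_negf[symmetric] by (intro sum.cong) (auto simp: neg single_uminus)
    also have "(\<Sum>i\<in>{i\<in>{1..Suc n}. d i = edge r s}. sgl i (B i k)) = - ev (edge r s)"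
      unfolding ev_def unit_vec_def sum_negf[symmetric] by (intro sum.cong) (auto simp: neg single_uminus)
    finally show ?thesis by simp
  qed
  let ?v1 = "- ?e + (ev (edge q r) + ev (edge s p))" and ?v2 = "- ?e + (ev (edge p q) + ev (edge r s))"
  have mv: "mutated_variable (Suc n) F k (M, B) = M ?v1 \<oplus> M ?v2"
    unfolding mutated_variable_def by (simp add: plus[simplified] minus[simplified] algebra_simps)
  note nc = cyc4_noncrossing[OF cyc]
  have t1: "?v1 \<in> lat" "M ?e \<otimes> M ?v1
      = \<kappa> (q_half (ulam p r q r + ulam p r s p)) \<otimes> j (unprod q r s p)"
    using summand[OF sides(2,4)] nc dist bound by auto
  have t2: "?v2 \<in> lat" "M ?e \<otimes> M ?v2
      = \<kappa> (q_half (ulam p r p q + ulam p r r s)) \<otimes> j (unprod p q r s)"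
    using summand[OF sides(1,3)] nc dist bound by auto
  have "M ?e \<otimes> (M ?v1 \<oplus> M ?v2) = M ?e \<otimes> M ?v1 \<oplus> M ?e \<otimes> M ?v2"
    using t1 t2 e M_closed by (simp add: r_distr)
  also have "\<dots> = j (tmul (uchord p r) (uchord q s))"
    unfolding t1(2) t2(2) ptolemy[OF cyc bound]
    using bound dist by (simp add: j_add j_scale tmul_closed unprod_keys)
  also have "\<dots> = M ?e \<otimes> j (uchord q s)"
    using bound dist by (simp add: M_e j_mult uchord_keys)
  finally have eq: "M ?e \<otimes> (M ?v1 \<oplus> M ?v2) = M ?e \<otimes> j (uchord q s)" .
  have "M ?v1 \<oplus> M ?v2 = j (uchord q s)"
    by (rule mult_cancel_left[OF M_closed[OF e(1)] M_nz[OF e(1)]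
          add.m_closed[OF M_closed[OF t1(1)] M_closed[OF t2(1)]] _ eq])
      (simp add: j_closed uchord_keys bound dist)
  then show ?thesis using mv by simp
qed

definition seed_inv :: "'f seed \<Rightarrow> bool" where
  "seed_inv t \<longleftrightarrow> (\<exists>d. seed_labelling (fst t) d \<and> labelled n d (snd t))"

text \<open>The mutated seed is given with a toric frame, and the injectivity of this frame provides
  what the flip requires of the new labelling.\<close>

lemma seed_inv_mutation:
  assumes "seed_inv t" "k \<in> {1..n}" "seed_mutation (Suc n) {1..n} F j k t t'"
  shows "seed_inv t'"
proof -
  obtain M B M' B' where t: "t = (M, B)" "t' = (M', B')" by (cases t, cases t')
  from assms(1) obtain d where sl: "seed_labelling M d" and lab: "labelled n d B"
    by (auto simp: seed_inv_def t)
  obtain p q r s where qk: "quad n d B k p q r s"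
    using lab assms(2) unfolding labelled_def by blast
  let ?d = "d(k := edge q s)"
  have mut: "toric_frame (Suc n) F j M'"
    "\<And>i. i \<in> {1..Suc n} - {k} \<Longrightarrow> M' (unit_vec i) = M (unit_vec i)"
    "M' (unit_vec k) = mutated_variable (Suc n) F k (M, B)"
    using assms(3) unfolding seed_mutation_def quantum_seed_def t by auto
  obtain eps :: int where eps: "eps \<in> {1, -1}"
    "\<forall>i\<in>{1..Suc n}. \<forall>l\<in>{1..n}. B' i l = mutate_exchange (Suc n) {1..n} eps k B i l"
    using assms(3) unfolding seed_mutation_def t prod.case by blast
  have M'k: "M' (unit_vec k) = j (chord_of (edge q s))"
    using mut(3) mutated_variable_eq[OF sl assms(2) qk] by (simp add: chord_of_edge)
  have sl': "seed_labelling M' ?d"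
    unfolding seed_labelling_def
  proof (intro conjI ballI)
    fix i assume "i \<in> {1..Suc n}"
    then show "M' (unit_vec i) = j (chord_of (?d i))"
      using mut(2)[of i] M'k sl unfolding seed_labelling_def by (cases "i = k") auto
  qed (rule mut(1))
  have k': "k \<in> {1..Suc n}" using assms(2) by simp
  interpret flip n d B k p q r s
    using seed_labelling_inj[OF sl] seed_labelling_inj[OF sl'] seed_labelling_inj(2)[OF sl' k']
      lab qk assms(2)
    by unfold_locales auto
  have "B' i l = mutB k B i l" if il: "i \<in> {1..Suc n}" "l \<in> {1..n}" for i l
  proof -
    obtain a b c e where ql: "quad n d B l a b c e"
      using lab il(2) unfolding labelled_def by blast
    have Bkk: "B k k = 0" using quad_entry_disj(1)[OF qk k'] dk dist by (simp add: edge_eq_iff)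
    have me: "mutate_exchange (Suc n) {1..n} eps k B i l = (if i = k \<or> l = k then - B i l
      else B i l + max 0 (- eps * B i k) * B k l + B i k * max 0 (eps * B k l))"
      by (rule mutate_exchange_eq) (use assms(2) il Bkk in auto)
    have B'il: "B' i l = mutate_exchange (Suc n) {1..n} eps k B i l"
      using eps(2) il by blast
    \<comment> \<open>As \<open>B k l\<close> is -1, 0 or 1, the formulas for both values of
      \<open>eps\<close> collapse to \<open>mutB\<close>.\<close>
    consider "B k l = 0" | "B k l = 1" | "B k l = -1"
      using quad_diag_entry[OF ql k'] by (auto simp: of_bool_def split: if_splits)
    then show ?thesis
      unfolding B'il me mutB_def using eps(1) by cases auto
  qed
  from labelled_cong[OF labelled_flipped this] have "labelled n ?d B'" by blast
  then show ?thesis using sl' by (auto simp: seed_inv_def t)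
qed

section \<open>The fan at the vertex 0 and the seeds reachable from it\<close>

definition fan :: "nat \<Rightarrow> nat \<times> nat" where
  "fan k = (0, Suc k)"

lemma fan_quad:
  assumes "k \<in> {1..n}" shows "quad n fan (B_lin n) k 0 k (Suc k) (Suc (Suc k))"
proof -
  have "edge 0 k \<in> edges n fan"
  \<comment> \<open>For k = 1 the side (0, k) is an outer side; otherwise it carries the label k -
    1.\<close>
  proof (cases "k = 1")
    case True
    then show ?thesis by (auto simp: edges_def outer_sides_def edge_def)
  next
    case False
    then have "edge 0 k = fan (k - 1)" "k - 1 \<in> {1..Suc n}"
      using assms by (auto simp: edge_def fan_def)
    then show ?thesis unfolding edges_def by blast
  qed
  moreover have "edge (Suc (Suc k)) 0 = fan (Suc k)" "Suc k \<in> {1..Suc n}"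
    using assms by (auto simp: edge_def fan_def)
  then have "edge (Suc (Suc k)) 0 \<in> edges n fan" unfolding edges_def by blast
  moreover have "edge k (Suc k) \<in> edges n fan" "edge (Suc k) (Suc (Suc k)) \<in> edges n fan"
    using assms by (auto simp: edges_def outer_sides_def edge_def)
  moreover have "\<forall>i\<in>{1..Suc n}. B_lin n i k
      = of_bool (fan i = edge k (Suc k) \<or> fan i = edge (Suc (Suc k)) 0)
        - of_bool (fan i = edge 0 k \<or> fan i = edge (Suc k) (Suc (Suc k)))"
    using assms by (auto simp: B_lin_def fan_def edge_def)
  ultimately show ?thesis
    using assms by (auto simp: quad_def cyc4_def fan_def edge_def)
qed

lemma fan_labelling: "seed_labelling tmon fan"
  unfolding seed_labelling_def
proof (intro conjI ballI toric_frame_tmon)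
  fix i assume "i \<in> {1..Suc n}"
  then show "tmon (unit_vec i) = j (chord_of (fan i))"
    by (auto simp: chord_of_def fan_def chord_fan torus_monom_def)
qed

lemma labelled_initial: "labelled n fan (B_lin n)"
  unfolding labelled_def
proof (intro conjI ballI)
  fix k assume "k \<in> {1..n}"
  from fan_quad[OF this] show "\<exists>p q r s. quad n fan (B_lin n) k p q r s" by blast
qed (auto simp: B_lin_def fan_def)

lemma mutation_class_inv:
  assumes "t \<in> mutation_class (Suc n) {1..n} F j (initial_seed n j)"
  shows "seed_inv t"
proof -
  have "(\<lambda>t t'. \<exists>k\<in>{1..n}. seed_mutation (Suc n) {1..n} F j k t t')\<^sup>*\<^sup>* (initial_seed n j) t"
    using assms by (simp add: mutation_class_def)
  then show ?thesis
  proof induction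
    case base
    then show ?case
      using fan_labelling labelled_initial by (auto simp: seed_inv_def initial_seed_def)
  next
    case (step y z)
    then show ?case using seed_inv_mutation by blast
  qed
qed

lemma initial_mutated_variable:
  assumes "k \<in> {1..n}"
  shows "mutated_variable (Suc n) F k (initial_seed n j) = j (short k)"
  using mutated_variable_eq[OF fan_labelling assms fan_quad[OF assms]]
  by (simp add: initial_seed_def uchord_def)

text \<open>This is the Ptolemy relation for a, b, b + 1, b + 2. Two of the four sides are 1, so it
  can be solved for the longest chord. The coefficients are left unspecified because only generation
  is at stake.\<close>

lemma chord_recursion:
  assumes "a < b" "Suc b \<le> Suc n"
  obtains x y where "j (chord a (Suc (Suc b))) = \<kappa> x \<otimes>
    (j (chord a (Suc b)) \<otimes> j (short b) \<ominus> \<kappa> y \<otimes> j (chord a b))"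
proof -
  let ?c = "Suc b" and ?e = "Suc (Suc b)"
  have cyc: "cyc4 a b ?c ?e" using assms by (simp add: cyc4_def)
  have bd: "a \<le> Suc (Suc n)" "b \<le> Suc (Suc n)" "?c \<le> Suc (Suc n)" "?e \<le> Suc (Suc n)"
    using assms by auto
  have u: "uchord a b = chord a b" "uchord a ?c = chord a ?c" "uchord b ?e = chord b ?e"
    "uchord ?e a = chord a ?e" "uchord b ?c = sgl 0 1" "uchord ?c ?e = sgl 0 1"
    using assms by (auto simp: uchord_def min_absorb1 max_absorb2 min_absorb2 max_absorb1)
  note nc = cyc4_noncrossing[OF cyc]
  have keys: "kys (chord a b) \<subseteq> lat" "kys (chord a ?c) \<subseteq> lat" "kys (chord b ?e) \<subseteq> lat"
    "kys (chord a ?e) \<subseteq> lat" "kys (unprod b ?c ?e a) \<subseteq> lat" "kys (unprod a b ?c ?e) \<subseteq> lat"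
    using assms by (simp_all add: chord_keys unprod_keys)
  note cl = keys[THEN j_closed]
  define x where "x = ulam b ?c ?e a"
  define y where "y = ulam a b ?c ?e"
  define vx where "vx = ulam a ?c b ?c + ulam a ?c ?e a"
  define vy where "vy = ulam a ?c a b + ulam a ?c ?c ?e"
  have 1: "j (chord a ?e) = \<kappa> (q_half x) \<otimes> j (unprod b ?c ?e a)"
  proof -
    have "j (chord a ?e) = j (tmul (uchord b ?c) (uchord ?e a))"
      using keys cl unfolding u by (simp add: j_mult)
    also have "\<dots> = \<kappa> (q_half x) \<otimes> j (unprod b ?c ?e a)"
      using assms bd keys by (subst uchord_mult_unprod) (auto simp: j_scale x_def)
    finally show ?thesis .
  qed
  have 2: "j (chord a b) = \<kappa> (q_half y) \<otimes> j (unprod a b ?c ?e)"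
  proof -
    have "j (chord a b) = j (tmul (uchord a b) (uchord ?c ?e))"
      using keys cl unfolding u by (simp add: j_mult)
    also have "\<dots> = \<kappa> (q_half y) \<otimes> j (unprod a b ?c ?e)"
      using assms bd keys by (subst uchord_mult_unprod) (auto simp: j_scale y_def)
    finally show ?thesis .
  qed
  have inv: "\<kappa> (q_half v) \<otimes> (\<kappa> (q_half w) \<otimes> z) = \<kappa> (q_half (v + w)) \<otimes> z"
    if "z \<in> carrier F" for v w z
    using that by (simp add: m_assoc[symmetric] q_half_add \<kappa>_mult)
  have 3: "j (chord a ?c) \<otimes> j (chord b ?e)
      = \<kappa> (q_half (vx - x)) \<otimes> j (chord a ?e) \<oplus> \<kappa> (q_half (vy - y)) \<otimes> j (chord a b)"
  proof -
    have "j (chord a ?c) \<otimes> j (chord b ?e) = j (tmul (uchord a ?c) (uchord b ?e))"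
      using keys unfolding u by (simp add: j_mult)
    also have "\<dots> = \<kappa> (q_half vx) \<otimes> j (unprod b ?c ?e a) \<oplus> \<kappa> (q_half vy) \<otimes> j (unprod a b ?c ?e)"
      unfolding ptolemy[OF cyc bd] vx_def vy_def using keys by (simp add: j_add j_scale tmul_closed)
    also have "\<dots> = \<kappa> (q_half (vx - x)) \<otimes> j (chord a ?e) \<oplus> \<kappa> (q_half (vy - y)) \<otimes> j (chord a b)"
      unfolding 1 2 using cl by (simp add: inv)
    finally show ?thesis .
  qed
  have "j (chord a ?c) \<otimes> j (chord b ?e) \<ominus> \<kappa> (q_half (vy - y)) \<otimes> j (chord a b)
      = \<kappa> (q_half (vx - x)) \<otimes> j (chord a ?e)"
    unfolding 3 using cl by (simp add: a_minus_def a_assoc r_neg)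
  then have "\<kappa> (q_half (x - vx)) \<otimes> (j (chord a ?c) \<otimes> j (chord b ?e) \<ominus> \<kappa> (q_half (vy - y)) \<otimes> j (chord a b))
      = j (chord a ?e)"
    using cl by (simp add: inv)
  then show thesis using that by metis
qed

lemma chord_in_subring:
  assumes H: "subring H F" and coeff: "\<And>c. \<kappa> c \<in> H"
    and Z: "\<And>k. k \<le> n \<Longrightarrow> j (short k) \<in> H"
  shows "a < b \<Longrightarrow> b \<le> Suc (Suc n) \<Longrightarrow> j (chord a b) \<in> H"
proof (induction "b - a" arbitrary: b rule: less_induct)
  case less
  consider "b = Suc a" | "b = Suc (Suc a)" | b' where "b = Suc (Suc b')" "a < b'"
  proof -
    assume *: "b = Suc a \<Longrightarrow> thesis" "b = Suc (Suc a) \<Longrightarrow> thesis"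
      "\<And>b'. b = Suc (Suc b') \<Longrightarrow> a < b' \<Longrightarrow> thesis"
    show thesis using less.prems *(1,2) *(3)[of "b - 2"] by (cases "b - a \<le> 2") force+
  qed
  then show ?case
  proof cases
    case 1
    then show ?thesis using coeff[of 1] by simp
  next
    case 2
    then show ?thesis using Z[of a] less.prems by simp
  next
    case 3
    then obtain x y where *: "j (chord a b) = \<kappa> x \<otimes>
        (j (chord a (Suc b')) \<otimes> j (chord b' (Suc (Suc b'))) \<ominus> \<kappa> y \<otimes> j (chord a b'))"
      using chord_recursion[of a b'] less.prems by auto
    have "j (chord a (Suc b')) \<in> H" "j (chord a b') \<in> H" "j (chord b' (Suc (Suc b'))) \<in> H"
      using less.hyps[of "Suc b'"] less.hyps[of b'] Z[of b'] 3 less.prems by auto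
    then show ?thesis unfolding * a_minus_def
      using coeff by (intro subringE(5-7)[OF H]) auto
  qed
qed

end

section \<open>Extending homomorphisms to the skew-field of fractions\<close>

context torus_fractions
begin

text \<open>Read off from \<open>F\<close> rather than proved inside the torus: the left fraction
  inv (j b) j a can be rewritten there as a right fraction.\<close>

lemma ore:
  assumes "kys a \<subseteq> lat" "kys b \<subseteq> lat" "b \<noteq> 0"
  obtains s t where "kys s \<subseteq> lat" "kys t \<subseteq> lat" "s \<noteq> 0" "tmul a s = tmul b t"
proof -
  have jb: "j b \<in> Units F" using assms by (auto simp: Units_iff j_eq_zero_iff)
  have cl: "j a \<in> carrier F" "j b \<in> carrier F" using assms by auto
  have "inv (j b) \<otimes> j a \<in> carrier F" using jb cl by simp
  then obtain t s where ts: "kys t \<subseteq> lat" "kys s \<subseteq> lat" "s \<noteq> 0" "inv (j b) \<otimes> j a = j t \<otimes> inv (j s)"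
    by (rule fraction)
  have js: "j s \<in> Units F" using ts by (auto simp: Units_iff j_eq_zero_iff)
  have cl': "j t \<in> carrier F" "j s \<in> carrier F" using ts by auto
  have "j a \<otimes> j s = j b \<otimes> (inv (j b) \<otimes> j a) \<otimes> j s"
    using jb cl by (simp add: m_assoc[symmetric])
  also have "\<dots> = j b \<otimes> (j t \<otimes> inv (j s)) \<otimes> j s" unfolding ts(4) ..
  also have "\<dots> = j b \<otimes> j t" using js cl cl' by (simp add: m_assoc)
  finally have "j (tmul a s) = j (tmul b t)" using assms ts by (simp add: j_mult)
  then have "tmul a s = tmul b t" using assms ts by (simp add: j_inject tmul_closed)
  then show thesis using ts that by blast
qed

lemma tmul_eq_0_iff:
  assumes "kys a \<subseteq> lat" "kys b \<subseteq> lat" "a \<noteq> 0" "b \<noteq> 0" shows "tmul a b \<noteq> 0"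
proof
  assume "tmul a b = 0"
  then have "j a \<otimes> j b = \<zero>" using assms j_mult[of a b] by simp
  then show False using integral[of "j a" "j b"] assms by (auto simp: j_eq_zero_iff)
qed

text \<open>The extension is built as a relation: x and y are related if one pair a, b represents x
  as a fraction through \<open>j\<close> and y through \<psi>. The Ore condition closes the relation
  under sums and products, so uniqueness of y reduces to x = 0, where injectivity of \<psi> and the
  absence of zero divisors decide.\<close>

lemma extend_hom:
  assumes \<psi>: "\<psi> \<in> ring_hom (quantum_torus m L) F"
    and \<psi>_inj: "\<And>f. kys f \<subseteq> lat \<Longrightarrow> \<psi> f = \<zero> \<Longrightarrow> f = 0"
  obtains \<phi> where "\<phi> \<in> ring_hom F F" "\<And>f. kys f \<subseteq> lat \<Longrightarrow> \<phi> (j f) = \<psi> f"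
proof -
  have \<psi>_cl: "kys f \<subseteq> lat \<Longrightarrow> \<psi> f \<in> carrier F"
    and \<psi>_mult: "\<lbrakk>kys f \<subseteq> lat; kys g \<subseteq> lat\<rbrakk> \<Longrightarrow> \<psi> (tmul f g) = \<psi> f \<otimes> \<psi> g"
    and \<psi>_add: "\<lbrakk>kys f \<subseteq> lat; kys g \<subseteq> lat\<rbrakk> \<Longrightarrow> \<psi> (f + g) = \<psi> f \<oplus> \<psi> g"
    and \<psi>_one: "\<psi> (sgl 0 1) = \<one>" for f g
    using ring_hom_memE[OF \<psi>] by (auto simp: quantum_torus_simps)
  define G where "G x y \<longleftrightarrow> x \<in> carrier F \<and> y \<in> carrier F \<and>
    (\<exists>a b. kys a \<subseteq> lat \<and> kys b \<subseteq> lat \<and> b \<noteq> 0 \<and> x \<otimes> j b = j a \<and> y \<otimes> \<psi> b = \<psi> a)" for x y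
  have G_total: "\<exists>y. G x y" if x: "x \<in> carrier F" for x
  proof -
    obtain a b where ab: "kys a \<subseteq> lat" "kys b \<subseteq> lat" "b \<noteq> 0" "x = j a \<otimes> inv (j b)"
      using x by (rule fraction)
    have u: "j b \<in> Units F" "\<psi> b \<in> Units F" "j b \<in> carrier F" "\<psi> b \<in> carrier F"
      "j a \<in> carrier F" "\<psi> a \<in> carrier F"
      using ab \<psi>_cl \<psi>_inj by (auto simp: Units_iff j_eq_zero_iff)
    have "x \<otimes> j b = j a" "\<psi> a \<otimes> inv (\<psi> b) \<otimes> \<psi> b = \<psi> a"
      using ab u by (simp_all add: m_assoc)
    then have "G x (\<psi> a \<otimes> inv (\<psi> b))" unfolding G_def using ab x u by auto
    then show ?thesis ..
  qed
  have G_j: "G (j f) (\<psi> f)" if "kys f \<subseteq> lat" for f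
    unfolding G_def
  proof (intro conjI)
    show "\<exists>a b. kys a \<subseteq> lat \<and> kys b \<subseteq> lat \<and> b \<noteq> 0 \<and> j f \<otimes> j b = j a \<and> \<psi> f \<otimes> \<psi> b = \<psi> a"
      using that \<psi>_cl[OF that] \<psi>_one j_closed[OF that]
      by (intro exI[of _ f] exI[of _ "sgl 0 1"]) simp
  qed (use that \<psi>_cl in auto)
  have expand: "x \<otimes> j (tmul b s) = j (tmul a s) \<and> y \<otimes> \<psi> (tmul b s) = \<psi> (tmul a s)"
    if "x \<otimes> j b = j a" "y \<otimes> \<psi> b = \<psi> a" "kys a \<subseteq> lat" "kys b \<subseteq> lat" "kys s \<subseteq> lat"
      "x \<in> carrier F" "y \<in> carrier F" for x y a b s
    using that \<psi>_cl by (simp add: j_mult \<psi>_mult j_closed flip: m_assoc)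
  have G_add: "G (x \<oplus> x') (y \<oplus> y')" if G1: "G x y" and G2: "G x' y'" for x x' y y'
  proof -
    obtain a b where ab: "kys a \<subseteq> lat" "kys b \<subseteq> lat" "b \<noteq> 0" "x \<otimes> j b = j a" "y \<otimes> \<psi> b = \<psi> a"
      and xy: "x \<in> carrier F" "y \<in> carrier F"
      using G1 by (auto simp: G_def)
    obtain a' b' where ab': "kys a' \<subseteq> lat" "kys b' \<subseteq> lat" "b' \<noteq> 0" "x' \<otimes> j b' = j a'" "y' \<otimes> \<psi> b' = \<psi> a'"
      and xy': "x' \<in> carrier F" "y' \<in> carrier F"
      using G2 by (auto simp: G_def)
    obtain s t where st: "kys s \<subseteq> lat" "kys t \<subseteq> lat" "s \<noteq> 0" "tmul b' s = tmul b t"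
      using ab'(2) ab(2,3) by (rule ore)
    let ?w = "tmul b t"
    have w: "kys ?w \<subseteq> lat" "?w \<noteq> 0"
      using tmul_closed[OF ab(2) st(2)] tmul_eq_0_iff[OF ab'(2) st(1) ab'(3) st(3)] st(4) by auto
    note e1 = expand[OF ab(4,5,1,2) st(2) xy] and e2 = expand[OF ab'(4,5,1,2) st(1) xy', unfolded st(4)]
    have k: "kys (tmul a t) \<subseteq> lat" "kys (tmul a' s) \<subseteq> lat"
      using tmul_closed ab ab' st by auto
    have "(x \<oplus> x') \<otimes> j ?w = j (tmul a t + tmul a' s)" "(y \<oplus> y') \<otimes> \<psi> ?w = \<psi> (tmul a t + tmul a' s)"
      using e1 e2 xy xy' w k \<psi>_cl by (simp_all add: l_distr j_add \<psi>_add j_closed)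
    moreover have "kys (tmul a t + tmul a' s) \<subseteq> lat"
      using k Poly_Mapping.keys_add[of "tmul a t" "tmul a' s"] by blast
    ultimately show ?thesis unfolding G_def using xy xy' w by blast
  qed
  have G_mult: "G (x \<otimes> x') (y \<otimes> y')" if G1: "G x y" and G2: "G x' y'" for x x' y y'
  proof -
    obtain a b where ab: "kys a \<subseteq> lat" "kys b \<subseteq> lat" "b \<noteq> 0" "x \<otimes> j b = j a" "y \<otimes> \<psi> b = \<psi> a"
      and xy: "x \<in> carrier F" "y \<in> carrier F"
      using G1 by (auto simp: G_def)
    obtain a' b' where ab': "kys a' \<subseteq> lat" "kys b' \<subseteq> lat" "b' \<noteq> 0" "x' \<otimes> j b' = j a'" "y' \<otimes> \<psi> b' = \<psi> a'"
      and xy': "x' \<in> carrier F" "y' \<in> carrier F"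
      using G2 by (auto simp: G_def)
    \<comment> \<open>The numerator a' is carried past the denominator b: if a' s = b t, then x x'
      b' s = x a' s = x b t = a t, and likewise for y and y'.\<close>
    obtain s t where st: "kys s \<subseteq> lat" "kys t \<subseteq> lat" "s \<noteq> 0" "tmul a' s = tmul b t"
      using ab'(1) ab(2,3) by (rule ore)
    let ?w = "tmul b' s"
    have w: "kys ?w \<subseteq> lat" "?w \<noteq> 0"
      using tmul_closed[OF ab'(2) st(1)] tmul_eq_0_iff[OF ab'(2) st(1) ab'(3) st(3)] by auto
    note e1 = expand[OF ab(4,5,1,2) st(2) xy] and e2 = expand[OF ab'(4,5,1,2) st(1) xy', unfolded st(4)]
    have k: "kys (tmul a t) \<subseteq> lat" using tmul_closed ab st by auto
    have "(x \<otimes> x') \<otimes> j ?w = j (tmul a t)" "(y \<otimes> y') \<otimes> \<psi> ?w = \<psi> (tmul a t)"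
      using e1 e2 xy xy' w \<psi>_cl by (simp_all add: m_assoc j_closed)
    then show ?thesis unfolding G_def using xy xy' w k by blast
  qed
  have G_0: "y = \<zero>" if G0: "G \<zero> y" for y
  proof -
    obtain a b where ab: "kys a \<subseteq> lat" "kys b \<subseteq> lat" "b \<noteq> 0" "\<zero> \<otimes> j b = j a" "y \<otimes> \<psi> b = \<psi> a"
      and y: "y \<in> carrier F"
      using G0 by (auto simp: G_def)
    have "j a = \<zero>" using ab j_closed[of b] by simp
    then have "a = 0" using ab by (simp add: j_eq_zero_iff)
    moreover have "\<psi> 0 = \<zero>"
      using \<psi>_add[of 0 0] add.l_cancel_one[of "\<psi> 0" "\<psi> 0"] \<psi>_cl[of 0] by simp
    ultimately have "y \<otimes> \<psi> b = \<zero>" using ab by simp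
    then show ?thesis using integral[of y "\<psi> b"] y \<psi>_cl[OF ab(2)] \<psi>_inj[OF ab(2)] ab(3) by blast
  qed
  have G_cl: "x \<in> carrier F" "y \<in> carrier F" if "G x y" for x y
    using that by (auto simp: G_def)
  have G_unique: "y = y'" if G1: "G x y" and G2: "G x y'" for x y y'
  proof -
    obtain z where z: "G (\<ominus> x) z" using G_total G_cl[OF G1] by blast
    have "y \<oplus> z = \<zero>" "y' \<oplus> z = \<zero>"
      using G_0 G_add[OF G1 z] G_add[OF G2 z] G_cl[OF G1] by (auto simp: r_neg)
    then have "y \<oplus> z = y' \<oplus> z" by simp
    then show ?thesis using G_cl G1 G2 z by (metis add.r_cancel)
  qed
  define \<phi> where "\<phi> x = (THE y. G x y)" for x
  have \<phi>_eq: "\<phi> x = y" if "G x y" for x y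
    unfolding \<phi>_def using that G_unique by blast
  have \<phi>_G: "G x (\<phi> x)" if x: "x \<in> carrier F" for x
  proof -
    obtain y where "G x y" using G_total[OF x] by blast
    then show ?thesis using \<phi>_eq by simp
  qed
  show thesis
  proof (rule that)
    show "\<phi> \<in> ring_hom F F"
    proof (rule ring_hom_memI)
      show "\<phi> \<one> = \<one>" using \<phi>_eq[OF G_j[of "sgl 0 1"]] \<psi>_one by simp
    next
      fix x assume "x \<in> carrier F"
      then show "\<phi> x \<in> carrier F" using \<phi>_G G_cl by blast
    next
      fix x y assume xy: "x \<in> carrier F" "y \<in> carrier F"
      show "\<phi> (x \<otimes> y) = \<phi> x \<otimes> \<phi> y"
        by (rule \<phi>_eq[OF G_mult[OF \<phi>_G[OF xy(1)] \<phi>_G[OF xy(2)]]])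
      show "\<phi> (x \<oplus> y) = \<phi> x \<oplus> \<phi> y"
        by (rule \<phi>_eq[OF G_add[OF \<phi>_G[OF xy(1)] \<phi>_G[OF xy(2)]]])
    qed
    show "kys f \<subseteq> lat \<Longrightarrow> \<phi> (j f) = \<psi> f" for f
      using G_j \<phi>_eq by blast
  qed
qed

lemma hom_inv:
  assumes \<phi>: "\<phi> \<in> ring_hom F F" and x: "x \<in> Units F"
  shows "\<phi> x \<in> Units F" "\<phi> (inv x) = inv (\<phi> x)"
proof -
  have cl: "x \<in> carrier F" "inv x \<in> carrier F" "\<phi> x \<in> carrier F" "\<phi> (inv x) \<in> carrier F"
    using x ring_hom_memE(1)[OF \<phi>] by auto
  have 1: "\<phi> x \<otimes> \<phi> (inv x) = \<one>" "\<phi> (inv x) \<otimes> \<phi> x = \<one>"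
    using x cl ring_hom_memE(2,4)[OF \<phi>] by (metis Units_r_inv Units_l_inv)+
  then show "\<phi> x \<in> Units F" using cl unfolding Units_def by blast
  show "\<phi> (inv x) = inv (\<phi> x)" using inv_unique'[OF cl(3,4) 1] .
qed

text \<open>Injectivity holds because units go to units. The image contains the coefficients and the
  monomials, hence the torus, hence all fractions.\<close>

lemma hom_automorphism:
  assumes \<phi>: "\<phi> \<in> ring_hom F F" and surj: "\<And>e. e \<in> lat \<Longrightarrow> tmon e \<in> \<phi> ` carrier F"
    and coeff: "\<And>c. \<phi> (\<kappa> c) = \<kappa> c"
  shows "skew_field_automorphism F j \<phi>"
proof -
  note \<phi>_simps = ring_hom_memE[OF \<phi>]
  have \<phi>0: "\<phi> \<zero> = \<zero>" using coeff[of 0] by (simp add: coeff_in_def)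
  have inj: "inj_on \<phi> (carrier F)"
  proof (rule inj_onI)
    fix x y assume xy: "x \<in> carrier F" "y \<in> carrier F" "\<phi> x = \<phi> y"
    show "x = y"
    proof (rule ccontr)
      assume "x \<noteq> y"
      then have "x \<ominus> y \<in> Units F" using xy by (simp add: Units_iff)
      from hom_inv(1)[OF \<phi> this] have nz: "\<phi> (x \<ominus> y) \<noteq> \<zero>" by (simp add: Units_iff)
      have "\<phi> (x \<ominus> y) \<oplus> \<phi> y = \<phi> (x \<ominus> y \<oplus> y)" using xy by (simp add: \<phi>_simps(3))
      also have "x \<ominus> y \<oplus> y = x" using xy by (simp add: a_minus_def a_assoc l_neg)
      finally have "\<phi> (x \<ominus> y) \<oplus> \<phi> y = \<phi> y" using xy by simp
      then have "\<phi> (x \<ominus> y) = \<zero>" using xy \<phi>_simps(1) by (simp add: add.r_cancel_one)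
      then show False using nz by simp
    qed
  qed
  have im: "j f \<in> \<phi> ` carrier F" if "kys f \<subseteq> lat" for f
    using that
  proof (induction f rule: keys_subset_induct)
    case zero
    then show ?case using \<phi>0 by (auto intro!: image_eqI[of _ _ \<zero>])
  next
    case (single e c)
    from surj[OF this] obtain x where x: "tmon e = \<phi> x" "x \<in> carrier F" by blast
    have "j (sgl e c) = \<phi> (\<kappa> c \<otimes> x)"
      using single x by (simp add: j_monom \<phi>_simps(2) coeff)
    then show ?case using x by blast
  next
    case (add f g)
    then obtain x y where "j f = \<phi> x" "j g = \<phi> y" "x \<in> carrier F" "y \<in> carrier F" by blast
    then have "j (f + g) = \<phi> (x \<oplus> y)" "x \<oplus> y \<in> carrier F"
      using add by (simp_all add: j_add \<phi>_simps(3))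
    then show ?case by blast
  qed
  have "\<phi> ` carrier F = carrier F"
  proof
    show "\<phi> ` carrier F \<subseteq> carrier F" using \<phi>_simps(1) by blast
    show "carrier F \<subseteq> \<phi> ` carrier F"
    proof
      fix z assume "z \<in> carrier F"
      then obtain f g where fg: "kys f \<subseteq> lat" "kys g \<subseteq> lat" "g \<noteq> 0" "z = j f \<otimes> inv (j g)"
        by (rule fraction)
      obtain x y where xy: "j f = \<phi> x" "j g = \<phi> y" "x \<in> carrier F" "y \<in> carrier F"
        using im fg by blast
      have "\<phi> y \<noteq> \<zero>" using fg xy j_eq_zero_iff[of g] by simp
      then have y: "y \<in> Units F" using xy \<phi>0 by (auto simp: Units_iff)
      have "z = \<phi> (x \<otimes> inv y)"
        using fg xy y hom_inv(2)[OF \<phi> y] by (simp add: \<phi>_simps(2))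
      then show "z \<in> \<phi> ` carrier F" using xy y by blast
    qed
  qed
  then show ?thesis
    using \<phi> inj coeff by (simp add: skew_field_automorphism_def ring_iso_def bij_betw_def)
qed

end

subsection \<open>Sequences with prescribed ratios\<close>

context Group.monoid
begin

text \<open>A substitute for an infinite product: only the ratios are prescribed, and the recursion
  is solved upwards by products and downwards by inverses.\<close>

lemma ratio_sequence:
  fixes D :: "int \<Rightarrow> 'a"
  assumes "\<And>i. D i \<in> Units G"
  obtains E where "E 0 = \<one>" "\<And>i. E (i + 1) = D i \<otimes> E i" "\<And>i. E i \<in> Units G"
proof -
  define P where "P = rec_nat \<one> (\<lambda>r x. D (int r) \<otimes> x)"
  define Q where "Q = rec_nat \<one> (\<lambda>r x. inv (D (- int r - 1)) \<otimes> x)"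
  have P: "P 0 = \<one>" "\<And>r. P (Suc r) = D (int r) \<otimes> P r" by (simp_all add: P_def)
  have Q: "Q 0 = \<one>" "\<And>r. Q (Suc r) = inv (D (- int r - 1)) \<otimes> Q r" by (simp_all add: Q_def)
  have PU: "P r \<in> Units G" and QU: "Q r \<in> Units G" for r
    using assms by (induction r) (simp_all add: P Q)
  define E where "E i = (if i \<ge> 0 then P (nat i) else Q (nat (- i)))" for i
  have "E (i + 1) = D i \<otimes> E i" for i
  proof (cases "i \<ge> 0")
    case True
    then show ?thesis by (simp add: E_def P nat_add_distrib)
  next
    case False
    then obtain r where r: "i = - int r - 1"
      by (metis add.inverse_inverse add_uminus_conv_diff int_cases minus_add_distrib
          negative_zless_0 of_nat_0_le_iff of_nat_Suc uminus_add_conv_diff)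
    have i1: "nat (- i) = Suc r" "nat (- (i + 1)) = r" using r by auto
    have "E i = Q (Suc r)" using False i1 by (simp add: E_def)
    moreover have "E (i + 1) = Q r" using False i1 P Q by (cases r) (auto simp: E_def r)
    moreover have "D i \<otimes> Q (Suc r) = Q r"
      using assms QU[of r] by (simp add: Q r m_assoc[symmetric] Units_closed)
    ultimately show ?thesis by simp
  qed
  moreover have "E 0 = \<one>" by (simp add: E_def P)
  moreover have "E i \<in> Units G" for i by (simp add: E_def PU QU)
  ultimately show thesis using that by blast
qed

end

subsection \<open>Triangular families in the torus\<close>

lemma lookup_scale: "lkp (torus_mult m L (sgl 0 x) g) v = x * lkp g v"
proof -
  have "kys g \<subseteq> UNIV" by simp
  then show ?thesis
    by (induction g rule: keys_subset_induct)
      (auto simp: torus_scale twisted_mult_add_right lookup_add lookup_single when_def distrib_left)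
qed

lemma lookup_mult_single:
  "lkp (torus_mult m L g (sgl e x)) v = q_half (bil_form m L (v - e) e) * lkp g (v - e) * x"
proof -
  have "kys g \<subseteq> UNIV" by simp
  then show ?thesis
    by (induction g rule: keys_subset_induct)
      (auto simp: torus_mult_single twisted_mult_add_left lookup_add lookup_single when_def
        distrib_left distrib_right)
qed

lemma lookup_single_mult:
  "lkp (torus_mult m L (sgl e x) g) v = q_half (bil_form m L e (v - e)) * x * lkp g (v - e)"
proof -
  have "kys g \<subseteq> UNIV" by simp
  then show ?thesis
    by (induction g rule: keys_subset_induct)
      (auto simp: torus_mult_single twisted_mult_add_right lookup_add lookup_single when_def
        distrib_left distrib_right)
qed

text \<open>Among the indices with nonzero coefficient take one whose leading exponent is lowest: no
  other of these members reaches that exponent. Applied to the images of torus monomials under the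
  dilogarithm map and, with negated height, to ordered words.\<close>

lemma triangular_independent:
  fixes t :: "'a \<Rightarrow> (vec \<Rightarrow>\<^sub>0 laurent)" and h :: "vec \<Rightarrow> int" and f :: "'a \<Rightarrow> laurent"
  assumes fin: "finite A" and inj: "inj_on lead A"
    and unit: "\<And>a. a \<in> A \<Longrightarrow> \<exists>u. lkp (t a) (lead a) = q_half u"
    and tri: "\<And>a v. \<lbrakk>a \<in> A; lkp (t a) v \<noteq> 0\<rbrakk> \<Longrightarrow> v = lead a \<or> h v > h (lead a)"
    and zero: "\<And>v. (\<Sum>a\<in>A. f a * lkp (t a) v) = 0"
    and a: "a \<in> A"
  shows "f a = 0"
proof (rule ccontr)
  let ?B = "{a\<in>A. f a \<noteq> 0}"
  assume "f a \<noteq> 0"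
  then have "?B \<noteq> {}" "finite ?B" using a fin by auto
  then obtain b where b: "b \<in> ?B" "\<And>c. c \<in> ?B \<Longrightarrow> h (lead b) \<le> h (lead c)"
  proof -
    let ?H = "(\<lambda>c. h (lead c)) ` ?B"
    have H: "finite ?H" "?H \<noteq> {}" using \<open>?B \<noteq> {}\<close> \<open>finite ?B\<close> by auto
    obtain b where "b \<in> ?B" "h (lead b) = Min ?H" using Min_in[OF H] by auto
    then show thesis using that[of b] Min_le[OF H(1)] by fastforce
  qed
  obtain u where u: "lkp (t b) (lead b) = q_half u" using unit b by auto
  have "f c * lkp (t c) (lead b) = 0" if "c \<in> A" "c \<noteq> b" for c
  proof (rule ccontr)
    assume *: "f c * lkp (t c) (lead b) \<noteq> 0"
    then have "c \<in> ?B" "lkp (t c) (lead b) \<noteq> 0" using that by auto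
    then have "lead b = lead c \<or> h (lead b) > h (lead c)" using tri that by blast
    moreover have "h (lead b) \<le> h (lead c)" by (rule b(2)) fact
    moreover have "lead b \<noteq> lead c" using b(1) inj that by (auto dest: inj_onD)
    ultimately show False by simp
  qed
  then have "(\<Sum>c\<in>A - {b}. f c * lkp (t c) (lead b)) = 0" by (intro sum.neutral) blast
  then have "(\<Sum>c\<in>A. f c * lkp (t c) (lead b)) = f b * q_half u"
    using b(1) fin u by (simp add: sum.remove[of A b])
  then have "f b * q_half u = 0" using zero[of "lead b"] by simp
  then have "f b * q_half u * q_half (- u) = 0" by simp
  then have "f b = 0" by (simp add: mult.assoc)
  then show False using b by simp
qed

section \<open>The initial seed can be mutated in every direction\<close>

lemma lookup_vtx: "lkp (vtx v) x = (if 2 \<le> v \<and> x = v - 1 then 1 else 0)"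
  by (auto simp: vtx_def lookup_unit_vec)

lemma vtx_Suc: "l \<ge> 1 \<Longrightarrow> vtx (Suc l) = unit_vec l"
  by (simp add: vtx_def)

lemma bil_form_expand_right:
  "bil_form m L e f = (\<Sum>l\<in>{1..m}. bil_form m L e (unit_vec l) * lkp f l)"
proof -
  have "bil_form m L e (unit_vec l) = (\<Sum>i\<in>{1..m}. lkp e i * L i l)" if "l \<in> {1..m}" for l
  proof -
    have "bil_form m L e (unit_vec l) = (\<Sum>i\<in>{1..m}. \<Sum>l'\<in>{1..m}. if l = l' then lkp e i * L i l else 0)"
      unfolding bil_form_def by (intro sum.cong) (auto simp: lookup_unit_vec)
    then show ?thesis using that by simp
  qed
  then have "(\<Sum>l\<in>{1..m}. bil_form m L e (unit_vec l) * lkp f l)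
      = (\<Sum>l\<in>{1..m}. \<Sum>i\<in>{1..m}. lkp e i * L i l * lkp f l)"
    by (simp add: sum_distrib_right)
  also have "\<dots> = bil_form m L e f" unfolding bil_form_def by (rule sum.swap)
  finally show ?thesis ..
qed

lemma om_diff: "om (Suc (Suc v)) w - om v w = (if w = Suc v then 1 else 0)"
proof -
  consider "w < v" | "w = v" | "w = Suc v" | "w = Suc (Suc v)" | "Suc (Suc v) < w" by linarith
  then show ?thesis by cases (simp_all add: om_def)
qed

text \<open>A linear functional that singles out leading terms: it is 2 on the exponent
  \<open>b\<close> of every direction, 1 on the upper monomial of a short chord and -1 on the lower
  one.\<close>

definition height :: "nat \<Rightarrow> vec \<Rightarrow> int" where
  "height n v = (\<Sum>i\<in>{1..Suc n}. int i * lkp v i)"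

lemma height_add: "height n (v + w) = height n v + height n w"
  and height_diff: "height n (v - w) = height n v - height n w"
  and height_zero [simp]: "height n 0 = 0"
  by (simp_all add: height_def lookup_add lookup_minus algebra_simps sum.distrib sum_subtractf)

lemma height_vtx:
  assumes "1 \<le> v" "v \<le> Suc (Suc n)" shows "height n (vtx v) = int v - 1"
proof -
  have "height n (vtx v) = (\<Sum>i\<in>{1..Suc n}. if v - 1 = i then int v - 1 else 0)"
    unfolding height_def using assms by (intro sum.cong) (auto simp: lookup_vtx)
  then show ?thesis using assms by auto
qed

section \<open>The quantum dilogarithm of a mutation direction\<close>

locale direction = linear_torus +
  fixes k :: nat
  assumes k: "k \<in> {1..n}"
begin

text \<open>Column \<open>k\<close> of \<open>B_lin\<close> as an exponent. Compatibility of the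
  initial pair appears as \<open>bil_b\<close>: pairing with \<open>b\<close> reads off the
  coordinate \<open>k\<close>.\<close>

definition b :: vec where "b = vtx (Suc (Suc k)) - vtx k"

lemma b_lat [simp, intro]: "b \<in> lat"
  unfolding b_def using k by (intro diff_in_lattice vtx_in_lattice) auto

lemma height_b: "height n b = 2"
  using k by (simp add: b_def height_diff height_vtx)

lemma b_neq_0: "b \<noteq> 0"
  using height_b by force

lemma bil_b: "bil b c = lkp c k"
proof -
  have "bil b (unit_vec l) = (if k = l then 1 else 0)" if "l \<in> {1..Suc n}" for l
  proof -
    have "bil b (unit_vec l) = om (Suc (Suc k)) (Suc l) - om k (Suc l)"
      using that k unfolding b_def vtx_Suc[symmetric, of l]
      by (simp add: bil_form_diff_left bil_vtx flip: vtx_Suc)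
    also have "\<dots> = (if k = l then 1 else 0)"
      by (simp add: om_diff)
    finally show ?thesis .
  qed
  then have "bil b c = (\<Sum>l\<in>{1..Suc n}. if k = l then lkp c l else 0)"
    by (subst bil_form_expand_right, intro sum.cong) auto
  then show ?thesis using k by simp
qed

lemma bil_b': "bil c b = - lkp c k"
  using bil_skew[of c b] bil_b[of c] by simp

lemma lookup_b_k: "lkp b k = 0"
  using k bil_b[of b] bil_b'[of b] by linarith

text \<open>The factor 1 + q^(i + 1/2) X^b of the quantum dilogarithm. The offset 1/2 is chosen so
  that both monomials of the mutated variable get coefficient 1.\<close>

definition Dt :: "int \<Rightarrow> (vec \<Rightarrow>\<^sub>0 laurent)" where
  "Dt i = sgl 0 1 + sgl b (q_half (2 * i + 1))"

definition D where
  "D i = j (Dt i)"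

lemma Dt_keys: "kys (Dt i) \<subseteq> lat"
  unfolding Dt_def by (rule order_trans[OF Poly_Mapping.keys_add]) auto

lemma Dt_neq_0: "Dt i \<noteq> 0"
proof
  assume "Dt i = 0"
  then have "lkp (Dt i) 0 = 0" by simp
  then show False using b_neq_0 by (simp add: Dt_def lookup_add lookup_single when_def)
qed

lemma D_Units [simp]: "D i \<in> Units F"
  using Dt_keys Dt_neq_0 by (auto simp: D_def Units_iff j_eq_zero_iff)

lemma D_closed [simp]: "D i \<in> carrier F"
  using D_Units by (rule Units_closed)

lemma D_commute: "D i \<otimes> D l = D l \<otimes> D i"
  unfolding D_def using Dt_keys
  by (simp add: Dt_def twisted_mult_add_left twisted_mult_add_right torus_mult_single
      bil_b lookup_b_k algebra_simps flip: j_mult q_half_add)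

text \<open>Moving X^c past X^b costs q to the power minus the k-th coordinate of c, which is a
  shift of the index i.\<close>

lemma D_shift:
  assumes "c \<in> lat" shows "tmon c \<otimes> D i = D (i - lkp c k) \<otimes> tmon c"
proof -
  have "tmul (sgl c 1) (Dt i) = tmul (Dt (i - lkp c k)) (sgl c 1)"
    by (simp add: Dt_def twisted_mult_add_left twisted_mult_add_right torus_mult_single
        bil_b bil_b' algebra_simps flip: q_half_add)
  then show ?thesis
    using Dt_keys assms by (simp add: torus_monom_def D_def keys_monom flip: j_mult)
qed

definition E where
  "E = (SOME E. E 0 = \<one> \<and> (\<forall>i. E (i + 1) = D i \<otimes> E i) \<and> (\<forall>i. E i \<in> Units F))"

lemma E_0 [simp]: "E 0 = \<one>" and E_step: "E (i + 1) = D i \<otimes> E i" and E_Units [simp]: "E i \<in> Units F"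
proof -
  have "\<exists>E. E 0 = \<one> \<and> (\<forall>i. E (i + 1) = D i \<otimes> E i) \<and> (\<forall>i. E i \<in> Units F)"
    by (rule ratio_sequence[of D]) auto
  from someI_ex[OF this] show "E 0 = \<one>" "E (i + 1) = D i \<otimes> E i" "E i \<in> Units F"
    unfolding E_def by blast+
qed

lemma E_closed [simp]: "E i \<in> carrier F"
  using E_Units by (rule Units_closed)

lemma E_step_down: "E (i - 1) = inv (D (i - 1)) \<otimes> E i"
  using E_step[of "i - 1"] by (simp add: m_assoc[symmetric])

lemma commute_E:
  assumes "x \<in> carrier F" "\<And>i. x \<otimes> D i = D i \<otimes> x"
  shows "x \<otimes> E i = E i \<otimes> x"
proof (induction i rule: int_induct[where k = 0])
  case base
  then show ?case using assms by simp
next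
  case (step1 i)
  have "x \<otimes> E (i + 1) = (x \<otimes> D i) \<otimes> E i" using assms(1) by (simp add: E_step m_assoc)
  also have "\<dots> = D i \<otimes> (x \<otimes> E i)" using assms by (simp add: m_assoc)
  also have "\<dots> = E (i + 1) \<otimes> x" unfolding step1(2) using assms(1) by (simp add: E_step m_assoc)
  finally show ?case .
next
  case (step2 i)
  have i: "x \<otimes> inv (D (i - 1)) = inv (D (i - 1)) \<otimes> x"
    using Units_commute_inv[OF D_Units assms(1)] assms(2) by metis
  have "x \<otimes> E (i - 1) = (x \<otimes> inv (D (i - 1))) \<otimes> E i" using assms(1) by (simp add: E_step_down m_assoc)
  also have "\<dots> = inv (D (i - 1)) \<otimes> (x \<otimes> E i)" unfolding i using assms(1) by (simp add: m_assoc)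
  also have "\<dots> = E (i - 1) \<otimes> x" unfolding step2(2) using assms(1) by (simp add: E_step_down m_assoc)
  finally show ?case .
qed

lemma E_D_commute: "D l \<otimes> E i = E i \<otimes> D l"
  by (rule commute_E) (auto intro: D_commute)

text \<open>Both sides obey the same recursion in i, because X^c shifts the index of each
  \<open>D i\<close>, and they agree at i = 0. This identity makes \<open>N\<close>
  multiplicative.\<close>

lemma E_shift:
  assumes c: "c \<in> lat"
  shows "E (- lkp c k) \<otimes> tmon c \<otimes> E i = E (i - lkp c k) \<otimes> tmon c"
proof (induction i rule: int_induct[where k = 0])
  case base
  then show ?case using tmon_closed[OF c] by simp
next
  note cl = tmon_closed[OF c]
  have move: "E (- lkp c k) \<otimes> tmon c \<otimes> (D i \<otimes> x) = D (i - lkp c k) \<otimes> (E (- lkp c k) \<otimes> tmon c \<otimes> x)"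
    if x: "x \<in> carrier F" for i x
  proof -
    have "E (- lkp c k) \<otimes> tmon c \<otimes> (D i \<otimes> x) = E (- lkp c k) \<otimes> (tmon c \<otimes> D i) \<otimes> x"
      using cl x by (simp add: m_assoc)
    also have "\<dots> = (E (- lkp c k) \<otimes> D (i - lkp c k)) \<otimes> tmon c \<otimes> x"
      unfolding D_shift[OF c] using cl x by (simp add: m_assoc)
    also have "\<dots> = D (i - lkp c k) \<otimes> (E (- lkp c k) \<otimes> tmon c \<otimes> x)"
      unfolding E_D_commute[symmetric] using cl x by (simp add: m_assoc)
    finally show ?thesis .
  qed
  {
    case (step1 i)
    have "E (- lkp c k) \<otimes> tmon c \<otimes> E (i + 1) = D (i - lkp c k) \<otimes> (E (i - lkp c k) \<otimes> tmon c)"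
      unfolding E_step move[OF E_closed] step1(2) ..
    then show ?case using cl E_step[of "i - lkp c k"] by (simp add: m_assoc algebra_simps)
  next
    case (step2 i)
    have "D (i - 1 - lkp c k) \<otimes> (E (- lkp c k) \<otimes> tmon c \<otimes> E (i - 1))
        = E (- lkp c k) \<otimes> tmon c \<otimes> (D (i - 1) \<otimes> E (i - 1))"
      by (rule move[symmetric]) simp
    also have "D (i - 1) \<otimes> E (i - 1) = E i" using E_step[of "i - 1"] by simp
    also note step2(2)
    also have "E (i - lkp c k) \<otimes> tmon c = D (i - 1 - lkp c k) \<otimes> (E (i - 1 - lkp c k) \<otimes> tmon c)"
      using cl E_step[of "i - 1 - lkp c k"] by (simp add: m_assoc algebra_simps)
    finally have "E (- lkp c k) \<otimes> tmon c \<otimes> E (i - 1) = E (i - 1 - lkp c k) \<otimes> tmon c"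
      by (simp add: cl)
    then show ?case .
  }
qed

text \<open>
  Conjugation by the (formal) quantum dilogarithm of \<open>tmon b\<close>, which is the identity on the
  variables other than the \<open>k\<close>-th one.
\<close>

definition N where
  "N c = E (- lkp c k) \<otimes> tmon c"

lemma N_closed: "c \<in> lat \<Longrightarrow> N c \<in> carrier F"
  by (simp add: N_def tmon_closed)

lemma N_mult:
  assumes "c \<in> lat" "d \<in> lat"
  shows "N c \<otimes> N d = \<kappa> (q_half (bil c d)) \<otimes> N (c + d)"
proof -
  note cl = tmon_closed[OF assms(1)] tmon_closed[OF assms(2)] tmon_closed[OF add_in_lattice[OF assms]]
  have "N c \<otimes> N d = (E (- lkp c k) \<otimes> tmon c \<otimes> E (- lkp d k)) \<otimes> tmon d"
    using cl by (simp add: N_def m_assoc)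
  also have "\<dots> = E (- lkp (c + d) k) \<otimes> (tmon c \<otimes> tmon d)"
    unfolding E_shift[OF assms(1)] using cl by (simp add: m_assoc lookup_add add.commute[of "lkp c k"])
  also have "\<dots> = (E (- lkp (c + d) k) \<otimes> \<kappa> (q_half (bil c d))) \<otimes> tmon (c + d)"
    using assms cl by (simp add: tmon_mult m_assoc)
  also have "\<dots> = \<kappa> (q_half (bil c d)) \<otimes> N (c + d)"
    unfolding \<kappa>_central[OF E_closed] using cl by (simp add: N_def m_assoc)
  finally show ?thesis .
qed

lemma N_eq_tmon: "c \<in> lat \<Longrightarrow> lkp c k = 0 \<Longrightarrow> N c = tmon c"
  by (simp add: N_def tmon_closed)

lemma N_hom: "twisted_hom lat (+) 0 (\<lambda>e f. q_half (bil e f)) F \<kappa> N"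
proof (rule twisted_hom.intro)
  show "twisted_hom_axioms lat (+) 0 (\<lambda>e f. q_half (bil e f)) F \<kappa> N"
  proof (rule twisted_hom_axioms.intro)
    show "r \<otimes> \<kappa> x = \<kappa> x \<otimes> r" if "r \<in> carrier F" for r x
      using that by (rule \<kappa>_central)
    show "N a \<otimes> N b = \<kappa> (q_half (bil a b)) \<otimes> N (a + b)" if "a \<in> lat" "b \<in> lat" for a b
      using that by (rule N_mult)
  qed (simp_all add: \<kappa>_add \<kappa>_mult N_closed N_eq_tmon)
qed (rule torus.twisted_monoid_axioms ring_axioms)+

text \<open>The ratio of \<open>E (i + int r)\<close> to \<open>E i\<close> is a product of r
  factors \<open>D\<close>, hence a polynomial in X^b with constant term 1, and \<open>b\<close> has
  positive height.\<close>

lemma E_poly: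
  "\<exists>p. kys p \<subseteq> lat \<and> lkp p 0 = 1 \<and> (\<forall>v. lkp p v \<noteq> 0 \<longrightarrow> v = 0 \<or> height n v > 0) \<and>
     E (i + int r) = E i \<otimes> j p"
proof (induction r)
  case 0
  show ?case
    by (rule exI[of _ "sgl 0 1"]) (auto simp: lookup_single when_def split: if_splits)
next
  case (Suc r)
  then obtain p where p: "kys p \<subseteq> lat" "lkp p 0 = 1"
    "\<And>v. lkp p v \<noteq> 0 \<Longrightarrow> v = 0 \<or> height n v > 0" "E (i + int r) = E i \<otimes> j p"
    by blast
  let ?p = "tmul p (Dt (i + int r))"
  have lk: "lkp ?p v = lkp p v + q_half (bil (v - b) b) * lkp p (v - b) * q_half (2 * (i + int r) + 1)" for v
    unfolding Dt_def twisted_mult_add_right lookup_add lookup_mult_single by simp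
  have "E (i + int (Suc r)) = D (i + int r) \<otimes> E (i + int r)"
    using E_step[of "i + int r"] by (simp add: algebra_simps)
  also have "\<dots> = E (i + int r) \<otimes> D (i + int r)" by (rule E_D_commute)
  also have "\<dots> = E i \<otimes> j ?p"
    unfolding p(4) using p(1) Dt_keys by (simp add: m_assoc j_mult D_def j_closed)
  finally have "E (i + int (Suc r)) = E i \<otimes> j ?p" .
  moreover have "lkp ?p 0 = 1"
  proof -
    have "lkp p (0 - b) = 0" using p(3)[of "0 - b"] b_neq_0 height_b height_diff[of n 0 b] by auto
    then show ?thesis unfolding lk using p(2) by simp
  qed
  moreover have "v = 0 \<or> height n v > 0" if "lkp ?p v \<noteq> 0" for v
  proof -
    have "lkp p v \<noteq> 0 \<or> lkp p (v - b) \<noteq> 0" using that unfolding lk by auto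
    then show ?thesis using p(3)[of v] p(3)[of "v - b"] height_b by (auto simp: height_diff)
  qed
  ultimately show ?case using tmul_closed[OF p(1) Dt_keys] by blast
qed

text \<open>Splitting off \<open>E i0\<close>, with i0 a lower bound of all occurring indices,
  leaves for each \<open>N c\<close> a polynomial with constant term 1 times X^c. These are torus
  elements with exponent c and otherwise only higher ones, hence independent.\<close>

lemma ext_inj:
  assumes f: "kys f \<subseteq> lat" and zero: "twisted_hom.ext F \<kappa> N f = \<zero>"
  shows "f = 0"
proof -
  interpret N: twisted_hom lat "(+)" 0 "\<lambda>e f. q_half (bil e f)" F \<kappa> N by (rule N_hom)
  define i0 where "i0 = Min ((\<lambda>c. - lkp c k) ` insert 0 (kys f))"
  have i0: "i0 \<le> - lkp c k" if "c \<in> kys f" for c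
    unfolding i0_def using that by (intro Min_le) auto
  have "\<forall>c\<in>kys f. \<exists>p. kys p \<subseteq> lat \<and> lkp p 0 = 1 \<and>
      (\<forall>v. lkp p v \<noteq> 0 \<longrightarrow> v = 0 \<or> height n v > 0) \<and> E (- lkp c k) = E i0 \<otimes> j p"
  proof
    fix c assume "c \<in> kys f"
    then have "- lkp c k = i0 + int (nat (- lkp c k - i0))" using i0[of c] by simp
    then show "\<exists>p. kys p \<subseteq> lat \<and> lkp p 0 = 1 \<and>
      (\<forall>v. lkp p v \<noteq> 0 \<longrightarrow> v = 0 \<or> height n v > 0) \<and> E (- lkp c k) = E i0 \<otimes> j p"
      using E_poly[of i0 "nat (- lkp c k - i0)"] by simp
  qed
  then obtain p where p: "\<And>c. c \<in> kys f \<Longrightarrow> kys (p c) \<subseteq> lat"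
    "\<And>c. c \<in> kys f \<Longrightarrow> lkp (p c) 0 = 1"
    "\<And>c v. c \<in> kys f \<Longrightarrow> lkp (p c) v \<noteq> 0 \<Longrightarrow> v = 0 \<or> height n v > 0"
    "\<And>c. c \<in> kys f \<Longrightarrow> E (- lkp c k) = E i0 \<otimes> j (p c)"
    unfolding bchoice_iff by blast
  define t where "t c = tmul (p c) (sgl c 1)" for c
  have t_keys: "kys (t c) \<subseteq> lat" if "c \<in> kys f" for c
    unfolding t_def using p(1)[OF that] that f by (intro tmul_closed) auto
  let ?s = "\<lambda>A. \<Sum>c\<in>A. tmul (sgl 0 (lkp f c)) (t c)"
  have "kys (?s A) \<subseteq> lat \<and> finsum F (\<lambda>c. \<kappa> (lkp f c) \<otimes> N c) A = E i0 \<otimes> j (?s A)"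
    if "finite A" "A \<subseteq> kys f" for A
    using that
  proof (induction A)
    case empty
    then show ?case by simp
  next
    case (insert c A)
    then have c: "c \<in> kys f" "c \<in> lat" using f by auto
    have cl: "j (p c) \<in> carrier F" "tmon c \<in> carrier F" "j (t c) \<in> carrier F"
      using p(1)[OF c(1)] c(2) t_keys[OF c(1)] by (auto intro: j_closed)
    have keys: "kys (tmul (sgl 0 (lkp f c)) (t c)) \<subseteq> lat"
      using t_keys[OF c(1)] by (intro tmul_closed) auto
    have "j (t c) = j (p c) \<otimes> tmon c"
      unfolding t_def torus_monom_def using p(1)[OF c(1)] c(2) by (simp add: j_mult keys_monom)
    then have "N c = E i0 \<otimes> j (t c)"
      using cl by (simp add: N_def p(4)[OF c(1)] m_assoc)
    then have "\<kappa> (lkp f c) \<otimes> N c = (\<kappa> (lkp f c) \<otimes> E i0) \<otimes> j (t c)"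
      using cl by (simp add: m_assoc)
    also have "\<dots> = E i0 \<otimes> j (tmul (sgl 0 (lkp f c)) (t c))"
      unfolding \<kappa>_central[OF E_closed, symmetric] using cl t_keys[OF c(1)]
      by (simp add: m_assoc j_scale)
    finally have *: "\<kappa> (lkp f c) \<otimes> N c = E i0 \<otimes> j (tmul (sgl 0 (lkp f c)) (t c))" .
    have IH: "kys (?s A) \<subseteq> lat" "finsum F (\<lambda>c. \<kappa> (lkp f c) \<otimes> N c) A = E i0 \<otimes> j (?s A)"
      using insert by auto
    have "finsum F (\<lambda>c. \<kappa> (lkp f c) \<otimes> N c) (insert c A)
        = \<kappa> (lkp f c) \<otimes> N c \<oplus> finsum F (\<lambda>c. \<kappa> (lkp f c) \<otimes> N c) A"
      using insert f c by (intro finsum_insert) (auto intro!: N_closed)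
    also have "\<dots> = E i0 \<otimes> j (tmul (sgl 0 (lkp f c)) (t c) + ?s A)"
      unfolding * IH(2) using IH(1) keys by (simp add: j_add r_distr j_closed)
    finally show ?case
      using insert(1,2) IH(1) keys Poly_Mapping.keys_add[of "tmul (sgl 0 (lkp f c)) (t c)" "?s A"]
      by auto
  qed
  from this[of "kys f"] have s: "kys (?s (kys f)) \<subseteq> lat" "E i0 \<otimes> j (?s (kys f)) = \<zero>"
    using zero by (auto simp: N.ext_def)
  have "j (?s (kys f)) = \<zero>"
    using integral[OF s(2)] s(1) E_Units[of i0] by (auto simp: Units_iff j_closed)
  then have s0: "?s (kys f) = 0" using s(1) by (simp add: j_eq_zero_iff)
  have "lkp f c = 0" if "c \<in> kys f" for c
  proof (rule triangular_independent[of "kys f" id t "height n" "lkp f", OF _ _ _ _ _ that])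
    fix c assume c: "c \<in> kys f"
    show "\<exists>u. lkp (t c) (id c) = q_half u"
      unfolding t_def lookup_mult_single by (intro exI[of _ 0]) (simp add: p(2)[OF c])
    fix v assume "lkp (t c) v \<noteq> 0"
    then have "lkp (p c) (v - c) \<noteq> 0" unfolding t_def lookup_mult_single by auto
    then show "v = id c \<or> height n (id c) < height n v"
      using p(3)[OF c, of "v - c"] by (auto simp: height_diff)
  next
    fix v
    have "lkp (?s (kys f)) v = 0" by (simp only: s0 lookup_zero)
    then show "(\<Sum>a\<in>kys f. lkp f a * lkp (t a) v) = 0"
      by (simp add: lookup_sum lookup_scale)
  qed auto
  then have "lkp f c = 0" for c by (cases "c \<in> kys f") (auto simp: in_keys_iff)
  then show "f = 0" by (simp add: poly_mapping_eqI)
qed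

text \<open>X^b has k-th coordinate 0 and is fixed by the extended map, hence so are all
  \<open>D i\<close> and \<open>E i\<close>. Therefore X^c is the image of X^c multiplied by the
  inverse of an \<open>E i\<close>, and the map is onto.\<close>

lemma dilogarithm_automorphism:
  "\<exists>\<phi>. skew_field_automorphism F j \<phi> \<and> (\<forall>c\<in>lat. \<phi> (tmon c) = N c)"
proof -
  interpret N: twisted_hom lat "(+)" 0 "\<lambda>e f. q_half (bil e f)" F \<kappa> N by (rule N_hom)
  have hom: "N.ext \<in> ring_hom (quantum_torus (Suc n) Lambda_lin) F"
    using N.ext_hom by (simp add: quantum_torus_def)
  obtain \<phi> where \<phi>: "\<phi> \<in> ring_hom F F" "\<And>f. kys f \<subseteq> lat \<Longrightarrow> \<phi> (j f) = N.ext f"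
  proof (rule extend_hom[OF hom], goal_cases)
    case (1 f)
    show ?case by (rule ext_inj) (fact 1)+
  next
    case (2 \<phi>)
    show ?case by (rule that) (fact 2)+
  qed
  note \<phi>_simps = ring_hom_memE[OF \<phi>(1)]
  have \<phi>_single: "\<phi> (j (sgl c x)) = \<kappa> x \<otimes> N c" if "c \<in> lat" for c x
    using that \<phi>(2)[of "sgl c x"] by (simp add: N.ext_single keys_monom)
  have coeff: "\<phi> (\<kappa> c) = \<kappa> c" for c
  proof -
    have "\<phi> (\<kappa> c) = \<kappa> c \<otimes> N 0" using \<phi>_single[of 0 c] by (simp add: coeff_in_def)
    then show ?thesis using N_eq_tmon[of 0] by simp
  qed
  have \<phi>_tmon: "\<phi> (tmon c) = N c" if "c \<in> lat" for c
    using \<phi>_single[OF that, of 1] N_closed[OF that] by (simp add: torus_monom_def)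
  have \<phi>_D: "\<phi> (D i) = D i" for i
  proof -
    have "D i = \<one> \<oplus> \<kappa> (q_half (2 * i + 1)) \<otimes> tmon b"
      unfolding D_def Dt_def j_add[OF keys_coeff keys_monom[OF b_lat]] j_monom[OF b_lat] j_one ..
    then show ?thesis
      using \<phi>_tmon[of b] N_eq_tmon[of b] lookup_b_k tmon_closed[of b] \<phi>_simps(4)
      by (simp add: \<phi>_simps(2,3) coeff)
  qed
  have \<phi>_E: "\<phi> (E i) = E i" for i
  proof (induction i rule: int_induct[where k = 0])
    case base
    then show ?case using \<phi>_simps(4) by simp
  next
    case (step1 i)
    then show ?case by (simp add: E_step \<phi>_simps(2) \<phi>_D)
  next
    case (step2 i)
    then show ?case by (simp add: E_step_down \<phi>_simps(2) \<phi>_D hom_inv(2)[OF \<phi>(1)])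
  qed
  have "skew_field_automorphism F j \<phi>"
  proof (rule hom_automorphism[OF \<phi>(1) _ coeff])
    fix c assume c: "c \<in> lat"
    let ?i = "- lkp c k"
    have "tmon c = inv (E ?i) \<otimes> N c"
      using tmon_closed[OF c] by (simp add: N_def m_assoc[symmetric])
    also have "\<dots> = \<phi> (inv (E ?i) \<otimes> tmon c)"
      using tmon_closed[OF c] hom_inv(2)[OF \<phi>(1) E_Units[of ?i]]
      by (simp add: \<phi>_simps(2) \<phi>_E \<phi>_tmon[OF c])
    finally show "tmon c \<in> \<phi> ` carrier F" using tmon_closed[OF c] by auto
  qed
  then show ?thesis using \<phi>_tmon by blast
qed

subsection \<open>The mutated seed\<close>

text \<open>The map \<open>eta\<close> below is the matrix \<open>E_mat 1 k\<close> acting on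
  exponents, and \<open>kvec\<close> is its column \<open>k\<close> minus the basis vector. The
  entry -2 at \<open>k\<close> makes \<open>eta\<close> an involution.\<close>

definition kvec :: vec where
  "kvec = vtx k - unit_vec k - unit_vec k"

definition eta :: "vec \<Rightarrow> vec" where
  "eta c = c + frag_cmul (lkp c k) kvec"

lemma lookup_kvec: "lkp kvec a = (if a = k then -2 else if 2 \<le> k \<and> a = k - 1 then 1 else 0)"
  unfolding kvec_def lookup_minus lookup_vtx lookup_unit_vec using k by auto

lemma kvec_lat: "kvec \<in> lat"
  unfolding kvec_def using k by (intro diff_in_lattice vtx_in_lattice unit_vec_in_lattice) auto

lemma frag_cmul_lat: "w \<in> lat \<Longrightarrow> frag_cmul x w \<in> lat"
  using keys_cmul[of x w] by (auto simp: lattice_of_def)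

lemma bil_frag_cmul: "bil (frag_cmul x w) v = x * bil w v"
  unfolding bil_form_def sum_distrib_left by (simp only: lookup_frag_cmul mult.assoc)

lemma eta_lat: "c \<in> lat \<Longrightarrow> eta c \<in> lat"
  unfolding eta_def by (intro add_in_lattice frag_cmul_lat kvec_lat)

lemma eta_add: "eta (c + d) = eta c + eta d"
  by (simp add: eta_def lookup_add frag_cmul_distrib algebra_simps)

lemma lookup_eta: "lkp (eta c) a = lkp c a + lkp c k * lkp kvec a"
  by (simp add: eta_def lookup_add)

lemma eta_eta: "eta (eta c) = c"
  by (rule poly_mapping_eqI) (simp add: lookup_eta lookup_kvec)

lemma lattice_iso_eta: "lattice_iso (Suc n) eta"
proof -
  have "bij_betw eta lat lat"
    by (rule bij_betw_byWitness[where f' = eta]) (auto simp: eta_eta eta_lat)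
  then show ?thesis by (simp add: lattice_iso_def eta_add)
qed

lemma lookup_eta_unit:
  assumes "i \<in> {1..Suc n}" "a \<in> {1..Suc n}"
  shows "lkp (eta (unit_vec i)) a = E_mat 1 k (B_lin n) a i"
  using assms k by (auto simp: lookup_eta lookup_kvec lookup_unit_vec E_mat_def B_lin_def)

lemma N_neq_zero: "c \<in> lat \<Longrightarrow> N c \<noteq> \<zero>"
  using integral[of "E (- lkp c k)" "tmon c"] E_Units[of "- lkp c k"]
  by (auto simp: N_def Units_iff tmon_closed tmon_neq_zero)

lemma frame_formI:
  assumes "M c \<otimes> M d = \<kappa> (q_half a) \<otimes> M (c + d)" "M (c + d) \<in> carrier F" "M (c + d) \<noteq> \<zero>"
  shows "frame_form F j M c d = a"
  unfolding frame_form_def using assms by (auto intro!: the_equality dest: \<kappa>_q_half_cancel)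

lemma frame_matrix_tmon:
  "\<lbrakk>i \<in> {1..Suc n}; l \<in> {1..Suc n}\<rbrakk> \<Longrightarrow> frame_matrix F j tmon i l = Lambda_lin i l"
  unfolding frame_matrix_def
  by (rule frame_formI)
    (simp_all add: tmon_mult bil_form_unit tmon_closed tmon_neq_zero add_in_lattice unit_vec_in_lattice)

lemma bil_eta_unit: 
  assumes "i \<in> {1..Suc n}" "l \<in> {1..Suc n}"
  shows "bil (eta (unit_vec i)) (eta (unit_vec l))
    = mutate_form (Suc n) 1 k (B_lin n) (frame_matrix F j tmon) i l"
  unfolding bil_form_def mutate_form_def using assms
  by (intro sum.cong refl) (simp add: lookup_eta_unit frame_matrix_tmon)

lemma B_lin_column: "l \<in> {1..n} \<Longrightarrow> x \<in> {1..Suc n} \<Longrightarrow>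
  B_lin n x l = lkp (vtx (Suc (Suc l)) - vtx l) x"
  by (auto simp: B_lin_def lookup_minus lookup_vtx)

lemma sum_bil:
  "(\<Sum>x\<in>{1..Suc n}. g x * bil (unit_vec x) w) = bil (\<Sum>x\<in>{1..Suc n}. sgl x (g x)) w"
proof -
  have "bil (\<Sum>x\<in>A. sgl x (g x)) w = (\<Sum>x\<in>A. g x * bil (unit_vec x) w)" if "finite A" for A
    using that
  proof induction
    case (insert x A)
    have "sgl x (g x) = frag_cmul (g x) (unit_vec x)"
      by (rule poly_mapping_eqI) (simp add: lookup_single lookup_unit_vec when_def)
    then show ?case using insert by (simp add: bil_form_add_left bil_frag_cmul)
  qed simp
  from this[of "{1..Suc n}"] show ?thesis by (simp only: finite_atLeastAtMost)
qed

lemma lookup_sum_singles: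
  "finite A \<Longrightarrow> lkp (\<Sum>x\<in>A. sgl x (g x)) a = (if a \<in> A then g a else 0)"
  by (simp add: lookup_sum lookup_single when_def)

text \<open>As \<open>eta\<close> is an involution, it takes column l of E B F to column l of B F.
  This is -b for l = k, and otherwise the vector \<open>b\<close> of direction l plus a multiple of
  that of direction k. Pairing with these vectors reads off coordinates, so all integers d_j stay
  equal to 1.\<close>

lemma compatible_mutated:
  assumes i: "i \<in> {1..Suc n}" and l: "l \<in> {1..n}"
  shows "(\<Sum>x\<in>{1..Suc n}. mutate_exchange (Suc n) {1..n} 1 k (B_lin n) x l
      * bil (eta (unit_vec x)) (eta (unit_vec i))) = (if i = l then 1 else 0)"
proof -
  interpret L: direction n F j l by unfold_locales (rule l)
  let ?B = "B_lin n"
  define w where "w = eta (unit_vec i)"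
  define B' where "B' x = mutate_exchange (Suc n) {1..n} 1 k ?B x l" for x
  have Bkk: "?B k k = 0" by (simp add: B_lin_def)
  have B': "B' x = (if x = k \<or> l = k then - ?B x l
     else ?B x l + max 0 (- ?B x k) * ?B k l + ?B x k * max 0 (?B k l))"
    if "x \<in> {1..Suc n}" for x
    unfolding B'_def using that k l Bkk by (subst mutate_exchange_eq) auto
  define V where "V = (\<Sum>x\<in>{1..Suc n}. sgl x (B' x))"
  have "(\<Sum>x\<in>{1..Suc n}. B' x * bil (eta (unit_vec x)) w)
      = (\<Sum>x\<in>{1..Suc n}. B' x * bil (unit_vec x) w + (if k = x then B' k * bil kvec w else 0))"
  proof (intro sum.cong refl)
    fix x
    show "B' x * bil (eta (unit_vec x)) w
        = B' x * bil (unit_vec x) w + (if k = x then B' k * bil kvec w else 0)"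
    proof (cases "x = k")
      case True
      have "eta (unit_vec k) = unit_vec k + kvec" by (simp add: eta_def lookup_unit_vec)
      then show ?thesis using True by (simp add: bil_form_add_left algebra_simps)
    next
      case False
      then show ?thesis by (simp add: eta_def lookup_unit_vec)
    qed
  qed
  also have "\<dots> = bil V w + B' k * bil kvec w"
    using k by (simp only: sum.distrib sum_bil V_def) simp
  finally have 1: "(\<Sum>x\<in>{1..Suc n}. B' x * bil (eta (unit_vec x)) w)
      = bil V w + B' k * bil kvec w" .
  have col: "lkp V a = (if a \<in> {1..Suc n} then B' a else 0)" for a
    unfolding V_def by (rule lookup_sum_singles) simp
  have wl: "lkp w l = (if i = l then (if l = k then -1 else 1) else if i = k then lkp kvec l else 0)"
    and wk: "lkp w k = (if i = k then -1 else 0)"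
    using i l k by (auto simp: w_def lookup_eta lookup_unit_vec lookup_kvec)
  have bB: "?B x k = lkp b x" "?B x l = lkp L.b x" if "x \<in> {1..Suc n}" for x
    using that B_lin_column[OF k] B_lin_column[OF l] by (simp_all add: b_def L.b_def)
  show ?thesis
  proof (cases "l = k")
    case True
    have "V = - b"
    proof (rule poly_mapping_eqI)
      fix a
      show "lkp V a = lkp (- b) a"
      proof (cases "a \<in> {1..Suc n}")
        case a: True
        then show ?thesis using True B'[OF a] bB[OF a] by (simp add: col)
      next
        case False
        then have "lkp b a = 0" using b_lat by (auto simp: lattice_of_def in_keys_iff)
        then show ?thesis using False by (simp add: col del: atLeastAtMost_iff)
      qed
    qed
    moreover have "B' k = 0" using B'[of k] k True Bkk by simp
    ultimately have "(\<Sum>x\<in>{1..Suc n}. B' x * bil (eta (unit_vec x)) w) = - lkp w k"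
      unfolding 1 by (simp add: bil_form_uminus_left bil_b)
    then show ?thesis using wk True by (simp only: B'_def w_def) simp
  next
    case False
    have "V
        = L.b + frag_cmul (?B k l) kvec + frag_cmul (max 0 (?B k l)) b"
    proof (rule poly_mapping_eqI)
      fix a
      show "lkp V a
          = lkp (L.b + frag_cmul (?B k l) kvec + frag_cmul (max 0 (?B k l)) b) a"
      proof (cases "a \<in> {1..Suc n}")
        case a: True
        have kv: "lkp kvec a = (if a = k then -2 else max 0 (- ?B a k))"
          using a k by (auto simp: lookup_kvec B_lin_def)
        show ?thesis
          using False B'[OF a] bB[OF a] a kv lookup_b_k Bkk
          by (cases "a = k") (auto simp: col lookup_add algebra_simps)
      next
        case a: False
        then have "lkp b a = 0" "lkp L.b a = 0" "lkp kvec a = 0"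
          using b_lat L.b_lat kvec_lat by (auto simp: lattice_of_def in_keys_iff)
        then show ?thesis using a by (simp add: col lookup_add del: atLeastAtMost_iff)
      qed
    qed
    moreover have "B' k = - ?B k l" using B'[of k] k by simp
    ultimately have "(\<Sum>x\<in>{1..Suc n}. B' x * bil (eta (unit_vec x)) w)
        = lkp w l + max 0 (?B k l) * lkp w k"
      unfolding 1 by (simp add: bil_form_add_left bil_frag_cmul bil_b L.bil_b)
    \<comment> \<open>For i = k the entry of \<open>kvec\<close> at l is max 0 (B k l), and the two
      terms cancel.\<close>
    also have "\<dots> = (if i = l then 1 else 0)"
      unfolding wl wk using False i l k by (auto simp: lookup_kvec B_lin_def)
    finally show ?thesis by (simp only: B'_def w_def)
  qed
qed

text \<open>The exponent has coordinate -1 at k, so the factor is \<open>E 1\<close>, that is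
  \<open>D 0\<close>; multiplying by X^b then contributes q^(-1/2), which cancels the q^(1/2) in
  \<open>D 0\<close>.\<close>

lemma N_eta_k: "N (eta (unit_vec k)) = j (short k)"
proof -
  let ?v = "vtx k - unit_vec k"
  have ek: "unit_vec k = vtx (Suc k)" using k by (simp add: vtx_def)
  have v: "eta (unit_vec k) = ?v"
    by (rule poly_mapping_eqI) (auto simp: lookup_eta lookup_unit_vec lookup_kvec lookup_minus lookup_vtx)
  have lk: "lkp ?v k = -1" using k by (auto simp: lookup_minus lookup_unit_vec lookup_vtx)
  have lat: "?v \<in> lat" using eta_lat[of "unit_vec k"] k v by simp
  have "N ?v = D 0 \<otimes> tmon ?v"
    using E_step[of 0] by (simp add: N_def lk)
  also have "\<dots> = j (tmul (Dt 0) (sgl ?v 1))"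
    unfolding D_def torus_monom_def by (rule j_mult[OF Dt_keys keys_monom[OF lat], symmetric])
  also have "tmul (Dt 0) (sgl ?v 1) = sgl ?v 1 + sgl (b + ?v) 1"
    by (simp add: Dt_def twisted_mult_add_left torus_mult_single bil_b lk flip: q_half_add)
  also have "\<dots> = short k"
    using k by (simp add: chord_def chord_idx_def ek side_vec_def b_def algebra_simps)
  finally show ?thesis by (simp add: v)
qed

text \<open>The new frame is the dilogarithm automorphism applied to monomials with exponents
  changed by \<open>eta\<close>: the map \<open>eta\<close> accounts for the mutated form, the
  automorphism for the second summand of the new variable.\<close>

theorem initial_seed_mutation:
  "\<exists>t. seed_mutation (Suc n) {1..n} F j k (initial_seed n j) t \<and>
     fst t (unit_vec k) = j (short k)"
proof -
  obtain \<phi> where \<phi>: "skew_field_automorphism F j \<phi>" "\<And>c. c \<in> lat \<Longrightarrow> \<phi> (tmon c) = N c"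
    using dilogarithm_automorphism by blast
  define M' where "M' c = \<phi> (tmon (eta c))" for c
  define B' where "B' = mutate_exchange (Suc n) {1..n} 1 k (B_lin n)"
  have M': "M' c = N (eta c)" if "c \<in> lat" for c
    using that \<phi>(2) eta_lat by (simp add: M'_def)
  have tf: "toric_frame (Suc n) F j M'"
    unfolding toric_frame_def using \<phi>(1) lattice_iso_eta M'_def by blast
  have fm: "frame_matrix F j M' i l = bil (eta (unit_vec i)) (eta (unit_vec l))"
    if il: "i \<in> {1..Suc n}" "l \<in> {1..Suc n}" for i l
    unfolding frame_matrix_def
  proof (rule frame_formI)
    have u: "unit_vec i \<in> lat" "unit_vec l \<in> lat" "unit_vec i + unit_vec l \<in> lat"
      using il by auto
    show "M' (unit_vec i) \<otimes> M' (unit_vec l)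
      = \<kappa> (q_half (bil (eta (unit_vec i)) (eta (unit_vec l)))) \<otimes> M' (unit_vec i + unit_vec l)"
      using u by (simp add: M' N_mult eta_lat eta_add)
    show "M' (unit_vec i + unit_vec l) \<in> carrier F" "M' (unit_vec i + unit_vec l) \<noteq> \<zero>"
      using u by (simp_all add: M' N_closed N_neq_zero eta_lat)
  qed
  have compat: "compatible_pair (Suc n) {1..n} (frame_matrix F j M') B'"
    unfolding compatible_pair_def
  proof (intro conjI ballI exI[of _ "\<lambda>_. 1"])
    fix i l assume "i \<in> {1..Suc n}" "l \<in> {1..Suc n}"
    then show "frame_matrix F j M' i l = - frame_matrix F j M' l i"
      by (simp only: fm) (rule bil_skew)
  next
    fix l i assume l: "l \<in> {1..n}" and i: "i \<in> {1..Suc n}"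
    have "(\<Sum>x\<in>{1..Suc n}. B' x l * frame_matrix F j M' x i)
        = (\<Sum>x\<in>{1..Suc n}. B' x l * bil (eta (unit_vec x)) (eta (unit_vec i)))"
      using i by (intro sum.cong refl) (simp only: fm)
    then show "(\<Sum>x\<in>{1..Suc n}. B' x l * frame_matrix F j M' x i) = (if i = l then 1 else 0)"
      using compatible_mutated[OF i l] by (simp only: B'_def)
  qed
  have M'k: "M' (unit_vec k) = j (short k)"
    using k by (simp add: M' N_eta_k)
  have M'i: "M' (unit_vec i) = tmon (unit_vec i)" if "i \<in> {1..Suc n} - {k}" for i
  proof -
    have "eta (unit_vec i) = unit_vec i" using that by (simp add: eta_def lookup_unit_vec)
    then show ?thesis using that by (simp add: M' N_eq_tmon lookup_unit_vec)
  qed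
  have "seed_mutation (Suc n) {1..n} F j k (initial_seed n j) (M', B')"
    unfolding seed_mutation_def initial_seed_def prod.case
  proof (intro conjI)
    show "quantum_seed (Suc n) {1..n} F j (M', B')"
      using tf compat by (simp add: quantum_seed_def)
    show "\<exists>eps\<in>{1, - 1}.
       (\<forall>i\<in>{1..Suc n}. \<forall>l\<in>{1..Suc n}. frame_matrix F j M' i l
          = mutate_form (Suc n) eps k (B_lin n) (frame_matrix F j tmon) i l) \<and>
       (\<forall>i\<in>{1..Suc n}. \<forall>l\<in>{1..n}. B' i l = mutate_exchange (Suc n) {1..n} eps k (B_lin n) i l)"
      by (intro bexI[of _ 1] conjI ballI) (simp_all only: fm bil_eta_unit B'_def insertI1)
    show "M' (unit_vec k) = mutated_variable (Suc n) F k (tmon, B_lin n)"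
      using M'k initial_mutated_variable[OF k] by (simp add: initial_seed_def)
  qed (use M'i in blast)
  then show ?thesis using M'k by auto
qed

end

section \<open>The presented algebra\<close>

interpretation free: twisted_monoid "lists G" "(@)" "[]" "\<lambda>_ _. 1" for G
  by unfold_locales auto

lemma free_algebra_simps:
  "carrier (free_algebra G) = {f. kys f \<subseteq> lists G}"
  "monoid.mult (free_algebra G) = twisted_mult (@) (\<lambda>_ _. 1)"
  "\<zero>\<^bsub>free_algebra G\<^esub> = 0"
  "ring.add (free_algebra G) = (+)"
  by (simp_all add: free_algebra_def free.alg_simps)

lemma free_algebra_ring: "Ring.ring (free_algebra G)"
  unfolding free_algebra_def by (rule free.is_ring)

abbreviation fmul :: "(nat list \<Rightarrow>\<^sub>0 laurent) \<Rightarrow> (nat list \<Rightarrow>\<^sub>0 laurent) \<Rightarrow> (nat list \<Rightarrow>\<^sub>0 laurent)"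
  where "fmul \<equiv> twisted_mult (@) (\<lambda>_ _. 1)"

lemma lookup_fmul_scale: "lkp (fmul (sgl [] x) g) w = x * lkp g w"
proof -
  have "kys g \<subseteq> UNIV" by simp
  then show ?thesis
    by (induction g rule: keys_subset_induct)
      (auto simp: twisted_mult_single twisted_mult_add_right lookup_add lookup_single when_def
        distrib_left)
qed

lemma keys_fmul_scale: "kys (fmul (sgl [] x) g) \<subseteq> kys g"
  by (auto simp: in_keys_iff lookup_fmul_scale)

subsection \<open>Ordered words span modulo straightening relations\<close>

text \<open>Each letter counts as often as there are letters from it to the end of the word. Both
  swapping and deleting the two letters of a descent lower this number.\<close>

fun weight :: "nat list \<Rightarrow> nat" where
  "weight [] = 0"
| "weight (x # xs) = Suc (length xs) * x + weight xs"

lemma weight_swap: "y < x \<Longrightarrow> weight (u @ y # x # v) < weight (u @ x # y # v)"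
  by (induction u) (auto simp: algebra_simps)

lemma weight_delete: "y < x \<Longrightarrow> weight (u @ v) < weight (u @ x # y # v)"
proof (induction u)
  case (Cons a u)
  then show ?case by (simp add: algebra_simps add_mono_thms_linordered_field)
qed (auto simp: algebra_simps)

lemma not_sorted_descent: "\<not> sorted w \<Longrightarrow> \<exists>u x y v. w = u @ x # y # v \<and> y < (x::nat)"
proof (induction w)
  case (Cons a w)
  show ?case
  proof (cases "sorted w")
    case True
    with Cons.prems obtain b v where "w = b # v" "b < a"
      by (cases w) auto
    then show ?thesis by (metis append_Nil)
  next
    case False
    with Cons.IH show ?thesis by (metis append_Cons)
  qed
qed simp

text \<open>The relation for a descent is multiplied on both sides by the rest of the word, and both
  resulting words have smaller weight. Only the shape of the relations matters, so the far and the
  adjacent ones are treated together.\<close>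

lemma straightening:
  assumes I: "ideal I (free_algebra G)"
    and rel: "\<And>x y. \<lbrakk>x \<in> G; y \<in> G; y < x\<rbrakk> \<Longrightarrow>
      \<exists>\<alpha> \<beta>. sgl [x, y] 1 - (sgl [y, x] \<alpha> + sgl [] \<beta>) \<in> I"
    and f: "kys f \<subseteq> lists G"
  shows "\<exists>g. kys g \<subseteq> {w \<in> lists G. sorted w} \<and> f - g \<in> I"
proof -
  interpret I: ideal I "free_algebra G" by (rule I)
  have I_add: "a + b \<in> I" if "a \<in> I" "b \<in> I" for a b
    using additive_subgroup.a_closed[OF ideal.axioms(1)[OF I] that] by (simp add: free_algebra_simps)
  have I_left: "fmul c a \<in> I" if "a \<in> I" "kys c \<subseteq> lists G" for a c
    using I.I_l_closed[of a c] that by (simp add: free_algebra_simps)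
  have I_right: "fmul a c \<in> I" if "a \<in> I" "kys c \<subseteq> lists G" for a c
    using I.I_r_closed[of a c] that by (simp add: free_algebra_simps)
  have zero: "0 \<in> I" using additive_subgroup.zero_closed[OF ideal.axioms(1)[OF I]] by (simp add: free_algebra_simps)
  have nil: "kys (sgl [] c) \<subseteq> lists G" for c :: laurent by simp
  let ?S = "{w \<in> lists G. sorted w}"
  have keys_comb: "kys (a + b) \<subseteq> ?S" if "kys a \<subseteq> ?S" "kys b \<subseteq> ?S" for a b :: "nat list \<Rightarrow>\<^sub>0 laurent"
    using that Poly_Mapping.keys_add[of a b] by blast
  have word: "w \<in> lists G \<Longrightarrow> \<exists>g. kys g \<subseteq> ?S \<and> sgl w 1 - g \<in> I" for w
  proof (induction "weight w" arbitrary: w rule: less_induct)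
    case less
    show ?case
    proof (cases "sorted w")
      case True
      then show ?thesis using less.prems zero by (intro exI[of _ "sgl w 1"]) auto
    next
      case False
      then obtain u x y v where w: "w = u @ x # y # v" "y < x"
        using not_sorted_descent by blast
      have G: "x \<in> G" "y \<in> G" "u \<in> lists G" "v \<in> lists G" using less.prems by (auto simp: w)
      obtain \<alpha> \<beta> where ab: "sgl [x, y] 1 - (sgl [y, x] \<alpha> + sgl [] \<beta>) \<in> I"
        using rel[OF G(1,2) w(2)] by blast
      let ?w1 = "u @ y # x # v" and ?w2 = "u @ v"
      have "fmul (fmul (sgl u 1) (sgl [x, y] 1 - (sgl [y, x] \<alpha> + sgl [] \<beta>))) (sgl v 1) \<in> I"
        using ab G by (intro I_right I_left) auto
      then have 1: "sgl w 1 - (sgl ?w1 \<alpha> + sgl ?w2 \<beta>) \<in> I"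
        by (simp add: twisted_mult_minus_right twisted_mult_minus_left twisted_mult_add_right
            twisted_mult_add_left twisted_mult_single w(1))
      obtain g1 where g1: "kys g1 \<subseteq> ?S" "sgl ?w1 1 - g1 \<in> I"
        using less.hyps[of ?w1] weight_swap[OF w(2)] G by (auto simp: w(1))
      obtain g2 where g2: "kys g2 \<subseteq> ?S" "sgl ?w2 1 - g2 \<in> I"
        using less.hyps[of ?w2] weight_delete[OF w(2)] G by (auto simp: w(1))
      have "fmul (sgl [] \<alpha>) (sgl ?w1 1 - g1) \<in> I" "fmul (sgl [] \<beta>) (sgl ?w2 1 - g2) \<in> I"
        by (rule I_left[OF g1(2) nil] I_left[OF g2(2) nil])+
      then have 2: "sgl ?w1 \<alpha> - fmul (sgl [] \<alpha>) g1 \<in> I" "sgl ?w2 \<beta> - fmul (sgl [] \<beta>) g2 \<in> I"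
        by (simp_all add: twisted_mult_minus_right twisted_mult_single)
      have "sgl w 1 - (fmul (sgl [] \<alpha>) g1 + fmul (sgl [] \<beta>) g2) \<in> I"
        using I_add[OF 1 I_add[OF 2]] by (simp add: algebra_simps)
      moreover have "kys (fmul (sgl [] \<alpha>) g1 + fmul (sgl [] \<beta>) g2) \<subseteq> ?S"
        using g1 g2 keys_fmul_scale by (intro keys_comb) blast+
      ultimately show ?thesis by blast
    qed
  qed
  show ?thesis using f
  proof (induction f rule: keys_subset_induct)
    case zero
    then show ?case using \<open>0 \<in> I\<close> by (intro exI[of _ 0]) auto
  next
    case (single w c)
    then obtain g where g: "kys g \<subseteq> ?S" "sgl w 1 - g \<in> I" using word by blast
    then have "fmul (sgl [] c) (sgl w 1 - g) \<in> I" by (intro I_left nil)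
    then have "sgl w c - fmul (sgl [] c) g \<in> I"
      by (simp add: twisted_mult_minus_right twisted_mult_single)
    then show ?case using g keys_fmul_scale by blast
  next
    case (add f f')
    then obtain g g' where g: "kys g \<subseteq> ?S" "f - g \<in> I" "kys g' \<subseteq> ?S" "f' - g' \<in> I" by blast
    have "(f + f') - (g + g') \<in> I" using I_add[OF g(2,4)] by (simp add: algebra_simps)
    then show ?case using keys_comb[OF g(1,3)] by blast
  qed
qed

section \<open>The isomorphism\<close>

text \<open>The higher exponent of the short chord at k, namely e_{k+1} - e_k with e_0 = 0.\<close>

definition lead_vec :: "nat \<Rightarrow> vec" where
  "lead_vec k = vtx (Suc (Suc k)) - vtx (Suc k)"

lemma chord_generator:
  "short k = sgl (lead_vec k) 1 + (if k = 0 then 0 else sgl (vtx k - vtx (Suc k)) 1)"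
proof (cases "k = 0")
  case True
  then show ?thesis by (simp add: chord_def chord_idx_def side_vec_def lead_vec_def)
next
  case False
  then show ?thesis by (simp add: chord_def chord_idx_def side_vec_def lead_vec_def)
qed

lemma height_lead_vec: "k \<le> n \<Longrightarrow> height n (lead_vec k) = 1"
  by (simp add: lead_vec_def height_diff height_vtx)

text \<open>The functionals dual to the vectors \<open>lead_vec\<close>, whose coordinates
  telescope. They read the multiplicity of a letter off the leading exponent of a word.\<close>

definition tail_sum :: "nat \<Rightarrow> nat \<Rightarrow> vec \<Rightarrow> int" where
  "tail_sum n s v = (\<Sum>i\<in>{Suc s..Suc n}. lkp v i)"

lemma tail_sum_add: "tail_sum n s (v + w) = tail_sum n s v + tail_sum n s w"
  by (simp add: tail_sum_def lookup_add sum.distrib)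

lemma tail_sum_lead:
  assumes "k \<le> n" shows "tail_sum n s (lead_vec k) = (if k = s then 1 else 0)"
proof -
  have vtx: "tail_sum n s (vtx v) = (if s + 2 \<le> v then 1 else 0)" if "v \<le> Suc (Suc n)" for v
  proof -
    have "tail_sum n s (vtx v) = (\<Sum>i\<in>{Suc s..Suc n}. if v - 1 = i then (if 2 \<le> v then 1 else 0) else 0)"
      unfolding tail_sum_def by (intro sum.cong) (auto simp: lookup_vtx)
    then show ?thesis using that by auto
  qed
  have "tail_sum n s (lead_vec k) = tail_sum n s (vtx (Suc (Suc k))) - tail_sum n s (vtx (Suc k))"
    by (simp add: lead_vec_def tail_sum_def lookup_minus sum_subtractf)
  then show ?thesis using assms by (auto simp: vtx)
qed

section \<open>Evaluation of words and their leading exponents\<close>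

context linear_torus
begin

abbreviation "gens \<equiv> KR_labels n"
abbreviation "free \<equiv> free_algebra gens"

definition pos :: "nat \<Rightarrow> nat" where
  "pos l = n - l div 2"

lemma pos_le: "pos l \<le> n"
  by (simp add: pos_def)

fun word_prod :: "nat list \<Rightarrow> (vec \<Rightarrow>\<^sub>0 laurent)" where
  "word_prod [] = sgl 0 1"
| "word_prod (l # w) = tmul (short (pos l)) (word_prod w)"

fun word_lead :: "nat list \<Rightarrow> vec" where
  "word_lead [] = 0"
| "word_lead (l # w) = lead_vec (pos l) + word_lead w"

lemma generator_keys: "kys (short (pos l)) \<subseteq> lat"
  using pos_le[of l] by (intro chord_keys) auto

lemma word_prod_keys: "kys (word_prod w) \<subseteq> lat"
  by (induction w) (simp_all add: tmul_closed generator_keys)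

lemma word_prod_append: "word_prod (u @ v) = tmul (word_prod u) (word_prod v)"
proof (induction u)
  case Nil
  then show ?case using torus.twisted_mult_unit(1)[OF word_prod_keys] by simp
next
  case (Cons l u)
  then show ?case
    using torus.twisted_mult_assoc[OF generator_keys word_prod_keys word_prod_keys] by simp
qed

text \<open>Exponents of greatest height add under multiplication, and their coefficients remain
  powers of q^(1/2), hence units.\<close>

lemma word_prod_lead:
  "(\<exists>u. lkp (word_prod w) (word_lead w) = q_half u) \<and>
   (\<forall>v. lkp (word_prod w) v \<noteq> 0 \<longrightarrow> v = word_lead w \<or> height n v < height n (word_lead w))"
proof (induction w)
  case Nil
  have "lkp (word_prod []) (word_lead []) = q_half 0" by simp
  then show ?case by (auto simp: lookup_single when_def simp del: q_half_0)
next
  case (Cons l w)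
  let ?k = "pos l" and ?P = "word_prod w" and ?e = "word_lead w"
  obtain u where u: "lkp ?P ?e = q_half u" using Cons.IH by blast
  have IH: "v = ?e \<or> height n v < height n ?e" if "lkp ?P v \<noteq> 0" for v using Cons.IH that by blast
  let ?f = "lead_vec ?k" and ?g = "vtx ?k - vtx (Suc ?k)"
  have hf: "height n ?f = 1" using height_lead_vec[OF pos_le] .
  have hg: "height n ?g = -1" if "?k \<noteq> 0"
    using that pos_le[of l] by (simp add: height_diff height_vtx)
  have lk: "lkp (word_prod (l # w)) v = q_half (bil ?f (v - ?f)) * lkp ?P (v - ?f)
      + (if ?k = 0 then 0 else q_half (bil ?g (v - ?g)) * lkp ?P (v - ?g))" for v
    by (simp add: chord_generator twisted_mult_add_left lookup_add lookup_single_mult)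
  \<comment> \<open>To reach the leading exponent, the lower monomial of the first factor would need
    a term two above the top height of the remaining product.\<close>
  have "lkp ?P (?f + ?e - ?g) = 0" if "?k \<noteq> 0"
  proof (rule ccontr)
    assume "lkp ?P (?f + ?e - ?g) \<noteq> 0"
    then have "?f + ?e - ?g = ?e \<or> height n (?f + ?e - ?g) < height n ?e" by (rule IH)
    then have "height n (?f + ?e - ?g) \<le> height n ?e" by (metis order_refl less_imp_le)
    moreover have "height n (?f + ?e - ?g) = height n ?e + 2"
      unfolding height_diff[of n "?f + ?e"] height_add hf hg[OF that] by simp
    ultimately show False by simp
  qed
  then have "lkp (word_prod (l # w)) (word_lead (l # w)) = q_half (bil ?f ?e + u)"
    unfolding lk by (simp add: u q_half_add)
  moreover have "v = word_lead (l # w) \<or> height n v < height n (word_lead (l # w))"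
    if v: "lkp (word_prod (l # w)) v \<noteq> 0" for v
  proof -
    consider "lkp ?P (v - ?f) \<noteq> 0" | "?k \<noteq> 0" "lkp ?P (v - ?g) \<noteq> 0"
    proof -
      have "lkp ?P (v - ?f) \<noteq> 0 \<or> (?k \<noteq> 0 \<and> lkp ?P (v - ?g) \<noteq> 0)"
      proof (rule ccontr)
        assume "\<not> ?thesis"
        then have z: "lkp ?P (v - ?f) = 0" "?k = 0 \<or> lkp ?P (v - ?g) = 0" by blast+
        from z(2) have "lkp (word_prod (l # w)) v = 0" unfolding lk z(1) by auto
        with v show False ..
      qed
      then show thesis using that by blast
    qed
    then show ?thesis
    proof cases
      case 1
      then have "v - ?f = ?e \<or> height n (v - ?f) < height n ?e" by (rule IH)
      then show ?thesis
      proof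
        assume "v - ?f = ?e"
        then have "v = ?f + ?e" by (metis add.commute diff_add_cancel)
        then show ?thesis by simp
      next
        assume "height n (v - ?f) < height n ?e"
        then show ?thesis using hf unfolding height_diff[of n v] word_lead.simps height_add by simp
      qed
    next
      case 2
      have "height n (v - ?g) \<le> height n ?e" using IH[OF 2(2)] by (metis order_refl less_imp_le)
      then have "height n v < height n (word_lead (l # w))"
        unfolding height_diff[of n v] hg[OF 2(1)] word_lead.simps height_add hf by simp
      then show ?thesis ..
    qed
  qed
  ultimately show ?case by blast
qed

lemma tail_sum_word_lead:
  "w \<in> lists gens \<Longrightarrow> s \<le> n \<Longrightarrow> tail_sum n s (word_lead w) = int (count (mset w) (2 * (n - s)))"
proof (induction w)
  case Nil
  then show ?case by (simp add: tail_sum_def)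
next
  case (Cons l w)
  then have "pos l = s \<longleftrightarrow> l = 2 * (n - s)" by (auto simp: KR_labels_def pos_def)
  then show ?case using Cons tail_sum_lead[OF pos_le] by (auto simp: tail_sum_add)
qed

text \<open>A sorted word is determined by the multiplicities of its letters, and these are values
  of \<open>tail_sum\<close>.\<close>

lemma word_lead_inj: "inj_on word_lead {w \<in> lists gens. sorted w}"
proof (rule inj_onI)
  fix v w assume v: "v \<in> {w \<in> lists gens. sorted w}" and w: "w \<in> {w \<in> lists gens. sorted w}"
    and eq: "word_lead v = word_lead w"
  have "count (mset v) l = count (mset w) l" for l
  proof (cases "l \<in> gens")
    case True
    then obtain k where k: "l = 2 * k" "k \<le> n" by (auto simp: KR_labels_def)
    then show ?thesis
      using tail_sum_word_lead[of v "n - k"] tail_sum_word_lead[of w "n - k"] v w eq by auto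
  next
    case False
    then have "l \<notin> set v" "l \<notin> set w" using v w by auto
    then show ?thesis by (metis not_in_iff set_mset_mset)
  qed
  then have "mset v = mset w" by (rule multiset_eqI)
  then have "sort v = w" using w by (intro properties_for_sort) auto
  moreover have "sort v = v" using v by (intro properties_for_sort) auto
  ultimately show "v = w" by simp
qed

lemma word_hom: "twisted_hom (lists gens) (@) [] (\<lambda>_ _. 1) F \<kappa> (\<lambda>w. j (word_prod w))"
proof (rule twisted_hom.intro)
  show "twisted_hom_axioms (lists gens) (@) [] (\<lambda>_ _. 1) F \<kappa> (\<lambda>w. j (word_prod w))"
  proof (rule twisted_hom_axioms.intro)
    show "r \<otimes> \<kappa> x = \<kappa> x \<otimes> r" if "r \<in> carrier F" for r x
      using that by (rule \<kappa>_central)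
    show "j (word_prod a) \<otimes> j (word_prod b) = \<kappa> 1 \<otimes> j (word_prod (a @ b))" for a b
      using word_prod_keys by (simp add: word_prod_append j_mult j_closed)
  qed (simp_all add: \<kappa>_add \<kappa>_mult word_prod_keys j_closed)
qed (rule free.twisted_monoid_axioms ring_axioms)+

sublocale word: twisted_hom "lists gens" "(@)" "[]" "\<lambda>_ _. 1" F \<kappa> "\<lambda>w. j (word_prod w)"
  by (rule word_hom)

definition eval_word :: "(nat list \<Rightarrow>\<^sub>0 laurent) \<Rightarrow> 'f" where
  "eval_word = word.ext"

lemma eval_hom: "eval_word \<in> ring_hom free F"
  using word.ext_hom by (simp add: eval_word_def free_algebra_def)

sublocale eval: ring_hom_ring free F eval_word
  using eval_hom by (intro ring_hom_ringI2 free_algebra_ring ring_axioms)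

lemma eval_single: "w \<in> lists gens \<Longrightarrow> eval_word (sgl w c) = \<kappa> c \<otimes> j (word_prod w)"
  unfolding eval_word_def by (rule word.ext_single)

lemma eval_eq_j:
  assumes "kys f \<subseteq> lists gens"
  shows "kys (\<Sum>w\<in>kys f. tmul (sgl 0 (lkp f w)) (word_prod w)) \<subseteq> lat"
    "eval_word f = j (\<Sum>w\<in>kys f. tmul (sgl 0 (lkp f w)) (word_prod w))"
proof -
  let ?s = "\<lambda>A. \<Sum>w\<in>A. tmul (sgl 0 (lkp f w)) (word_prod w)"
  have "kys (?s A) \<subseteq> lat \<and> finsum F (\<lambda>w. \<kappa> (lkp f w) \<otimes> j (word_prod w)) A = j (?s A)"
    if "finite A" for A
    using that
  proof (induction A)
    case empty
    then show ?case by simp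
  next
    case (insert w A)
    have k: "kys (tmul (sgl 0 (lkp f w)) (word_prod w)) \<subseteq> lat"
      by (intro tmul_closed word_prod_keys keys_coeff)
    have "finsum F (\<lambda>w. \<kappa> (lkp f w) \<otimes> j (word_prod w)) (insert w A)
      = \<kappa> (lkp f w) \<otimes> j (word_prod w) \<oplus> finsum F (\<lambda>w. \<kappa> (lkp f w) \<otimes> j (word_prod w)) A"
      using insert(1,2) by (intro finsum_insert) (auto intro!: m_closed j_closed word_prod_keys)
    also have "\<dots> = j (tmul (sgl 0 (lkp f w)) (word_prod w) + ?s A)"
      using insert(3) k by (simp add: j_add j_scale word_prod_keys)
    finally show ?case
      using insert k Poly_Mapping.keys_add[of "tmul (sgl 0 (lkp f w)) (word_prod w)" "?s A"]
      by auto
  qed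
  from this[of "kys f"] show "kys (?s (kys f)) \<subseteq> lat" "eval_word f = j (?s (kys f))"
    by (auto simp: eval_word_def word.ext_def)
qed

lemma eval_sorted_inj:
  assumes f: "kys f \<subseteq> {w \<in> lists gens. sorted w}" and zero: "eval_word f = \<zero>"
  shows "f = 0"
proof -
  have f': "kys f \<subseteq> lists gens" using f by auto
  have s0: "(\<Sum>w\<in>kys f. tmul (sgl 0 (lkp f w)) (word_prod w)) = 0"
    using j_eq_zero_iff[OF eval_eq_j(1)[OF f']] eval_eq_j(2)[OF f'] zero by argo
  have "lkp f w = 0" if "w \<in> kys f" for w
  \<comment> \<open>The height is negated: words have their leading exponent at the top, and the
    independence lemma expects it at the bottom.\<close>
  proof (rule triangular_independent[of "kys f" word_lead word_prod "\<lambda>v. - height n v" "lkp f",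
        OF _ _ _ _ _ that])
    show "inj_on word_lead (kys f)" using word_lead_inj f by (rule inj_on_subset)
    fix a v assume "lkp (word_prod a) v \<noteq> 0"
    then show "v = word_lead a \<or> - height n (word_lead a) < - height n v"
      using word_prod_lead[of a] by auto
  next
    fix a show "\<exists>u. lkp (word_prod a) (word_lead a) = q_half u" using word_prod_lead[of a] by blast
  next
    fix v
    have "lkp (\<Sum>w\<in>kys f. tmul (sgl 0 (lkp f w)) (word_prod w)) v = 0" by (simp only: s0 lookup_zero)
    then show "(\<Sum>a\<in>kys f. lkp f a * lkp (word_prod a) v) = 0"
      by (simp add: lookup_sum lookup_scale)
  qed simp
  then have "lkp f w = 0" for w by (cases "w \<in> kys f") (auto simp: in_keys_iff)
  then show "f = 0" by (simp add: poly_mapping_eqI)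
qed

lemma eval_diff_zero:
  assumes "kys f \<subseteq> lists gens" "kys g \<subseteq> lists gens" "eval_word f = eval_word g"
  shows "f - g \<in> a_kernel free F eval_word"
proof -
  have k: "kys (f - g) \<subseteq> lists gens" using assms keys_diff[of f g] by blast
  have "eval_word (f - g) \<oplus> eval_word g = eval_word (f - g + g)"
    unfolding eval_word_def by (rule word.ext_add[OF k assms(2), symmetric])
  then have "eval_word (f - g) \<oplus> eval_word g = eval_word g" using assms(3) by simp
  then have "eval_word (f - g) = \<zero>"
    using k assms word.ext_closed by (simp add: eval_word_def add.r_cancel_one)
  then show ?thesis unfolding a_kernel_def' free_algebra_simps using k by blast
qed

section \<open>Hernandez's relations for the short chords, and the kernel of the evaluation\<close>

lemma generators_far:
  assumes "a + 2 \<le> b" "b \<le> n"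
  shows "tmul (short a) (short b)
    = tmul (sgl 0 (q_pow ((-1) ^ (b - a)))) (tmul (short b) (short a))"
proof -
  let ?a2 = "Suc (Suc a)" and ?b2 = "Suc (Suc b)"
  have nc: "noncrossing a ?a2 b ?b2" using assms by (simp add: noncrossing_def)
  \<comment> \<open>For a short chord \<open>hsum\<close> is 1 or -1 by the parity of its start; the
    product of two such signs is the exponent in the far relation.\<close>
  have lam: "lam a ?a2 b ?b2 = (-1) ^ (b - a)"
    using assms by (cases "even a"; cases "even b") (auto simp: lam_def hsum_def)
  have keys: "kys (nprod a ?a2 b ?b2) \<subseteq> lat" using assms by (intro nprod_keys) auto
  let ?N = "nprod a ?a2 b ?b2" and ?l = "lam a ?a2 b ?b2"
  have 1: "tmul (chord a ?a2) (chord b ?b2) = tmul (sgl 0 (q_half ?l)) ?N"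
    using assms by (intro chord_mult_nprod) auto
  have 2: "tmul (chord b ?b2) (chord a ?a2) = tmul (sgl 0 (q_half (- ?l))) ?N"
    using assms chord_mult_nprod[of b ?b2 n a ?a2] nprod_sym[OF _ _ nc] lam_skew[OF _ _ nc] by simp
  have "tmul (sgl 0 (q_pow ?l)) (tmul (sgl 0 (q_half (- ?l))) ?N)
      = tmul (tmul (sgl 0 (q_pow ?l)) (sgl 0 (q_half (- ?l)))) ?N"
    using keys by (intro torus.twisted_mult_assoc[symmetric]) auto
  also have "\<dots> = tmul (sgl 0 (q_half ?l)) ?N"
    by (simp add: torus_mult_single q_pow_def flip: q_half_add)
  finally show ?thesis using 1 2 lam by simp
qed

text \<open>In the quadrilateral a, a + 1, a + 2, a + 3 the sides (a, a + 1) and (a + 2, a + 3) are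
  1, so the two orders of the diagonals are q^(-1/2) P + 1 and q^(1/2) P + 1 with the same P.
  Eliminating P leaves the constant 1 - q^(-1).\<close>

lemma generators_adjacent:
  assumes "Suc a \<le> n"
  shows "tmul (short a) (short (Suc a))
    = tmul (sgl 0 (q_pow (-1))) (tmul (short (Suc a)) (short a))
      + sgl 0 (1 - q_pow (-1))"
proof -
  let ?b = "Suc a" and ?c = "Suc (Suc a)" and ?d = "Suc (Suc (Suc a))"
  let ?P = "nprod ?b ?c a ?d"
  have keys: "kys ?P \<subseteq> lat" using assms by (intro nprod_keys) auto
  have lams: "lam a ?c ?b ?c + lam a ?c a ?d = -1" "lam ?b ?d ?b ?c + lam ?b ?d a ?d = 1"
    "lam a ?c a ?b + lam a ?c ?c ?d = 0" "lam ?b ?d a ?b + lam ?b ?d ?c ?d = 0" "lam a ?b ?c ?d = 0"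
    by (cases "even a"; simp add: lam_def hsum_def hdiff_def)+
  have "sgl 0 1 = tmul (chord a ?b) (chord ?c ?d)"
    using torus_mult_single[of "Suc n" Lambda_lin 0 1 0 1] by simp
  also have "\<dots> = nprod a ?b ?c ?d"
    using chord_mult_nprod[of a ?b n ?c ?d] assms lams(5)
      torus.twisted_mult_unit(1)[OF nprod_keys, of a ?b n ?c ?d] by simp
  finally have one: "nprod a ?b ?c ?d = sgl 0 1" by simp
  have 1: "tmul (chord a ?c) (chord ?b ?d) = tmul (sgl 0 (q_half (-1))) ?P + sgl 0 1"
    using ptolemy_ordered(1)[of a ?b ?c ?d n] assms
    by (simp add: lams one torus_mult_single)
  have 2: "tmul (chord ?b ?d) (chord a ?c) = tmul (sgl 0 (q_half 1)) ?P + sgl 0 1"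
    using ptolemy_ordered(2)[of a ?b ?c ?d n] assms
    by (simp add: lams one torus_mult_single)
  have "tmul (sgl 0 (q_pow (-1))) (tmul (sgl 0 (q_half 1)) ?P)
      = tmul (tmul (sgl 0 (q_pow (-1))) (sgl 0 (q_half 1))) ?P"
    using keys by (intro torus.twisted_mult_assoc[symmetric]) auto
  also have "\<dots> = tmul (sgl 0 (q_half (-1))) ?P"
    by (simp add: torus_mult_single q_pow_def flip: q_half_add)
  finally show ?thesis
    unfolding 1 2 twisted_mult_add_right
    by (simp add: torus_mult_single add.assoc flip: single_add)
qed

lemma word_prod_two:
  "word_prod [x, y] = tmul (short (pos x)) (short (pos y))"
  using torus.twisted_mult_unit(2)[OF generator_keys[of y]] by simp

lemma eval_two:
  assumes "x \<in> gens" "y \<in> gens"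
  shows "eval_word (sgl [x, y] c) = \<kappa> c \<otimes>
    j (tmul (short (pos x)) (short (pos y)))"
  unfolding word_prod_two[symmetric] using assms by (intro eval_single) simp

lemma eval_const: "eval_word (sgl [] c) = \<kappa> c"
  using eval_single[of "[]" c] by simp

lemma tmul_generators_keys:
  "kys (tmul (short (pos x)) (short (pos y))) \<subseteq> lat"
  by (intro tmul_closed generator_keys)

lemma far_relation:
  assumes "x \<in> gens" "y \<in> gens" "y < x" "x \<noteq> y + 2"
  shows "sgl [x, y] 1 - sgl [y, x] (q_pow ((- 1) ^ ((x - y) div 2))) \<in> a_kernel free F eval_word"
proof (rule eval_diff_zero)
  obtain a b where ab: "x = 2 * a" "y = 2 * b" "a \<le> n" "b \<le> n"
    using assms(1,2) by (auto simp: KR_labels_def)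
  \<comment> \<open>Positions run against labels: the larger label x has the smaller
    position.\<close>
  then have p: "pos x + 2 \<le> pos y" "pos y \<le> n" "pos y - pos x = (x - y) div 2"
    using assms(3,4) by (auto simp: pos_def)
  show "eval_word (sgl [x, y] 1) = eval_word (sgl [y, x] (q_pow ((- 1) ^ ((x - y) div 2))))"
    unfolding eval_two[OF assms(1,2)] eval_two[OF assms(2,1)] generators_far[OF p(1,2)] p(3)
      j_scale[OF tmul_generators_keys]
    by (simp add: j_closed tmul_generators_keys)
qed (use assms in auto)

lemma adjacent_relation:
  assumes "l \<in> gens" "l \<ge> 2"
  shows "sgl [l, l - 2] 1 - (sgl [l - 2, l] (q_pow (- 1)) + sgl [] (1 - q_pow (- 1)))
    \<in> a_kernel free F eval_word"
proof (rule eval_diff_zero)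
  obtain a where a: "l = 2 * a" "1 \<le> a" "a \<le> n"
    using assms by (auto simp: KR_labels_def)
  then have p: "pos (l - 2) = Suc (pos l)" "Suc (pos l) \<le> n"
    by (auto simp: pos_def)
  have l': "l - 2 \<in> gens" using a by (auto simp: KR_labels_def intro!: exI[of _ "a - 1"])
  have k: "kys (sgl [l - 2, l] (q_pow (- 1))) \<subseteq> lists gens"
    "kys (sgl [] (1 - q_pow (- 1)) :: nat list \<Rightarrow>\<^sub>0 laurent) \<subseteq> lists gens"
    using assms(1) l' by auto
  show "kys (sgl [l, l - 2] 1) \<subseteq> lists gens" using assms(1) l' by auto
  show "kys (sgl [l - 2, l] (q_pow (- 1)) + sgl [] (1 - q_pow (- 1))) \<subseteq> lists gens"
    using k Poly_Mapping.keys_add by (metis (no_types, lifting) Un_least subset_trans)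
  let ?Q = "tmul (short (Suc (pos l))) (short (pos l))"
  have Q: "kys ?Q \<subseteq> lat" using tmul_generators_keys[of "l - 2" l] by (simp add: p)
  have "eval_word (sgl [l, l - 2] 1)
      = j (tmul (sgl 0 (q_pow (-1))) ?Q + sgl 0 (1 - q_pow (-1)))"
    unfolding eval_two[OF assms(1) l'] p(1) generators_adjacent[OF p(2), symmetric]
    using tmul_generators_keys[of l "l - 2"] by (simp add: p(1) j_closed)
  also have "\<dots> = \<kappa> (q_pow (-1)) \<otimes> j ?Q \<oplus> \<kappa> (1 - q_pow (-1))"
    by (subst j_add[OF tmul_closed[OF keys_coeff Q] keys_coeff])
      (simp only: j_scale[OF Q] coeff_in_def)
  also have "\<dots> = eval_word (sgl [l - 2, l] (q_pow (- 1))) \<oplus> eval_word (sgl [] (1 - q_pow (- 1)))"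
    unfolding eval_two[OF l' assms(1)] eval_const p(1) ..
  also have "\<dots> = eval_word (sgl [l - 2, l] (q_pow (- 1)) + sgl [] (1 - q_pow (- 1)))"
    unfolding eval_word_def by (rule word.ext_add[OF k, symmetric])
  finally show "eval_word (sgl [l, l - 2] 1)
      = eval_word (sgl [l - 2, l] (q_pow (- 1)) + sgl [] (1 - q_pow (- 1)))" .
qed

lemma relations_in_kernel: "Rep_relations n \<subseteq> a_kernel free F eval_word"
  unfolding Rep_relations_def using far_relation adjacent_relation by blast

lemma kernel_subset: "a_kernel free F eval_word \<subseteq> carrier free"
  unfolding a_kernel_def' by blast

lemma Rep_ideal_ideal: "ideal (Rep_ideal n) free"
  unfolding Rep_ideal_def using relations_in_kernel kernel_subset
  by (intro eval.R.genideal_ideal) blast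

lemma relations_in_ideal: "Rep_relations n \<subseteq> Rep_ideal n"
  unfolding Rep_ideal_def using relations_in_kernel kernel_subset
  by (intro eval.R.genideal_self) blast

lemma kernel_eq: "a_kernel free F eval_word = Rep_ideal n"
proof
  show sub: "Rep_ideal n \<subseteq> a_kernel free F eval_word"
    unfolding Rep_ideal_def
    by (rule eval.R.genideal_minimal[OF eval.kernel_is_ideal relations_in_kernel])
  show "a_kernel free F eval_word \<subseteq> Rep_ideal n"
  proof
    fix f assume "f \<in> a_kernel free F eval_word"
    then have f: "kys f \<subseteq> lists gens" "eval_word f = \<zero>"
      unfolding a_kernel_def' free_algebra_simps by blast+
    have rel: "\<exists>\<alpha> \<beta>. sgl [x, y] 1 - (sgl [y, x] \<alpha> + sgl [] \<beta>) \<in> Rep_ideal n"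
      if xy: "x \<in> gens" "y \<in> gens" "y < x" for x y
    proof (cases "x = y + 2")
      case True
      then have "sgl [x, y] 1 - (sgl [y, x] (q_pow (- 1)) + sgl [] (1 - q_pow (- 1))) \<in> Rep_relations n"
        using xy unfolding Rep_relations_def by (intro UnI2 CollectI exI[of _ x]) simp
      then show ?thesis using relations_in_ideal by blast
    next
      case False
      then have "sgl [x, y] 1 - sgl [y, x] (q_pow ((- 1) ^ ((x - y) div 2))) \<in> Rep_relations n"
        using xy unfolding Rep_relations_def by (intro UnI1 CollectI exI[of _ x] exI[of _ y]) simp
      \<comment> \<open>The constant term 0 gives the far relations the shape that
        \<open>straightening\<close> expects.\<close>
      then have "sgl [x, y] 1 - (sgl [y, x] (q_pow ((- 1) ^ ((x - y) div 2))) + sgl [] 0) \<in> Rep_ideal n"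
        using relations_in_ideal by auto
      then show ?thesis by blast
    qed
    obtain g where g: "kys g \<subseteq> {w \<in> lists gens. sorted w}" "f - g \<in> Rep_ideal n"
      using straightening[OF Rep_ideal_ideal rel f(1)] by blast
    have g': "kys g \<subseteq> lists gens" using g by auto
    have fg: "kys (f - g) \<subseteq> lists gens" "eval_word (f - g) = \<zero>"
      using sub g(2) unfolding a_kernel_def' free_algebra_simps by blast+
    have "eval_word (f - g + g) = eval_word (f - g) \<oplus> eval_word g"
      unfolding eval_word_def by (rule word.ext_add[OF fg(1) g'])
    then have "eval_word g = \<zero>"
      using fg(2) f(2) word.ext_closed[OF g'] by (simp add: eval_word_def)
    then have "g = 0" by (rule eval_sorted_inj[OF g(1)])
    then show "f \<in> Rep_ideal n" using g(2) by simp
  qed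
qed

section \<open>The cluster algebra as the image of the evaluation\<close>

lemma X_var_eq:
  assumes "i \<le> n"
  shows "X_var n F j i = j (short (pos (2 * i)))"
proof (cases "i < n")
  case True
  then show ?thesis using initial_mutated_variable[of "n - i"] by (simp add: X_var_def pos_def)
next
  case False
  then have "i = n" using assms by simp
  \<comment> \<open>X_{2n} is Y_1, the chord (0, 2), which is the short chord at position 0.\<close>
  then show ?thesis by (simp add: X_var_def pos_def Y_var_def torus_monom_def chord_fan)
qed

lemma eval_generator:
  assumes "k \<le> n"
  shows "eval_word (sgl [2 * (n - k)] 1) = j (short k)" "2 * (n - k) \<in> gens"
proof -
  show l: "2 * (n - k) \<in> gens" by (auto simp: KR_labels_def)
  have "pos (2 * (n - k)) = k" using assms by (simp add: pos_def)
  then show "eval_word (sgl [2 * (n - k)] 1) = j (short k)"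
    using l eval_single[of "[2 * (n - k)]" 1] torus.twisted_mult_unit(2)[OF generator_keys[of "2 * (n - k)"]]
      j_closed[OF generator_keys[of "2 * (n - k)"]]
    by simp
qed

lemma image_subring: "subring (eval_word ` carrier free) F"
  using subring_iff[of "eval_word ` carrier free"] eval.img_is_ring eval.hom_closed by blast

text \<open>The inclusions use different seeds. That all seeds of the class consist of chords bounds
  the algebra from above; that the initial seed and its neighbours contain the short chords bounds
  it from below.\<close>

lemma A_alg_eq: "A_alg n F j = F\<lparr>carrier := eval_word ` carrier free\<rparr>"
proof -
  let ?s = "initial_seed n j"
  let ?C = "\<Union>t\<in>mutation_class (Suc n) {1..n} F j ?s. seed_cluster {1..n} t"
  let ?H = "range \<kappa> \<union> ?C \<union> frozen_variables (Suc n) {1..n} ?s"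
  let ?E = "eval_word ` carrier free"
  have E_coeff: "\<kappa> c \<in> ?E" for c
    using eval_const[of c] by (intro image_eqI[of _ _ "sgl [] c"]) (auto simp: free_algebra_simps)
  have E_gen: "j (short k) \<in> ?E" if "k \<le> n" for k
    using eval_generator[OF that]
    by (intro image_eqI[of _ _ "sgl [2 * (n - k)] 1"]) (auto simp: free_algebra_simps)
  have E_chord: "j (chord a b) \<in> ?E" if "a < b" "b \<le> Suc (Suc n)" for a b
    by (rule chord_in_subring[OF image_subring E_coeff E_gen that])
  have cluster: "seed_cluster {1..n} t \<subseteq> ?E" if t: "t \<in> mutation_class (Suc n) {1..n} F j ?s" for t
  proof
    fix x assume "x \<in> seed_cluster {1..n} t"
    then obtain i where i: "i \<in> {1..n}" "x = fst t (unit_vec i)"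
      by (cases t) (auto simp: seed_cluster_def)
    obtain d where d: "seed_labelling (fst t) d" "labelled n d (snd t)"
      using mutation_class_inv[OF t] by (auto simp: seed_inv_def)
    have i': "i \<in> {1..Suc n}" using i by simp
    obtain a b where "d i = (a, b)" "a < b" "b \<le> Suc (Suc n)"
      using d(2) i' unfolding labelled_def by blast
    moreover have "x = j (chord_of (d i))"
      using d(1) i' i(2) unfolding seed_labelling_def by blast
    ultimately show "x \<in> ?E" using E_chord by (simp add: chord_of_def)
  qed
  have frozen: "frozen_variables (Suc n) {1..n} ?s \<subseteq> ?E"
  proof
    fix x assume "x \<in> frozen_variables (Suc n) {1..n} ?s"
    then have "x = tmon (unit_vec (Suc n))"
      by (auto simp: frozen_variables_def initial_seed_def le_Suc_eq)
    then have "x = j (chord 0 (Suc (Suc n)))" by (simp add: torus_monom_def chord_fan)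
    then show "x \<in> ?E" using E_chord[of 0 "Suc (Suc n)"] by simp
  qed
  have HE: "?H \<subseteq> ?E" using E_coeff cluster frozen by blast
  have Ecar: "?E \<subseteq> carrier F" using eval.hom_closed by blast
  then have Hcar: "?H \<subseteq> carrier F" using HE by blast
  have gen_sub: "generate_ring F ?H \<subseteq> ?E"
    by (rule generate_ring_min_subring1[OF Hcar image_subring HE])
  have coeff_gen: "\<kappa> c \<in> generate_ring F ?H" for c by (rule generate_ring.incl) blast
  have Z_gen: "j (short k) \<in> generate_ring F ?H" if "k \<le> n" for k
  proof -
    have "j (short k) \<in> ?C"
    proof (cases "k = 0")
      \<comment> \<open>This chord is Y_1, a mutable variable because n is at least 1.\<close>
      case True
      have "?s \<in> mutation_class (Suc n) {1..n} F j ?s" by (simp add: mutation_class_def)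
      moreover have "j (chord 0 2) = tmon (unit_vec 1)"
        using chord_fan[of 1] by (simp add: torus_monom_def numeral_2_eq_2)
      then have "j (chord 0 2) \<in> seed_cluster {1..n} ?s"
        using n_pos by (auto simp: seed_cluster_def initial_seed_def)
      ultimately show ?thesis using True by (auto simp: numeral_2_eq_2)
    next
      case False
      then have k: "k \<in> {1..n}" using that by simp
      then interpret K: direction n F j k by unfold_locales
      obtain t where t: "seed_mutation (Suc n) {1..n} F j k ?s t"
        "fst t (unit_vec k) = j (short k)"
        using K.initial_seed_mutation by blast
      have "t \<in> mutation_class (Suc n) {1..n} F j ?s"
        unfolding mutation_class_def
        by (intro CollectI r_into_rtranclp) (use t(1) k in blast)
      moreover have "j (short k) \<in> seed_cluster {1..n} t"
        using t(2)[symmetric] k by (cases t) (auto simp: seed_cluster_def)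
      ultimately show ?thesis by blast
    qed
    then show ?thesis by (intro generate_ring.incl) blast
  qed
  have word_gen: "j (word_prod w) \<in> generate_ring F ?H" for w
  proof (induction w)
    case Nil
    show ?case using generate_ring.one[of F ?H] by simp
  next
    case (Cons l w)
    have "j (word_prod (l # w)) = j (short (pos l)) \<otimes> j (word_prod w)"
      by (simp add: j_mult generator_keys word_prod_keys)
    then show ?case using generate_ring.eng_mult[OF Z_gen[OF pos_le] Cons.IH] by simp
  qed
  have "eval_word f \<in> generate_ring F ?H" if "kys f \<subseteq> lists gens" for f
    using that
  proof (induction f rule: keys_subset_induct)
    case zero
    show ?case using zero_in_generate by (simp add: eval_word_def word.ext_zero)
  next
    case (single w c)
    show ?case unfolding eval_single[OF single] by (rule generate_ring.eng_mult[OF coeff_gen word_gen])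
  next
    case (add f g)
    then show ?case
      by (simp add: eval_word_def word.ext_add generate_ring.eng_add)
  qed
  then have "?E \<subseteq> generate_ring F ?H" by (auto simp: free_algebra_simps)
  with gen_sub have "generate_ring F ?H = ?E" by blast
  then show ?thesis by (simp add: A_alg_def quantum_cluster_algebra_def)
qed

end

theorem mainTheorem1:
  fixes n :: nat and F :: "'f ring" and j :: "'f embedding"
  assumes "n \<ge> 1"
    and "skew_field_of_fractions (quantum_torus (n + 1) Lambda_lin) F j"
  shows "\<exists>\<iota>. \<iota> \<in> ring_iso (A_alg n F j) (Rep_ring n)
    \<and> (\<forall>c. \<forall>x\<in>carrier (A_alg n F j).
          \<iota> (coeff_in j c \<otimes>\<^bsub>A_alg n F j\<^esub> x) = Rep_coeff n c \<otimes>\<^bsub>Rep_ring n\<^esub> \<iota> x)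
    \<and> (\<forall>i\<le>n. \<iota> (X_var n F j i) = KR_class n (2 * i))"
proof -
  interpret linear_torus n F j
    using assms by unfold_locales simp_all
  \<comment> \<open>Evaluation induces a map from the quotient of the free algebra onto the cluster
    algebra; \<iota> is its inverse.\<close>
  let ?g = "\<lambda>Y. the_elem (eval_word ` Y)"
  let ?\<iota> = "inv_into (carrier (Rep_ring n)) ?g"
  have g: "?g \<in> ring_iso (Rep_ring n) (A_alg n F j)"
    using eval.FactRing_iso_set_aux unfolding kernel_eq A_alg_eq Rep_ring_def .
  have Rep: "Ring.ring (Rep_ring n)"
    unfolding Rep_ring_def by (rule ideal.quotient_is_ring[OF Rep_ideal_ideal])
  have \<iota>: "?\<iota> \<in> ring_iso (A_alg n F j) (Rep_ring n)"
    by (rule ring_iso_set_sym[OF Rep g])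
  have \<iota>_eval: "?\<iota> (eval_word f) = Rep_ideal n +>\<^bsub>free\<^esub> f" if "kys f \<subseteq> lists gens" for f
  proof -
    have f: "f \<in> carrier free" using that by (simp add: free_algebra_simps)
    have val: "?g (Rep_ideal n +>\<^bsub>free\<^esub> f) = eval_word f"
      using eval.the_elem_simp[OF f] unfolding kernel_eq .
    have mem: "Rep_ideal n +>\<^bsub>free\<^esub> f \<in> carrier (Rep_ring n)"
      using f unfolding Rep_ring_def FactRing_def by (auto simp: A_RCOSETS_def')
    have inj: "inj_on ?g (carrier (Rep_ring n))"
      using g by (auto simp: ring_iso_def bij_betw_def)
    show ?thesis using inv_into_f_f[OF inj mem] unfolding val .
  qed
  \<comment> \<open>The coefficients are multiples of the empty word, so linearity follows from
    multiplicativity.\<close>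
  have coeff: "?\<iota> (\<kappa> c) = Rep_coeff n c" for c
    using \<iota>_eval[of "sgl [] c"] by (simp add: eval_const Rep_coeff_def)
  have "\<kappa> c \<in> carrier (A_alg n F j)" for c
  proof -
    have "sgl [] c \<in> carrier free" by (simp add: free_algebra_simps)
    then have "eval_word (sgl [] c) \<in> eval_word ` carrier free" by (rule imageI)
    then show ?thesis by (simp add: A_alg_eq eval_const)
  qed
  then have "?\<iota> (\<kappa> c \<otimes>\<^bsub>A_alg n F j\<^esub> x) = Rep_coeff n c \<otimes>\<^bsub>Rep_ring n\<^esub> ?\<iota> x"
    if "x \<in> carrier (A_alg n F j)" for c x
    using ring_iso_memE(2)[OF \<iota>, of "\<kappa> c" x] that coeff by simp
  moreover have "?\<iota> (X_var n F j i) = KR_class n (2 * i)" if "i \<le> n" for i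
  proof -
    have "X_var n F j i = eval_word (sgl [2 * i] 1)"
      using X_var_eq[OF that] eval_generator(1)[of "n - i"] that by (simp add: pos_def)
    moreover have "kys (sgl [2 * i] (1 :: laurent)) \<subseteq> lists gens"
      using that by (auto simp: KR_labels_def)
    ultimately show ?thesis using \<iota>_eval[of "sgl [2 * i] 1"] by (simp add: KR_class_def)
  qed
  ultimately show ?thesis using \<iota> by blast
qed

end
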